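(* Consider the noiseless mixed linear regression model with parameters $\beta_1^*,\beta_2^*\in\mathbb{R}^k$ and fractions $p_1,p_2$, and let $\widehat{c}$ be any constant with $0<\widehat{c}<1/2$. There are constants $c_1,c_2,c_3>0$, depending on $\widehat{c}$ and $\min\{p_1,p_2\}$ but not on the dimension $k$, such that the following holds. Suppose the grid resolution $\delta>0$ satisfies $$\delta\le \tfrac{2}{11}\,\widehat{c}\,\|\beta_1^*-\beta_2^*\|_2\,\bigl(\sqrt{\min\{p_1,p_2\}}\bigr)^3 ,$$ and the disjoint sample sets $\mathcal{S}_*$ and $\mathcal{S}_+$ satisfy $$|\mathcal{S}_*|\ge c_1\left(\frac{1}{\widetilde{\delta}}\right)^2k\log^2k,\qquad |\mathcal{S}_+|\ge\left(\frac{c_2}{\min\{p_1,p_2\}}\right)k,$$ where $$\widetilde{\delta}=\frac{\delta^2}{384}\left(1-\sqrt{1-4\bigl(1-\langle\beta_1^*,\beta_2^*\rangle^2\bigr)p_1p_2}\right).$$ Then, with probability at least $1-c_3k^{-2}$, the initialization procedure with resampling outputs a pair $(\beta_1^{(0)},\beta_2^{(0)})$ satisfying $$\mathrm{err}^{(0)}:=\max\{\|\beta_1^{(0)}-\beta_1^*\|_2,\|\beta_2^{(0)}-\beta_2^*\|_2\}\le \widehat{c}\,\min\{p_1,p_2\}\,\|\beta_1^*-\beta_2^*\|_2 .$$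
   Context: Noiseless mixed linear regression model: $\beta_1^*,\beta_2^*\in\mathbb{R}^k$ satisfy $\|\beta_1^*\|_2=\|\beta_2^*\|_2=1$ and $\beta_1^*\ne\pm\beta_2^*$ (so that $\widetilde\delta>0$ and $1/\widetilde\delta$ is defined). Samples are pairs $(y_i,\mathbf{x}_i)$, where the $\mathbf{x}_i\sim\mathcal{N}(0,I_k)$ are i.i.d. and $y_i=z_i\langle \mathbf{x}_i,\beta_1^*\rangle+(1-z_i)\langle\mathbf{x}_i,\beta_2^*\rangle$ with unobserved labels $z_i\in\{0,1\}$ not depending on the $\mathbf{x}_i$. The numbers $p_1,p_2>0$, $p_1+p_2=1$, are the fractions of observations that come from $\beta_1^*$ ($z_i=1$) and from $\beta_2^*$ ($z_i=0$) respectively. Initialization procedure with resampling (grid resolution $\delta$, samples partitioned into disjoint sets $\mathcal{S}_*,\mathcal{S}_+$): form $$M=\frac{1}{|\mathcal{S}_*|}\sum_{i\in\mathcal{S}_*}y_i^2\,\mathbf{x}_i\mathbf{x}_i^\top ,$$ let $\mathbf{v}_1,\mathbf{v}_2$ be orthonormal eigenvectors of $M$ for its two largest eigenvalues, form the grid $$G=\{\mathbf{v}_1\cos(\delta t)+\mathbf{v}_2\sin(\delta t): t=0,1,\dots,\lceil 2\pi/\delta\rceil\},$$ and output $(\beta_1^{(0)},\beta_2^{(0)})\in\arg\min_{\mathbf{u}_1,\mathbf{u}_2\in G}\mathcal{L}_+(\mathbf{u}_1,\mathbf{u}_2)$, where $$\mathcal{L}_+(\mathbf{u}_1,\mathbf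{u}_2)=\sum_{i\in\mathcal{S}_+}\min\{(y_i-\langle\mathbf{x}_i,\mathbf{u}_1\rangle)^2,(y_i-\langle\mathbf{x}_i,\mathbf{u}_2\rangle)^2\}.$$
   Formalization: Since the loss is symmetric in its two arguments, the bound is stated as: some output pair satisfies it, and every output pair satisfies it after possibly swapping its entries; the fractions p1, p2 are taken to be the exact label fractions in each of the two sample sets. *)

theory Defs
  imports "HOL-Probability.Probability" "Jordan_Normal_Form.Char_Poly"
begin

unbundle no vec_syntax

hide_const (open) Finite_Cartesian_Product.vec Finite_Cartesian_Product.mat
hide_type (open) Finite_Cartesian_Product.vec

no_notation inner (infix \<open>\<bullet>\<close> 70)

text \<open>Vectors in \<open>\<real>\<^sup>k\<close> are elements of \<^term>\<open>carrier_vec k\<close>, so that the dimension is a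
  term and constants can be chosen before it.\<close>

definition l2_norm :: "real vec \<Rightarrow> real" where
  "l2_norm v = sqrt (v \<bullet> v)"

definition response :: "real vec \<Rightarrow> real vec \<Rightarrow> real \<Rightarrow> real vec \<Rightarrow> real" where
  "response \<beta>1 \<beta>2 z x = z * (x \<bullet> \<beta>1) + (1 - z) * (x \<bullet> \<beta>2)"

text \<open>The labels may be deterministic or random; in either case they are jointly independent of
  the covariates. The fractions \<open>p1\<close>, \<open>p2\<close> are the exact fractions of the two
  labels in each of the two sample sets.\<close>

locale noiseless_mlr = prob_space M
  for M :: "'a measure"
    and k :: nat and \<beta>1 \<beta>2 :: "real vec" and p1 p2 :: real
    and Sstar Splus :: "nat set"
    and X :: "nat \<Rightarrow> 'a \<Rightarrow> real vec" and Z :: "nat \<Rightarrow> 'a \<Rightarrow> real" +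
  assumes beta_dim: "\<beta>1 \<in> carrier_vec k" "\<beta>2 \<in> carrier_vec k"
    and beta_norm: "l2_norm \<beta>1 = 1" "l2_norm \<beta>2 = 1"
    and beta_neq: "\<beta>1 \<noteq> \<beta>2" "\<beta>1 \<noteq> - \<beta>2"
    and fractions: "p1 > 0" "p2 > 0" "p1 + p2 = 1"
    and samples: "finite Sstar" "finite Splus" "Sstar \<inter> Splus = {}"
    and X_dim: "\<And>i \<omega>. i \<in> Sstar \<union> Splus \<Longrightarrow> \<omega> \<in> space M \<Longrightarrow> X i \<omega> \<in> carrier_vec k"
    and X_normal: "\<And>i j. i \<in> Sstar \<union> Splus \<Longrightarrow> j < k \<Longrightarrow>
      distributed M lborel (\<lambda>\<omega>. X i \<omega> $ j) std_normal_density"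
    and X_indep: "indep_vars (\<lambda>_. borel) (\<lambda>(i, j) \<omega>. X i \<omega> $ j) ((Sstar \<union> Splus) \<times> {..<k})"
    and Z_label: "\<And>i \<omega>. i \<in> Sstar \<union> Splus \<Longrightarrow> \<omega> \<in> space M \<Longrightarrow> Z i \<omega> \<in> {0, 1}"
    and Z_indep: "indep_set
      (sets (vimage_algebra (space M) (\<lambda>\<omega>. \<lambda>i\<in>Sstar \<union> Splus. Z i \<omega>)
        (Pi\<^sub>M (Sstar \<union> Splus) (\<lambda>_. borel))))
      (sets (vimage_algebra (space M)
        (\<lambda>\<omega>. \<lambda>(i, j)\<in>(Sstar \<union> Splus) \<times> {..<k}. X i \<omega> $ j)
        (Pi\<^sub>M ((Sstar \<union> Splus) \<times> {..<k}) (\<lambda>_. borel))))"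
    and Z_fraction: "\<And>S \<omega>. S \<in> {Sstar, Splus} \<Longrightarrow> \<omega> \<in> space M \<Longrightarrow>
      real (card {i \<in> S. Z i \<omega> = 1}) = p1 * real (card S) \<and>
      real (card {i \<in> S. Z i \<omega> = 0}) = p2 * real (card S)"

definition moment_matrix :: "nat \<Rightarrow> nat set \<Rightarrow> (nat \<Rightarrow> real) \<Rightarrow> (nat \<Rightarrow> real vec) \<Rightarrow> real mat" where
  "moment_matrix k S y x =
     mat k k (\<lambda>(a, b). (1 / real (card S)) * (\<Sum>i\<in>S. (y i)\<^sup>2 * (x i $ a * x i $ b)))"

text \<open>The list \<open>es\<close> consists of all eigenvalues with multiplicity, in decreasing order.\<close>

definition top_two_eigenvectors :: "real mat \<Rightarrow> real vec \<Rightarrow> real vec \<Rightarrow> bool" where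
  "top_two_eigenvectors A v1 v2 \<longleftrightarrow>
     v1 \<bullet> v1 = 1 \<and> v2 \<bullet> v2 = 1 \<and> v1 \<bullet> v2 = 0 \<and>
     (\<exists>es. char_poly A = (\<Prod>e\<leftarrow>es. [:- e, 1:]) \<and> sorted_wrt (\<ge>) es \<and> length es \<ge> 2 \<and>
        eigenvector A v1 (es ! 0) \<and> eigenvector A v2 (es ! 1))"

definition grid :: "real \<Rightarrow> real vec \<Rightarrow> real vec \<Rightarrow> real vec set" where
  "grid \<delta> v1 v2 =
     {cos (\<delta> * real t) \<cdot>\<^sub>v v1 + sin (\<delta> * real t) \<cdot>\<^sub>v v2 |t. t \<le> nat \<lceil>2 * pi / \<delta>\<rceil>}"

definition loss ::
  "nat set \<Rightarrow> (nat \<Rightarrow> real) \<Rightarrow> (nat \<Rightarrow> real vec) \<Rightarrow> real vec \<times> real vec \<Rightarrow> real" where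
  "loss S y x = (\<lambda>(u1, u2). \<Sum>i\<in>S. min ((y i - x i \<bullet> u1)\<^sup>2) ((y i - x i \<bullet> u2)\<^sup>2))"

text \<open>The possible outputs of the procedure, over all choices of eigenvectors and all
  minimisers.\<close>

definition init_output ::
  "nat \<Rightarrow> real \<Rightarrow> nat set \<Rightarrow> nat set \<Rightarrow> (nat \<Rightarrow> real) \<Rightarrow> (nat \<Rightarrow> real vec)
     \<Rightarrow> (real vec \<times> real vec) set" where
  "init_output k \<delta> Sstar Splus y x =
     {u. \<exists>v1 v2. top_two_eigenvectors (moment_matrix k Sstar y x) v1 v2 \<and>
           is_arg_min (loss Splus y x) (\<lambda>w. w \<in> grid \<delta> v1 v2 \<times> grid \<delta> v1 v2) u}"

definition err :: "real vec \<Rightarrow> real vec \<Rightarrow> real vec \<times> real vec \<Rightarrow> real" where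
  "err \<beta>1 \<beta>2 = (\<lambda>(u1, u2). max (l2_norm (u1 - \<beta>1)) (l2_norm (u2 - \<beta>2)))"

definition delta_tilde :: "real \<Rightarrow> real vec \<Rightarrow> real vec \<Rightarrow> real \<Rightarrow> real \<Rightarrow> real" where
  "delta_tilde \<delta> \<beta>1 \<beta>2 p1 p2 =
     \<delta>\<^sup>2 / 384 * (1 - sqrt (1 - 4 * (1 - (\<beta>1 \<bullet> \<beta>2)\<^sup>2) * p1 * p2))"

end

theory Submission
  imports Defs
begin

text \<open>
  Write \<open>a \<bullet> M a\<close> for the empirical second moment of the responses in direction \<open>a\<close>. Its expectation
  is \<open>1 + 2 p1 (\<beta>1 \<bullet> a)\<^sup>2 + 2 p2 (\<beta>2 \<bullet> a)\<^sup>2\<close> for unit \<open>a\<close>, and it concentrates uniformly to accuracy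
  \<open>\<eta> \<sim> \<delta>\<^sup>2\<close>: for fixed \<open>a\<close> by Chernoff bounds (for the upper tail after truncating the squared responses
  at a multiple of the logarithm of the sample size), and for all \<open>a\<close> by a net of \<open>exp (O(k))\<close> points.
  On the orthogonal complement of the \<open>\<beta>\<close>s the form is at most \<open>1 + \<eta>\<close>, so by Courant--Fischer it is at
  most \<open>1 + \<eta>\<close> on the complement of the two leading eigenvectors; comparing with the lower bound
  there, the \<open>\<beta>\<close>s have components of order \<open>\<delta>\<close> only outside the plane of the grid. No eigenvalue gap enters.
  Hence the grid contains points at distance of order \<open>\<delta>\<close> from \<open>\<beta>1\<close> and \<open>\<beta>2\<close>, whose loss is at
  most of order \<open>\<delta>\<^sup>2\<close> per sample. Conversely, for every direction at most a third of the samples of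
  either label have a small inner product with it, so the loss of a pair is at least a constant
  multiple of the squared distance of each \<open>\<beta>\<close> from the pair. The minimiser is thus close to both \<open>\<beta>\<close>s,
  and these are too far apart to be served by the same grid point.
\<close>

section \<open>Symmetric real matrices\<close>

text \<open>The product of a squared response and a squared projection is quartic in Gaussians, so
  it has no exponential moment of positive order and Chernoff cannot reach its upper tail directly;
  the lower tail is harmless because the product is nonnegative. Truncation costs a logarithm of the
  sample size, which the factor \<open>(ln k)\<^sup>2\<close> pays for, and the event that some
  response is truncated is the only one bounded by a power of \<open>k\<close> instead of an
  exponential.

  Constants, with p = min p1 p2: \<eta> = p \<delta>^2 / 100, so that division by p1 or p2 leaves a
  squared residual of at most \<delta>^2 / 100. Rounding the angle raises this to 27/100 \<delta>^2
  for a grid point. Comparing losses multiplies by 54 / p, and 54 * 27/100 * 4/121 < 1 is what the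
  factor 2/11 affords; of the three powers of p in the square of the bound on \<delta>, one pays for
  this division and two for the square of the target accuracy. The bound \<open>delta_tilde\<close>
  \<le> \<delta>^2 / 384 turns the condition on the first sample set into one on 1 / \<eta>.\<close>

lemma scalar_prod_self_nonneg: "0 \<le> v \<bullet> (v :: real vec)"
  by (auto simp: scalar_prod_def intro!: sum_nonneg)

lemma scalar_prod_self_eq_0_iff:
  assumes "v \<in> carrier_vec n"
  shows "v \<bullet> v = 0 \<longleftrightarrow> v = (0\<^sub>v n :: real vec)"
  using assms by (auto simp: scalar_prod_def sum_nonneg_eq_0_iff)

lemma scalar_prod_self_pos:
  assumes "v \<in> carrier_vec n" "v \<noteq> (0\<^sub>v n :: real vec)"
  shows "0 < v \<bullet> v"
  using scalar_prod_self_nonneg[of v] scalar_prod_self_eq_0_iff[OF assms(1)] assms(2) by linarith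

lemma scalar_prod_Cauchy_Schwarz:
  fixes u v :: "real vec"
  assumes "u \<in> carrier_vec n" "v \<in> carrier_vec n"
  shows "(u \<bullet> v)\<^sup>2 \<le> (u \<bullet> u) * (v \<bullet> v)"
  using assms Cauchy_Schwarz_ineq_sum[of "\<lambda>i. u $ i" "\<lambda>i. v $ i" "{0..<n}"]
  by (simp add: scalar_prod_def power2_eq_square)

lemma l2_norm_nonneg [simp]: "0 \<le> l2_norm v"
  by (simp add: l2_norm_def scalar_prod_self_nonneg)

lemma l2_norm_sq: "(l2_norm v)\<^sup>2 = v \<bullet> v"
  by (simp add: l2_norm_def scalar_prod_self_nonneg)

lemma l2_norm_le_iff: "0 \<le> c \<Longrightarrow> l2_norm v \<le> c \<longleftrightarrow> v \<bullet> v \<le> c\<^sup>2"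
  using power_mono_iff[of "l2_norm v" c 2] by (simp add: l2_norm_sq)

lemma l2_norm_one_iff: "l2_norm v = 1 \<longleftrightarrow> v \<bullet> v = 1"
  by (simp add: l2_norm_def)

lemma abs_scalar_prod_le:
  assumes "u \<in> carrier_vec n" "v \<in> carrier_vec n"
  shows "\<bar>u \<bullet> v\<bar> \<le> l2_norm u * l2_norm v"
proof -
  have "\<bar>u \<bullet> v\<bar>\<^sup>2 \<le> (l2_norm u * l2_norm v)\<^sup>2"
    using scalar_prod_Cauchy_Schwarz[OF assms] by (simp add: power_mult_distrib l2_norm_sq)
  then show ?thesis
    using power_mono_iff[of "\<bar>u \<bullet> v\<bar>" "l2_norm u * l2_norm v" 2] by simp
qed

lemma scalar_prod_add_self:
  assumes "u \<in> carrier_vec n" "v \<in> carrier_vec n"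
  shows "(u + v) \<bullet> (u + v) = u \<bullet> u + 2 * (u \<bullet> v) + v \<bullet> (v :: real vec)"
  using assms comm_scalar_prod[of v n u]
  by (simp add: add_scalar_prod_distrib[of _ n] scalar_prod_add_distrib[of _ n])

lemma scalar_prod_minus_self:
  assumes "u \<in> carrier_vec n" "v \<in> carrier_vec n"
  shows "(u - v) \<bullet> (u - v) = u \<bullet> u - 2 * (u \<bullet> v) + v \<bullet> (v :: real vec)"
  using assms comm_scalar_prod[of v n u]
  by (simp add: minus_scalar_prod_distrib[of _ n] scalar_prod_minus_distrib[of _ n])

lemma l2_norm_triangle:
  assumes "u \<in> carrier_vec n" "v \<in> carrier_vec n"
  shows "l2_norm (u + v) \<le> l2_norm u + l2_norm v"
proof -
  have "u \<bullet> v \<le> l2_norm u * l2_norm v" using abs_scalar_prod_le[OF assms] by linarith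
  then have "(u + v) \<bullet> (u + v) \<le> (l2_norm u + l2_norm v)\<^sup>2"
    by (simp add: scalar_prod_add_self[OF assms] power2_sum l2_norm_sq)
  then show ?thesis by (simp add: l2_norm_le_iff)
qed

lemma l2_norm_smult: "l2_norm (c \<cdot>\<^sub>v v) = \<bar>c\<bar> * l2_norm v"
proof -
  have "(c \<cdot>\<^sub>v v) \<bullet> (c \<cdot>\<^sub>v v) = c\<^sup>2 * (v \<bullet> v)"
    by (simp add: power2_eq_square)
  then show ?thesis by (simp add: l2_norm_def real_sqrt_mult)
qed

lemma l2_norm_minus_commute:
  assumes "u \<in> carrier_vec n" "v \<in> carrier_vec n"
  shows "l2_norm (u - v) = l2_norm (v - u)"
  unfolding l2_norm_def
  using comm_scalar_prod[of v n u] assms by (simp add: scalar_prod_minus_self[of _ n])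

lemma unit_normalize:
  assumes "v \<in> carrier_vec n" "v \<noteq> (0\<^sub>v n :: real vec)"
  defines "u \<equiv> (1 / l2_norm v) \<cdot>\<^sub>v v"
  shows "u \<in> carrier_vec n" "u \<bullet> u = 1" "v = l2_norm v \<cdot>\<^sub>v u" "l2_norm v > 0"
proof -
  show pos: "l2_norm v > 0"
    using scalar_prod_self_pos[OF assms(1,2)] by (simp add: l2_norm_def)
  show "u \<in> carrier_vec n" using assms by simp
  have "l2_norm u = 1" unfolding u_def l2_norm_smult using pos by simp
  then show "u \<bullet> u = 1" by (simp add: l2_norm_one_iff)
  show "v = l2_norm v \<cdot>\<^sub>v u" unfolding u_def using pos by (simp add: smult_smult_assoc)
qed

text \<open>The m functionals, padded with zero rows, form a square matrix whose row m vanishes; it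
  is singular, and a nonzero kernel vector solves the system.\<close>

lemma underdetermined_nonzero_solution:
  fixes f :: "nat \<Rightarrow> 'a :: field vec"
  assumes "m < n" and f: "\<And>i. i < m \<Longrightarrow> f i \<in> carrier_vec n"
  obtains v where "v \<in> carrier_vec n" "v \<noteq> 0\<^sub>v n" "\<And>i. i < m \<Longrightarrow> f i \<bullet> v = 0"
proof -
  define c where "c i = (if i < m then f i else 0\<^sub>v n)" for i
  define A where "A = mat\<^sub>r n n (\<lambda>i. if i = m then 0\<^sub>v n else c i)"
  have "det A = 0" unfolding A_def
    by (rule det_row_0) (use assms in \<open>auto simp: c_def\<close>)
  moreover have A: "A \<in> carrier_mat n n" by (simp add: A_def)
  ultimately obtain v where v: "v \<in> carrier_vec n" "v \<noteq> 0\<^sub>v n" "A *\<^sub>v v = 0\<^sub>v n"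
    using det_0_iff_vec_prod_zero[OF A] by auto
  have "f i \<bullet> v = 0" if "i < m" for i
  proof -
    have "(A *\<^sub>v v) $ i = row A i \<bullet> v" using A that assms(1) by simp
    also have "row A i = f i" using that assms by (simp add: A_def c_def)
    finally show ?thesis using v(3) that assms(1) by simp
  qed
  then show thesis using that v by blast
qed

text \<open>Vectors are represented by coordinate functions extended by zero, so that the set is a
  product of compact intervals and singletons and Tychonoff applies. The unit sphere will be a
  closed subset of it.\<close>

lemma compact_unit_functions:
  "compact {f :: nat \<Rightarrow> real. (\<forall>i<n. \<bar>f i\<bar> \<le> 1) \<and> (\<forall>i\<ge>n. f i = 0)}" (is "compact ?K")
proof -
  let ?S = "\<lambda>i. if i < n then {-1..1} else {0 :: real}"
  have eq: "f \<in> ?K \<longleftrightarrow> f \<in> Pi\<^sub>E UNIV ?S" for f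
  proof -
    have "f i \<in> ?S i \<longleftrightarrow> (i < n \<longrightarrow> \<bar>f i\<bar> \<le> 1) \<and> (i \<ge> n \<longrightarrow> f i = 0)" for i
      by (auto simp: abs_le_iff)
    then show ?thesis unfolding PiE_UNIV_domain Pi_iff mem_Collect_eq by blast
  qed
  have "?K = Pi\<^sub>E UNIV ?S" by (rule Set.set_eqI) (rule eq)
  moreover have "compactin (product_topology (\<lambda>i. euclidean) UNIV) (Pi\<^sub>E UNIV ?S)"
    unfolding compactin_PiE by auto
  ultimately show ?thesis by (simp add: euclidean_product_topology)
qed

section \<open>Orthonormal eigenbases of symmetric matrices\<close>

lemma symmetric_scalar_prod:
  fixes A :: "real mat"
  assumes A: "A \<in> carrier_mat n n" and sym: "transpose_mat A = A"
    and u: "u \<in> carrier_vec n" and v: "v \<in> carrier_vec n"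
  shows "u \<bullet> (A *\<^sub>v v) = (A *\<^sub>v u) \<bullet> v"
  using transpose_vec_mult_scalar[OF A v u] sym by simp

text \<open>The quadratic form attains its maximum on the unit sphere of the orthogonal complement of
  the given eigenvectors; the maximiser is a further eigenvector.\<close>

lemma next_eigenvector:
  fixes A :: "real mat"
  assumes A: "A \<in> carrier_mat n n" and sym: "transpose_mat A = A"
    and "m < n" and f: "\<And>i. i < m \<Longrightarrow> f i \<in> carrier_vec n"
    and ev: "\<And>i. i < m \<Longrightarrow> A *\<^sub>v f i = d i \<cdot>\<^sub>v f i"
  obtains w \<mu> where "w \<in> carrier_vec n" "w \<bullet> w = 1" "\<And>i. i < m \<Longrightarrow> f i \<bullet> w = 0"
    "A *\<^sub>v w = \<mu> \<cdot>\<^sub>v w"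
    "\<And>u. u \<in> carrier_vec n \<Longrightarrow> (\<And>i. i < m \<Longrightarrow> f i \<bullet> u = 0) \<Longrightarrow> u \<bullet> (A *\<^sub>v u) \<le> \<mu> * (u \<bullet> u)"
proof -
  \<comment> \<open>\<open>V\<close> is invariant under \<open>A\<close>, because \<open>A\<close>
    is symmetric and the \<open>f i\<close> are eigenvectors. The residual of the maximiser
    therefore stays in \<open>V\<close> and may serve as a direction of variation.\<close>
  define V where "V = {u \<in> carrier_vec n. \<forall>i<m. f i \<bullet> u = 0}"
  have V_add: "u + v \<in> V" if "u \<in> V" "v \<in> V" for u v
    using that f by (auto simp: V_def scalar_prod_add_distrib[of _ n])
  have V_smult: "c \<cdot>\<^sub>v u \<in> V" if "u \<in> V" for u c
    using that f by (auto simp: V_def)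
  have V_A: "A *\<^sub>v u \<in> V" if "u \<in> V" for u
    using that f A by (auto simp: V_def symmetric_scalar_prod[OF A sym] ev)
  define K where "K = {g :: nat \<Rightarrow> real. (\<forall>i<n. \<bar>g i\<bar> \<le> 1) \<and> (\<forall>i\<ge>n. g i = 0)}
     \<inter> {g. (\<Sum>i<n. (g i)\<^sup>2) = 1} \<inter> {g. \<forall>i<m. (\<Sum>j<n. f i $ j * g j) = 0}"
  define q where "q g = (\<Sum>i<n. g i * (\<Sum>j<n. A $$ (i, j) * g j))" for g :: "nat \<Rightarrow> real"
  have cont: "continuous_on S (\<lambda>g :: nat \<Rightarrow> real. g i)" for S i
    by (rule continuous_on_subset[OF continuous_on_product_coordinates]) simp
  have "closed {g :: nat \<Rightarrow> real. (\<Sum>i<n. (g i)\<^sup>2) = 1}"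
    by (intro closed_Collect_eq continuous_intros cont)
  moreover have "closed {g. \<forall>i<m. (\<Sum>j<n. f i $ j * g j) = 0}"
    by (intro closed_Collect_all closed_Collect_imp closed_Collect_eq continuous_intros cont) auto
  ultimately have "compact K" unfolding K_def
    by (intro compact_Int_closed compact_unit_functions) auto
  have q: "vec n g \<bullet> (A *\<^sub>v vec n g) = q g" for g
    using A by (simp add: q_def scalar_prod_def mult_mat_vec_def row_def lessThan_atLeast0)
  have in_K: "(\<lambda>i. if i < n then u $ i else 0) \<in> K" (is "?g \<in> K")
    if "u \<in> V" "u \<bullet> u = 1" for u
  proof -
    have d: "dim_vec u = n" using that(1) by (auto simp: V_def)
    have s: "(\<Sum>i<n. (u $ i)\<^sup>2) = 1"
      using that(2) d by (simp add: scalar_prod_def lessThan_atLeast0 power2_eq_square)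
    have "\<bar>u $ i\<bar> \<le> 1" if "i < n" for i
    proof -
      have "(u $ i)\<^sup>2 \<le> (\<Sum>i<n. (u $ i)\<^sup>2)"
        using that by (intro member_le_sum) auto
      then show ?thesis using s by (simp add: abs_square_le_1)
    qed
    moreover have "(\<Sum>j<n. f i $ j * ?g j) = 0" if "i < m" for i
    proof -
      have "(\<Sum>j<n. f i $ j * ?g j) = f i \<bullet> u"
        using d by (simp add: scalar_prod_def lessThan_atLeast0)
      then show ?thesis using that \<open>u \<in> V\<close> by (simp add: V_def)
    qed
    ultimately show ?thesis using s by (simp add: K_def)
  qed
  have vec_in_V: "vec n g \<in> V" "vec n g \<bullet> vec n g = 1" if "g \<in> K" for g
  proof -
    have "f i \<bullet> vec n g = (\<Sum>j<n. f i $ j * g j)" for i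
      by (simp add: scalar_prod_def lessThan_atLeast0)
    then show "vec n g \<in> V" using that by (auto simp: V_def K_def)
    show "vec n g \<bullet> vec n g = 1" using that
      by (simp add: scalar_prod_def lessThan_atLeast0 K_def power2_eq_square)
  qed
  obtain v0 where v0: "v0 \<in> carrier_vec n" "v0 \<noteq> 0\<^sub>v n" "\<And>i. i < m \<Longrightarrow> f i \<bullet> v0 = 0"
    using underdetermined_nonzero_solution[where f = f, OF \<open>m < n\<close> f] by blast
  have "v0 \<in> V" using v0 by (simp add: V_def)
  then have "K \<noteq> {}" using in_K[OF V_smult unit_normalize(2)[OF v0(1,2)]] by blast
  moreover have "continuous_on K q" unfolding q_def by (intro continuous_intros cont)
  ultimately obtain g where g: "g \<in> K" "\<And>h. h \<in> K \<Longrightarrow> q h \<le> q g"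
    using continuous_attains_sup[OF \<open>compact K\<close>] by blast
  define w where "w = vec n g"
  define \<mu> where "\<mu> = w \<bullet> (A *\<^sub>v w)"
  have w: "w \<in> V" "w \<bullet> w = 1" using vec_in_V[OF g(1)] by (auto simp: w_def)
  then have wc: "w \<in> carrier_vec n" by (simp add: V_def)
  have unit: "u \<bullet> (A *\<^sub>v u) \<le> \<mu>" if "u \<in> V" "u \<bullet> u = 1" for u
  proof -
    have "u = vec n (\<lambda>i. if i < n then u $ i else 0)"
      using that(1) by (intro eq_vecI) (auto simp: V_def)
    then have "u \<bullet> (A *\<^sub>v u) = q (\<lambda>i. if i < n then u $ i else 0)" using q by metis
    then show ?thesis using g(2)[OF in_K[OF that]] q[of g] by (simp add: \<mu>_def w_def)
  qed
  have max: "u \<bullet> (A *\<^sub>v u) \<le> \<mu> * (u \<bullet> u)" if "u \<in> V" for u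
  proof (cases "u = 0\<^sub>v n")
    case True
    then show ?thesis using A by simp
  next
    case False
    have uc: "u \<in> carrier_vec n" using that by (simp add: V_def)
    note un = unit_normalize[OF uc False]
    let ?u = "(1 / l2_norm u) \<cdot>\<^sub>v u"
    have "?u \<bullet> (A *\<^sub>v ?u) \<le> \<mu>" using unit[OF V_smult[OF that] un(2)] .
    moreover have "?u \<bullet> (A *\<^sub>v ?u) = (u \<bullet> (A *\<^sub>v u)) / (l2_norm u)\<^sup>2"
      using uc A by (simp add: mult_mat_vec[of _ n n] power2_eq_square)
    ultimately have "(u \<bullet> (A *\<^sub>v u)) / (u \<bullet> u) \<le> \<mu>" by (simp add: l2_norm_sq)
    then show ?thesis using scalar_prod_self_pos[OF uc False] by (simp add: pos_divide_le_eq)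
  qed
  define r where "r = A *\<^sub>v w - \<mu> \<cdot>\<^sub>v w"
  have Awc: "A *\<^sub>v w \<in> carrier_vec n" using A wc by simp
  have r_eq: "r = A *\<^sub>v w + (- \<mu>) \<cdot>\<^sub>v w" unfolding r_def using wc Awc
    by (intro eq_vecI) auto
  have rV: "r \<in> V" unfolding r_eq using w V_A V_smult V_add by blast
  then have rc: "r \<in> carrier_vec n" by (simp add: V_def)
  \<comment> \<open>First variation: along \<open>w + t r\<close> the quantity
    \<open>u \<bullet> A u - \<mu> (u \<bullet> u)\<close> grows like
    \<open>2 t (r \<bullet> r)\<close> to first order, but it is never positive on
    \<open>V\<close>.\<close>
  have "r \<bullet> r = 0"
  proof (rule ccontr)
    assume "r \<bullet> r \<noteq> 0"
    then have pos: "r \<bullet> r > 0" using scalar_prod_self_nonneg[of r] by linarith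
    define C where "C = r \<bullet> (A *\<^sub>v r) - \<mu> * (r \<bullet> r)"
    have Arc: "A *\<^sub>v r \<in> carrier_vec n" using A rc by simp
    have key: "2 * t * (r \<bullet> r) + t\<^sup>2 * C \<le> 0" for t
    proof -
      let ?u = "w + t \<cdot>\<^sub>v r"
      have uV: "?u \<in> V" using w rV V_smult V_add by blast
      have wr: "w \<bullet> (A *\<^sub>v r) = r \<bullet> (A *\<^sub>v w)"
        using symmetric_scalar_prod[OF A sym wc rc] comm_scalar_prod[OF Awc rc] by simp
      have Au: "A *\<^sub>v ?u = A *\<^sub>v w + t \<cdot>\<^sub>v (A *\<^sub>v r)"
        using A wc rc by (simp add: mult_add_distrib_mat_vec[of _ n n] mult_mat_vec[of _ n n])
      have 1: "?u \<bullet> (A *\<^sub>v ?u) = \<mu> + 2 * t * (r \<bullet> (A *\<^sub>v w)) + t\<^sup>2 * (r \<bullet> (A *\<^sub>v r))"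
        unfolding Au using wc rc Awc Arc wr
        by (simp add: add_scalar_prod_distrib[of _ n] scalar_prod_add_distrib[of _ n] \<mu>_def
            power2_eq_square algebra_simps)
      have 2: "?u \<bullet> ?u = 1 + 2 * t * (r \<bullet> w) + t\<^sup>2 * (r \<bullet> r)"
        using wc rc w(2) comm_scalar_prod[OF wc rc]
        by (simp add: scalar_prod_add_self[of _ n] power2_eq_square)
      have 3: "r \<bullet> (A *\<^sub>v w) - \<mu> * (r \<bullet> w) = r \<bullet> r"
        using rc wc Awc by (subst (4) r_def) (simp add: scalar_prod_minus_distrib[of _ n])
      have "?u \<bullet> (A *\<^sub>v ?u) - \<mu> * (?u \<bullet> ?u)
          = 2 * t * (r \<bullet> (A *\<^sub>v w) - \<mu> * (r \<bullet> w)) + t\<^sup>2 * C"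
        unfolding 1 2 C_def by (simp add: algebra_simps)
      then show ?thesis using max[OF uV] unfolding 3 by linarith
    qed
    \<comment> \<open>Small enough that the quadratic term is at most half of the linear one in
      absolute value.\<close>
    define t where "t = (r \<bullet> r) / (\<bar>C\<bar> + 1)"
    have t: "t > 0" "t * \<bar>C\<bar> \<le> r \<bullet> r" using pos by (auto simp: t_def field_simps)
    have "t\<^sup>2 * C \<ge> - (t * (r \<bullet> r))"
    proof -
      have "t * (t * \<bar>C\<bar>) \<le> t * (r \<bullet> r)" using t by (intro mult_left_mono) auto
      moreover have "- (t * (t * \<bar>C\<bar>)) \<le> t * (t * C)" using t(1)
        by (metis abs_ge_minus_self abs_mult abs_of_pos minus_le_iff)
      ultimately show ?thesis by (simp add: power2_eq_square mult.assoc)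
    qed
    moreover have "t * (r \<bullet> r) > 0" using t pos by simp
    ultimately show False using key[of t] by linarith
  qed
  then have "r = 0\<^sub>v n" using scalar_prod_self_eq_0_iff[OF rc] by simp
  then have "A *\<^sub>v w = \<mu> \<cdot>\<^sub>v w"
  proof -
    have "(A *\<^sub>v w) $ i = (\<mu> \<cdot>\<^sub>v w) $ i" if "i < n" for i
      using arg_cong[OF \<open>r = 0\<^sub>v n\<close>, of "\<lambda>v. v $ i"] that wc Awc by (simp add: r_def)
    then show ?thesis using A wc Awc by (intro eq_vecI) auto
  qed
  then show thesis using that[of w \<mu>] w wc max by (auto simp: V_def)
qed

definition orthonormal_eigensystem :: "nat \<Rightarrow> real mat \<Rightarrow> nat \<Rightarrow> (nat \<Rightarrow> real vec) \<Rightarrow> (nat \<Rightarrow> real) \<Rightarrow> bool" where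
  "orthonormal_eigensystem n A m f d \<longleftrightarrow>
     (\<forall>i<m. f i \<in> carrier_vec n \<and> A *\<^sub>v f i = d i \<cdot>\<^sub>v f i) \<and>
     (\<forall>i<m. \<forall>j<m. f i \<bullet> f j = (if i = j then 1 else 0))"

text \<open>Each added vector maximises the quadratic form on the complement of all its
  predecessors, by repeated use of \<open>next_eigenvector\<close>. The variational clause concerns
  the added indices only, since the given eigenpairs are arbitrary. With m = 0 this is the spectral
  theorem; with m = 2 it completes whichever two leading eigenvectors the procedure has picked, also
  when eigenvalues coincide.\<close>

lemma extend_eigensystem:
  fixes A :: "real mat"
  assumes A: "A \<in> carrier_mat n n" and sym: "transpose_mat A = A"
    and "m \<le> n" and "orthonormal_eigensystem n A m f d"
  shows "\<exists>f' d'. orthonormal_eigensystem n A n f' d' \<and> (\<forall>i<m. f' i = f i \<and> d' i = d i) \<and>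
    (\<forall>i u. m \<le> i \<longrightarrow> i < n \<longrightarrow> u \<in> carrier_vec n \<longrightarrow> (\<forall>j<i. f' j \<bullet> u = 0) \<longrightarrow>
       u \<bullet> (A *\<^sub>v u) \<le> d' i * (u \<bullet> u))"
  using assms(3,4)
proof (induction "n - m" arbitrary: m f d)
  case 0
  then show ?case by (intro exI[of _ f] exI[of _ d]) auto
next
  case (Suc l)
  then have mn: "m < n" by simp
  have f: "\<And>i. i < m \<Longrightarrow> f i \<in> carrier_vec n" "\<And>i. i < m \<Longrightarrow> A *\<^sub>v f i = d i \<cdot>\<^sub>v f i"
    using Suc.prems by (auto simp: orthonormal_eigensystem_def)
  obtain w \<mu> where w: "w \<in> carrier_vec n" "w \<bullet> w = 1" "\<And>i. i < m \<Longrightarrow> f i \<bullet> w = 0"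
    "A *\<^sub>v w = \<mu> \<cdot>\<^sub>v w"
    "\<And>u. u \<in> carrier_vec n \<Longrightarrow> (\<And>i. i < m \<Longrightarrow> f i \<bullet> u = 0) \<Longrightarrow> u \<bullet> (A *\<^sub>v u) \<le> \<mu> * (u \<bullet> u)"
    using next_eigenvector[where f = f and m = m, OF A sym mn f] by blast
  have w': "w \<bullet> f i = 0" if "i < m" for i
    using w(3)[OF that] comm_scalar_prod[OF w(1) f(1)[OF that]] by simp
  have sys: "orthonormal_eigensystem n A (Suc m) (f(m := w)) (d(m := \<mu>))"
    using Suc.prems w w' by (auto simp: orthonormal_eigensystem_def less_Suc_eq)
  have "l = n - Suc m" using Suc.hyps(2) by simp
  from Suc.hyps(1)[OF this _ sys] mn obtain f' d' where
    f': "orthonormal_eigensystem n A n f' d'"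
      "\<forall>i<Suc m. f' i = (f(m := w)) i \<and> d' i = (d(m := \<mu>)) i"
      "\<forall>i u. Suc m \<le> i \<longrightarrow> i < n \<longrightarrow> u \<in> carrier_vec n \<longrightarrow> (\<forall>j<i. f' j \<bullet> u = 0) \<longrightarrow>
         u \<bullet> (A *\<^sub>v u) \<le> d' i * (u \<bullet> u)"
    by (metis Suc_leI)
  have "u \<bullet> (A *\<^sub>v u) \<le> d' i * (u \<bullet> u)"
    if "m \<le> i" "i < n" "u \<in> carrier_vec n" "\<forall>j<i. f' j \<bullet> u = 0" for i u
  proof (cases "i = m")
    case True
    have "f j \<bullet> u = 0" if "j < m" for j
      using f'(2) that \<open>\<forall>j<i. f' j \<bullet> u = 0\<close> True by (metis fun_upd_other less_Suc_eq nat_neq_iff)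
    then show ?thesis using w(5)[OF that(3)] f'(2) True by simp
  qed (use f'(3) that in simp)
  moreover have "f' i = f i \<and> d' i = d i" if "i < m" for i using f'(2) that by simp
  ultimately show ?case using f'(1) by blast
qed

text \<open>With the eigenvectors as columns of \<open>P\<close>, the eigenvalue equations say
  \<open>A * P = P * D\<close> column by column, and a left inverse of a square matrix is also a
  right inverse.\<close>

lemma eigensystem_matrices:
  assumes A: "A \<in> carrier_mat n n" and sys: "orthonormal_eigensystem n A n f d"
  defines "P \<equiv> mat n n (\<lambda>(i, j). f j $ i)"
  shows "transpose_mat P * P = 1\<^sub>m n" "P * transpose_mat P = 1\<^sub>m n"
    "A = P * mat n n (\<lambda>(i, j). if i = j then d i else 0) * transpose_mat P"
proof -
  let ?D = "mat n n (\<lambda>(i, j). if i = j then d i else 0)"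
  have P: "P \<in> carrier_mat n n" and D: "?D \<in> carrier_mat n n" by (auto simp: P_def)
  have f: "f i \<in> carrier_vec n" "A *\<^sub>v f i = d i \<cdot>\<^sub>v f i" if "i < n" for i
    using sys that by (auto simp: orthonormal_eigensystem_def)
  have col: "col P j = f j" if "j < n" for j
    using f(1)[OF that] that by (auto simp: P_def)
  show PP: "transpose_mat P * P = 1\<^sub>m n"
    using sys P by (intro eq_matI) (auto simp: col orthonormal_eigensystem_def)
  show PP': "P * transpose_mat P = 1\<^sub>m n"
    using mat_mult_left_right_inverse[OF _ P PP] P by simp
  have "A * P = P * ?D"
  proof (rule eq_matI)
    fix i j assume "i < dim_row (P * ?D)" "j < dim_col (P * ?D)"
    then have ij: "i < n" "j < n" using P by auto
    have "(A * P) $$ (i, j) = (A *\<^sub>v f j) $ i" using A P ij by (simp add: col)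
    also have "\<dots> = d j * P $$ (i, j)" using f[OF ij(2)] ij by (simp add: P_def)
    also have "\<dots> = (\<Sum>l = 0..<n. P $$ (i, l) * (if l = j then d l else 0))"
      using ij by (simp add: if_distrib[of "\<lambda>x. _ * x"] cong: if_cong)
    also have "\<dots> = (P * ?D) $$ (i, j)"
      using P ij by (simp add: scalar_prod_def)
    finally show "(A * P) $$ (i, j) = (P * ?D) $$ (i, j)" .
  qed (use A P in auto)
  then have "P * ?D * transpose_mat P = A * P * transpose_mat P" by simp
  also have "\<dots> = A" using A P PP' by (simp add: assoc_mult_mat[of _ n n _ n _ n])
  finally show "A = P * ?D * transpose_mat P" ..
qed

section \<open>Eigenvalues with multiplicity and the two leading eigenvectors\<close>

lemma char_poly_eigensystem:
  assumes A: "A \<in> carrier_mat n n" and sys: "orthonormal_eigensystem n A n f d"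
  shows "char_poly A = (\<Prod>e\<leftarrow>map d [0..<n]. [:- e, 1:])"
proof -
  let ?D = "mat n n (\<lambda>(i, j). if i = j then d i else 0)"
  have "similar_mat A ?D"
    by (rule similar_matI[of _ _ "mat n n (\<lambda>(i, j). f j $ i)"
          "transpose_mat (mat n n (\<lambda>(i, j). f j $ i))" n])
      (use A eigensystem_matrices[OF A sys] in auto)
  then have "char_poly A = char_poly ?D" by (rule char_poly_similar)
  also have "\<dots> = (\<Prod>e\<leftarrow>diag_mat ?D. [:- e, 1:])"
    by (rule char_poly_upper_triangular[of _ n]) auto
  also have "diag_mat ?D = map d [0..<n]" by (auto simp: diag_mat_def)
  finally show ?thesis .
qed

lemma eigensystem_orthogonal_zero:
  assumes A: "A \<in> carrier_mat n n" and sys: "orthonormal_eigensystem n A n f d"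
    and u: "u \<in> carrier_vec n" "\<And>i. i < n \<Longrightarrow> f i \<bullet> u = 0"
  shows "u = 0\<^sub>v n"
proof -
  define P where "P = mat n n (\<lambda>(i, j). f j $ i)"
  have P: "P \<in> carrier_mat n n" by (simp add: P_def)
  have "row (transpose_mat P) i = f i" if "i < n" for i
    using sys that P by (intro eq_vecI) (auto simp: P_def orthonormal_eigensystem_def)
  then have "transpose_mat P *\<^sub>v u = 0\<^sub>v n"
    using u P by (intro eq_vecI) auto
  moreover have "u = P *\<^sub>v (transpose_mat P *\<^sub>v u)"
    using eigensystem_matrices(2)[OF A sys] P u(1)
    by (simp add: P_def[symmetric] assoc_mult_mat_vec[of _ n n _ n, symmetric])
  moreover have "P *\<^sub>v 0\<^sub>v n = 0\<^sub>v n" using P by (intro eq_vecI) auto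
  ultimately show ?thesis by simp
qed

text \<open>Root multiplicities do not depend on the factorisation, so the list in
  \<open>top_two_eigenvectors\<close> and the eigenvalues of any eigenbasis agree as
  multisets.\<close>

lemma count_list_linear_factors:
  "count_list es x = order x (\<Prod>e\<leftarrow>es. [:- e, 1 :: real:])"
proof (induction es)
  case (Cons a es)
  have "(\<Prod>e\<leftarrow>es. [:- e, 1 :: real:]) \<noteq> 0" by (auto simp: prod_list_zero_iff)
  then have "order x ([:- a, 1:] * (\<Prod>e\<leftarrow>es. [:- e, 1 :: real:]))
      = order x [:- a, 1:] + order x (\<Prod>e\<leftarrow>es. [:- e, 1 :: real:])"
    by (intro order_mult) (simp del: mult_pCons_left)
  then show ?case using Cons by (simp add: order_linear' del: mult_pCons_left)
qed (simp add: order_0I)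

text \<open>Guarantees that the procedure has an output. Greedily chosen eigenvalues decrease,
  because each later eigenvector competes in the maximum that defines an earlier one.\<close>

lemma exists_top_two_eigenvectors:
  assumes A: "A \<in> carrier_mat n n" and sym: "transpose_mat A = A" and n: "n \<ge> 2"
  shows "\<exists>v1 v2. top_two_eigenvectors A v1 v2"
proof -
  have "orthonormal_eigensystem n A 0 (\<lambda>_. 0\<^sub>v n) (\<lambda>_. 0)"
    by (simp add: orthonormal_eigensystem_def)
  from extend_eigensystem[OF A sym _ this] obtain f d where
    sys: "orthonormal_eigensystem n A n f d"
    and max: "\<And>i u. i < n \<Longrightarrow> u \<in> carrier_vec n \<Longrightarrow> (\<forall>j<i. f j \<bullet> u = 0) \<Longrightarrow>
      u \<bullet> (A *\<^sub>v u) \<le> d i * (u \<bullet> u)" by auto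
  have d: "d j \<le> d i" if "i \<le> j" "j < n" for i j
    using max[of i "f j"] that sys by (auto simp: orthonormal_eigensystem_def)
  have e: "eigenvector A (f i) (d i)" if "i < n" for i
  proof -
    have "f i \<in> carrier_vec n" "A *\<^sub>v f i = d i \<cdot>\<^sub>v f i" "f i \<bullet> f i = 1"
      using sys that by (auto simp: orthonormal_eigensystem_def)
    then show ?thesis using A by (auto simp: eigenvector_def)
  qed
  have "sorted_wrt (\<ge>) (map d [0..<n])"
    using d by (auto simp: sorted_wrt_iff_nth_less)
  then have "top_two_eigenvectors A (f 0) (f 1)"
    unfolding top_two_eigenvectors_def
    using char_poly_eigensystem[OF A sys] e[of 0] e[of 1] n sys
    by (auto simp: orthonormal_eigensystem_def intro!: exI[of _ "map d [0..<n]"])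
  then show ?thesis by blast
qed

text \<open>The Rayleigh quotient of \<open>w\<close> is at most the third eigenvalue. The span of
  three leading eigenvectors has dimension three, so it contains a nonzero \<open>b\<close>
  orthogonal to the two given vectors, and the quotient of \<open>b\<close> is at least the third
  eigenvalue. The third eigenvalue itself drops out, which spares any estimate of it; the vectors
  \<open>b1\<close>, \<open>b2\<close> will be the regressors.\<close>

lemma top_two_eigenvectors_courant_fischer:
  fixes A :: "real mat"
  assumes A: "A \<in> carrier_mat n n" and sym: "transpose_mat A = A"
    and top: "top_two_eigenvectors A v1 v2"
    and w: "w \<in> carrier_vec n" "v1 \<bullet> w = 0" "v2 \<bullet> w = 0" "w \<noteq> 0\<^sub>v n"
    and b: "b1 \<in> carrier_vec n" "b2 \<in> carrier_vec n"
  obtains b where "b \<in> carrier_vec n" "b \<noteq> 0\<^sub>v n" "b1 \<bullet> b = 0" "b2 \<bullet> b = 0"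
    "(w \<bullet> (A *\<^sub>v w)) * (b \<bullet> b) \<le> (b \<bullet> (A *\<^sub>v b)) * (w \<bullet> w)"
proof -
  obtain es where es: "char_poly A = (\<Prod>e\<leftarrow>es. [:- e, 1:])" "sorted_wrt (\<ge>) es" "length es \<ge> 2"
    "eigenvector A v1 (es ! 0)" "eigenvector A v2 (es ! 1)"
    and v: "v1 \<bullet> v1 = 1" "v2 \<bullet> v2 = 1" "v1 \<bullet> v2 = 0"
    using top by (auto simp: top_two_eigenvectors_def)
  define d where "d i = es ! i" for i
  define f where "f i = (if i = 0 then v1 else v2)" for i :: nat
  have vc: "v1 \<in> carrier_vec n" "v2 \<in> carrier_vec n"
    using es A by (auto simp: eigenvector_def)
  have sys2: "orthonormal_eigensystem n A 2 f d"
    using es v vc comm_scalar_prod[OF vc]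
    by (auto simp: orthonormal_eigensystem_def f_def d_def eigenvector_def less_2_cases_iff)
  have mset_eq: "mset es = mset (map d' [0..<n])" if "orthonormal_eigensystem n A n f' d'" for f' d'
  proof (rule multiset_eqI)
    fix x
    show "count (mset es) x = count (mset (map d' [0..<n])) x"
      using char_poly_eigensystem[OF A that] es(1)
      by (simp only: count_mset count_list_linear_factors)
  qed
  have "length es = n"
  proof -
    have "orthonormal_eigensystem n A 0 (\<lambda>_. 0\<^sub>v n) (\<lambda>_. 0)"
      by (simp add: orthonormal_eigensystem_def)
    from extend_eigensystem[OF A sym _ this] obtain f' d' where
      "orthonormal_eigensystem n A n f' d'" by auto
    from arg_cong[OF mset_eq[OF this], of size] show ?thesis by simp
  qed
  then have n2: "n \<ge> 2" using es(3) by simp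
  \<comment> \<open>In dimension two the leading eigenvectors already span the space and
    \<open>w\<close> would vanish.\<close>
  have "n \<noteq> 2"
  proof
    assume "n = 2"
    then have "w = 0\<^sub>v n" using sys2 w(1-3)
      by (intro eigensystem_orthogonal_zero[OF A, of f d]) (auto simp: f_def)
    then show False using w(4) by simp
  qed
  then have n: "2 < n" using n2 by simp
  obtain f' d' where sys: "orthonormal_eigensystem n A n f' d'"
    and eq: "\<And>i. i < 2 \<Longrightarrow> f' i = f i \<and> d' i = d i"
    and max: "\<And>u. u \<in> carrier_vec n \<Longrightarrow> (\<forall>j<2. f' j \<bullet> u = 0) \<Longrightarrow> u \<bullet> (A *\<^sub>v u) \<le> d' 2 * (u \<bullet> u)"
    using extend_eigensystem[OF A sym n2 sys2] n by (metis order_refl)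
  have f': "f' i \<in> carrier_vec n" "A *\<^sub>v f' i = d' i \<cdot>\<^sub>v f' i" if "i < n" for i
    using sys that by (auto simp: orthonormal_eigensystem_def)
  have on: "f' i \<bullet> f' j = (if i = j then 1 else 0)" if "i < n" "j < n" for i j
    using sys that by (simp add: orthonormal_eigensystem_def)
  \<comment> \<open>The two eigenvalue multisets agree, and so do their first two entries. After
    removing these, \<open>d' 2\<close> occurs in the tail of the decreasing list
    \<open>es\<close>.\<close>
  have "d' 2 \<le> es ! 1"
  proof -
    have "mset (map d' [0..<n]) = {#d' 0, d' 1#} + mset (map d' [2..<n])"
      using n by (simp add: upt_conv_Cons numeral_2_eq_2)
    moreover have "mset es = {#es ! 0, es ! 1#} + mset (drop 2 es)"
      using es(3) by (metis Cons_nth_drop_Suc One_nat_def Suc_1 Suc_le_lessD add_mset_add_single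
          drop0 mset.simps(2) union_mset_add_mset_left add_0 Suc_lessD lessI less_le_trans)
    ultimately have "mset (map d' [2..<n]) = mset (drop 2 es)"
      using mset_eq[OF sys] eq[of 0] eq[of 1] by (simp add: d_def)
    then have "set (map d' [2..<n]) = set (drop 2 es)" by (metis set_mset_mset)
    moreover have "d' 2 \<in> set (map d' [2..<n])" using n by auto
    ultimately have "d' 2 \<in> set (drop 2 es)" by simp
    then obtain j where "j < length es - 2" "d' 2 = es ! (2 + j)"
      by (metis in_set_conv_nth length_drop nth_drop es(3))
    then show ?thesis using es(2) by (auto simp: sorted_wrt_iff_nth_less)
  qed
  moreover have "es ! 1 \<le> es ! 0"
    using es(2,3) by (auto simp: sorted_wrt_iff_nth_less)
  ultimately have d3: "d' 2 \<le> d' i" if "i < 3" for i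
    using that eq[of 0] eq[of 1] by (auto simp: d_def numeral_3_eq_3 less_Suc_eq numeral_2_eq_2)

  have w_le: "w \<bullet> (A *\<^sub>v w) \<le> d' 2 * (w \<bullet> w)"
    using max[OF w(1)] w(2,3) eq by (auto simp: f_def less_2_cases_iff)
  \<comment> \<open>Coordinates of \<open>b1\<close> and \<open>b2\<close> along the three leading
    eigenvectors: orthogonality of \<open>b\<close> to both amounts to two linear equations in three
    unknowns.\<close>
  define g where "g i = vec 3 (\<lambda>l. f' l \<bullet> (if i = 0 then b1 else b2))" for i :: nat
  obtain c where c: "c \<in> carrier_vec 3" "c \<noteq> 0\<^sub>v 3" "\<And>i. i < 2 \<Longrightarrow> g i \<bullet> c = 0"
    using underdetermined_nonzero_solution[of 2 3 g] by (auto simp: g_def)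
  define b where "b = c $ 0 \<cdot>\<^sub>v f' 0 + c $ 1 \<cdot>\<^sub>v f' 1 + c $ 2 \<cdot>\<^sub>v f' 2"
  have fc: "f' 0 \<in> carrier_vec n" "f' 1 \<in> carrier_vec n" "f' 2 \<in> carrier_vec n"
    using f'(1) n by auto
  then have bc: "b \<in> carrier_vec n" by (simp add: b_def)
  have b_prod: "b \<bullet> x = c $ 0 * (f' 0 \<bullet> x) + c $ 1 * (f' 1 \<bullet> x) + c $ 2 * (f' 2 \<bullet> x)"
    if "x \<in> carrier_vec n" for x
    using that fc by (simp add: b_def add_scalar_prod_distrib[of _ n])
  have b_f: "f' i \<bullet> b = c $ i" if "i < 3" for i
  proof -
    have "f' i \<bullet> b = b \<bullet> f' i" using comm_scalar_prod[OF _ bc] f'(1)[of i] that n by simp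
    also have "\<dots> = c $ i" using that n b_prod[OF f'(1)[of i]]
      by (auto simp: on numeral_3_eq_3 less_Suc_eq numeral_2_eq_2)
    finally show ?thesis .
  qed
  have bb: "b \<bullet> b = (c $ 0)\<^sup>2 + (c $ 1)\<^sup>2 + (c $ 2)\<^sup>2"
    using b_prod[OF bc] b_f by (simp add: power2_eq_square)
  have bA: "f' i \<bullet> (A *\<^sub>v b) = d' i * c $ i" if "i < 3" for i
    using symmetric_scalar_prod[OF A sym f'(1)[of i] bc] f'[of i] that n b_f[OF that] bc by simp
  have bAb: "b \<bullet> (A *\<^sub>v b) = d' 0 * (c $ 0)\<^sup>2 + d' 1 * (c $ 1)\<^sup>2 + d' 2 * (c $ 2)\<^sup>2"
    using b_prod[of "A *\<^sub>v b"] bA A bc by (simp add: power2_eq_square mult.assoc mult.left_commute)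
  have "d' 2 * (b \<bullet> b) \<le> b \<bullet> (A *\<^sub>v b)"
    unfolding bAb bb distrib_left using d3 by (intro add_mono mult_right_mono) auto
  then have "(d' 2 * (b \<bullet> b)) * (w \<bullet> w) \<le> (b \<bullet> (A *\<^sub>v b)) * (w \<bullet> w)"
    by (intro mult_right_mono scalar_prod_self_nonneg)
  moreover have "(w \<bullet> (A *\<^sub>v w)) * (b \<bullet> b) \<le> (d' 2 * (w \<bullet> w)) * (b \<bullet> b)"
    by (intro mult_right_mono scalar_prod_self_nonneg w_le)
  ultimately have le: "(w \<bullet> (A *\<^sub>v w)) * (b \<bullet> b) \<le> (b \<bullet> (A *\<^sub>v b)) * (w \<bullet> w)"
    by (simp add: ac_simps)
  have "b \<bullet> b \<noteq> 0"
  proof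
    assume "b \<bullet> b = 0"
    then have "c $ 0 = 0 \<and> c $ 1 = 0 \<and> c $ 2 = 0"
      unfolding bb by (simp add: add_nonneg_eq_0_iff)
    then have "c = 0\<^sub>v 3" using c(1)
      by (intro eq_vecI) (auto simp: numeral_3_eq_3 less_Suc_eq numeral_2_eq_2)
    then show False using c(2) by simp
  qed
  then have b0: "b \<noteq> 0\<^sub>v n" by auto
  have *: "g i \<bullet> c = b \<bullet> (if i = 0 then b1 else b2)" for i
  proof -
    have x: "(if i = 0 then b1 else b2) \<in> carrier_vec n" using assms(8,9) by simp
    have "g i \<bullet> c = (\<Sum>l\<in>{0, 1, 2}. g i $ l * c $ l)"
      using c(1) unfolding scalar_prod_def by (intro sum.cong) auto
    also have "\<dots> = b \<bullet> (if i = 0 then b1 else b2)"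
      unfolding b_prod[OF x] by (simp add: g_def)
    finally show ?thesis .
  qed
  have "b1 \<bullet> b = 0" "b2 \<bullet> b = 0"
    using *[of 0] *[of 1] c(3)[of 0] c(3)[of 1] comm_scalar_prod[OF bc] assms(8,9) by auto
  then show thesis using that[OF bc b0] le by blast
qed

section \<open>Nets of the sphere and quadratic forms\<close>

lemma sum_half_power_abs_le: "(\<Sum>m\<in>{- int B..int B}. (1 / 2 :: real) ^ nat \<bar>m\<bar>) \<le> 3"
proof -
  have "(\<Sum>m\<in>{- int B..int B}. (1 / 2 :: real) ^ nat \<bar>m\<bar>) = 3 - 2 * (1 / 2) ^ B"
  proof (induction B)
    case (Suc B)
    have "{- int (Suc B)..int (Suc B)} = insert (- int (Suc B)) (insert (int (Suc B)) {- int B..int B})"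
      by auto
    then show ?case using Suc by (simp add: nat_add_distrib)
  qed simp
  then show ?thesis by simp
qed

text \<open>Each point counted has weight at least \<open>2\<close> to the power \<open>- R k\<close> under the product of the weights
  \<open>m \<mapsto> 2\<close> to the power \<open>- \<bar>m\<bar>\<close>, whose total mass is at most \<open>3\<close> to the power \<open>k\<close>.\<close>

lemma card_lattice_points_le:
  fixes R k :: nat
  defines "L \<equiv> {z \<in> {..<k} \<rightarrow>\<^sub>E {- int (R * k)..int (R * k)}. (\<Sum>j<k. nat \<bar>z j\<bar>) \<le> R * k}"
  shows "finite L" "real (card L) \<le> (3 * 2 ^ R) ^ k"
proof -
  let ?F = "{..<k} \<rightarrow>\<^sub>E {- int (R * k)..int (R * k)}"
  have fin: "finite ?F" by (intro finite_PiE) auto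
  then show "finite L" unfolding L_def by simp
  have "real (card L) * (1 / 2) ^ (R * k) = (\<Sum>z\<in>L. (1 / 2) ^ (R * k))" by simp
  also have "\<dots> \<le> (\<Sum>z\<in>L. (1 / 2) ^ (\<Sum>j<k. nat \<bar>z j\<bar>))"
    by (intro sum_mono power_decreasing) (auto simp: L_def)
  also have "\<dots> \<le> (\<Sum>z\<in>?F. (1 / 2) ^ (\<Sum>j<k. nat \<bar>z j\<bar>))"
    using fin by (intro sum_mono2) (auto simp: L_def)
  also have "\<dots> = (\<Sum>z\<in>?F. \<Prod>j<k. (1 / 2) ^ nat \<bar>z j\<bar>)" by (simp add: power_sum)
  also have "\<dots> = (\<Prod>j<k. \<Sum>m\<in>{- int (R * k)..int (R * k)}. (1 / 2) ^ nat \<bar>m\<bar>)"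
    by (rule prod_sum_PiE[symmetric]) auto
  also have "\<dots> \<le> (\<Prod>j<k. 3)"
    by (intro prod_mono conjI sum_half_power_abs_le sum_nonneg) auto
  finally have "real (card L) * (1 / 2) ^ (R * k) \<le> 3 ^ k" by simp
  then have "real (card L) \<le> 3 ^ k * 2 ^ (R * k)" by (simp add: field_simps power_one_over)
  then show "real (card L) \<le> (3 * 2 ^ R) ^ k" by (simp add: power_mult_distrib power_mult)
qed

text \<open>The radius is an absolute constant: with 1/1000, quadratic forms lose a factor of at
  most 101/100 in passing to the whole sphere, and small-ball counts lose less than one percent of
  the sample.\<close>

definition sphere_net :: "nat \<Rightarrow> real vec set \<Rightarrow> bool" where
  "sphere_net k N \<longleftrightarrow> finite N \<and> (\<forall>a\<in>N. a \<in> carrier_vec k \<and> a \<bullet> a = 1) \<and>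
     (\<forall>a\<in>carrier_vec k. a \<bullet> a = 1 \<longrightarrow> (\<exists>a'\<in>N. l2_norm (a - a') \<le> 1 / 1000))"

text \<open>Rounding the coordinates of a unit vector down to the mesh \<open>h\<close> moves it by
  at most \<open>h * sqrt k\<close>, which is 1/2000, and normalising costs at most as much again.
  The integer vector obtained has l1-norm at most \<open>sqrt k / h + k\<close>, linear in k because
  the l1-norm of a unit vector is at most \<open>sqrt k\<close>; such integer vectors are only
  exponentially many.\<close>

lemma sphere_net_exists:
  obtains D :: real where "1 \<le> D"
    "\<And>k. 0 < k \<Longrightarrow> \<exists>N. sphere_net k N \<and> real (card N) \<le> D ^ k"
proof -
  \<comment> \<open>The l1-norm of the rounded vector is at most 2000 k from the mesh, plus k from
    rounding.\<close>
  define R where "R = (2001 :: nat)"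
  have "\<exists>N. sphere_net k N \<and> real (card N) \<le> (3 * 2 ^ R) ^ k" if "0 < k" for k
  proof -
    define h where "h = 1 / (2000 * sqrt (real k))"
    have h: "h > 0" using that by (simp add: h_def)
    define L where "L = {z \<in> {..<k} \<rightarrow>\<^sub>E {- int (R * k)..int (R * k)}. (\<Sum>j<k. nat \<bar>z j\<bar>) \<le> R * k}"
    define u where "u z = vec k (\<lambda>j. h * real_of_int (z j))" for z
    \<comment> \<open>The condition on \<open>v\<close> discards the zero lattice point, whose
      normalisation is the zero vector since \<open>1 / 0 = 0\<close>.\<close>
    define N where "N = {v \<in> (\<lambda>z. (1 / l2_norm (u z)) \<cdot>\<^sub>v u z) ` L. v \<bullet> v = 1}"
    have L: "finite L" "real (card L) \<le> (3 * 2 ^ R) ^ k"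
      unfolding L_def by (rule card_lattice_points_le)+
    have uc: "u z \<in> carrier_vec k" for z by (simp add: u_def)
    have "card N \<le> card L"
    proof -
      have "card N \<le> card ((\<lambda>z. (1 / l2_norm (u z)) \<cdot>\<^sub>v u z) ` L)"
        unfolding N_def using L(1) by (intro card_mono) auto
      also have "\<dots> \<le> card L" using L(1) by (rule card_image_le)
      finally show ?thesis .
    qed
    then have "real (card N) \<le> (3 * 2 ^ R) ^ k" using L(2) by linarith
    moreover have "sphere_net k N"
      unfolding sphere_net_def
    proof (intro conjI ballI impI)
      show "finite N" using L(1) by (simp add: N_def)
    next
      fix a assume "a \<in> N"
      then show "a \<in> carrier_vec k" "a \<bullet> a = 1" using uc by (auto simp: N_def)
    next
      fix a :: "real vec" assume a: "a \<in> carrier_vec k" "a \<bullet> a = 1"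
      define z where "z = (\<lambda>j\<in>{..<k}. \<lfloor>a $ j / h\<rfloor>)"
      have z: "z j = \<lfloor>a $ j / h\<rfloor>" if "j < k" for j using that by (simp add: z_def)
      have abs_z: "real (nat \<bar>z j\<bar>) \<le> \<bar>a $ j\<bar> / h + 1" if "j < k" for j
      proof -
        have "\<bar>real_of_int \<lfloor>a $ j / h\<rfloor>\<bar> \<le> \<bar>a $ j / h\<bar> + 1" by linarith
        then show ?thesis using h z[OF that] by (simp add: abs_divide)
      qed
      have sq1: "(\<Sum>j<k. (a $ j)\<^sup>2) = 1"
        using a by (simp add: scalar_prod_def lessThan_atLeast0 power2_eq_square)
      have "(\<Sum>j<k. \<bar>a $ j\<bar> * 1)\<^sup>2 \<le> (\<Sum>j<k. \<bar>a $ j\<bar>\<^sup>2) * (\<Sum>j<k. 1\<^sup>2)"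
        by (rule Cauchy_Schwarz_ineq_sum)
      then have "(\<Sum>j<k. \<bar>a $ j\<bar>)\<^sup>2 \<le> (sqrt (real k))\<^sup>2" using sq1 by simp
      then have l1: "(\<Sum>j<k. \<bar>a $ j\<bar>) \<le> sqrt (real k)"
        by (rule power2_le_imp_le) simp
      have "real (\<Sum>j<k. nat \<bar>z j\<bar>) \<le> (\<Sum>j<k. \<bar>a $ j\<bar> / h + 1)"
        unfolding of_nat_sum by (intro sum_mono) (use abs_z in auto)
      also have "\<dots> = (\<Sum>j<k. \<bar>a $ j\<bar>) / h + real k"
        by (simp add: sum.distrib sum_divide_distrib)
      also have "\<dots> \<le> sqrt (real k) / h + real k"
        using l1 h by (intro add_right_mono divide_right_mono) auto
      also have "\<dots> = real (R * k)" by (simp add: h_def R_def)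
      finally have zsum: "(\<Sum>j<k. nat \<bar>z j\<bar>) \<le> R * k" using of_nat_le_iff by blast
      have "z j \<in> {- int (R * k)..int (R * k)}" if "j < k" for j
      proof -
        have "nat \<bar>z j\<bar> \<le> (\<Sum>j<k. nat \<bar>z j\<bar>)"
          by (rule member_le_sum) (use that in auto)
        then have "int (nat \<bar>z j\<bar>) \<le> int (R * k)" using zsum unfolding of_nat_le_iff by linarith
        then have "\<bar>z j\<bar> \<le> int (R * k)" by (simp del: of_nat_mult)
        then show ?thesis by (simp add: abs_le_iff del: of_nat_mult)
      qed
      then have zL: "z \<in> L" using zsum by (auto simp: L_def z_def)
      have "(a - u z) \<bullet> (a - u z) = (\<Sum>j<k. (a $ j - h * real_of_int (z j))\<^sup>2)"
        using a by (simp add: scalar_prod_def u_def lessThan_atLeast0 power2_eq_square)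
      also have "\<dots> \<le> (\<Sum>j<k. h\<^sup>2)"
      proof (rule sum_mono)
        fix j assume "j \<in> {..<k}"
        then have j: "j < k" by simp
        have "\<bar>a $ j / h - real_of_int (z j)\<bar> \<le> 1" using z[OF j] by linarith
        then have "\<bar>h * (a $ j / h - real_of_int (z j))\<bar> \<le> h * 1"
          using h unfolding abs_mult by (intro mult_mono) auto
        then have "\<bar>a $ j - h * real_of_int (z j)\<bar> \<le> h" using h by (simp add: right_diff_distrib)
        then show "(a $ j - h * real_of_int (z j))\<^sup>2 \<le> h\<^sup>2"
          using abs_le_square_iff[of "a $ j - h * real_of_int (z j)" h] h by simp
      qed
      also have "\<dots> = (1 / 2000)\<^sup>2" using that by (simp add: h_def power_divide power_mult_distrib)
      finally have d1: "l2_norm (a - u z) \<le> 1 / 2000" by (subst l2_norm_le_iff) auto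
      have na: "l2_norm a = 1" using a by (simp add: l2_norm_one_iff)
      have "a = (a - u z) + u z" using a uc[of z] by (intro eq_vecI) auto
      then have "1 \<le> l2_norm (a - u z) + l2_norm (u z)"
        using l2_norm_triangle[of "a - u z" k "u z"] a uc[of z] na by simp
      then have lo: "l2_norm (u z) \<ge> 1 - 1 / 2000" using d1 by linarith
      have "u z = (u z - a) + a" using a uc[of z] by (intro eq_vecI) auto
      then have "l2_norm (u z) \<le> l2_norm (u z - a) + 1"
        using l2_norm_triangle[of "u z - a" k a] a uc[of z] na by simp
      then have hi: "l2_norm (u z) \<le> 1 + 1 / 2000"
        using d1 l2_norm_minus_commute[OF a(1) uc[of z]] by linarith
      have "u z \<noteq> 0\<^sub>v k" using lo by (auto simp: l2_norm_def)
      note un = unit_normalize[OF uc this]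
      let ?v = "(1 / l2_norm (u z)) \<cdot>\<^sub>v u z"
      have "?v \<in> N" using zL un(2) by (auto simp: N_def)
      moreover have "l2_norm (a - ?v) \<le> 1 / 1000"
      proof -
        have eq: "a - ?v = (a - u z) + (l2_norm (u z) - 1) \<cdot>\<^sub>v ?v"
          using a uc[of z] lo by (intro eq_vecI) (auto simp: field_simps)
        have "l2_norm (a - ?v) \<le> l2_norm (a - u z) + \<bar>l2_norm (u z) - 1\<bar> * l2_norm ?v"
          unfolding eq using l2_norm_triangle[of "a - u z" k "(l2_norm (u z) - 1) \<cdot>\<^sub>v ?v"] a uc[of z] un(1)
          by (simp only: l2_norm_smult[of "l2_norm (u z) - 1"] minus_carrier_vec smult_carrier_vec)
        also have "l2_norm ?v = 1" by (subst l2_norm_one_iff) (rule un(2))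
        finally show ?thesis using d1 lo hi by (simp add: abs_le_iff)
      qed
      ultimately show "\<exists>a'\<in>N. l2_norm (a - a') \<le> 1 / 1000" by blast
    qed
    ultimately show ?thesis by blast
  qed
  moreover have "1 \<le> 3 * (2 :: real) ^ R"
    using one_le_power[of "2 :: real" R] by linarith
  ultimately show thesis using that[of "3 * 2 ^ R"] by blast
qed

text \<open>It suffices to compare at a point of the net close to an extremal eigenvector, where the
  first-order error is proportional to the eigenvalue itself.\<close>

lemma quadratic_form_net_bound:
  fixes S :: "real mat"
  assumes S: "S \<in> carrier_mat k k" and sym: "transpose_mat S = S" and k: "0 < k"
    and N: "sphere_net k N" and c: "\<And>a. a \<in> N \<Longrightarrow> \<bar>a \<bullet> (S *\<^sub>v a)\<bar> \<le> c"
    and u: "u \<in> carrier_vec k"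
  shows "\<bar>u \<bullet> (S *\<^sub>v u)\<bar> \<le> 101 / 100 * c * (u \<bullet> u)"
proof -
  obtain w1 \<mu>1 where w1: "w1 \<in> carrier_vec k" "w1 \<bullet> w1 = 1" "S *\<^sub>v w1 = \<mu>1 \<cdot>\<^sub>v w1"
    "\<And>u. u \<in> carrier_vec k \<Longrightarrow> u \<bullet> (S *\<^sub>v u) \<le> \<mu>1 * (u \<bullet> u)"
    using next_eigenvector[OF S sym k] by (metis less_nat_zero_code)
  have nS: "- S \<in> carrier_mat k k" "transpose_mat (- S) = - S"
    using S sym transpose_uminus[of S] by auto
  have nSu: "(- S) *\<^sub>v u = - (S *\<^sub>v u)" if "u \<in> carrier_vec k" for u
    using S that by (intro eq_vecI) auto
  obtain w2 \<mu>2 where w2: "w2 \<in> carrier_vec k" "w2 \<bullet> w2 = 1" "(- S) *\<^sub>v w2 = \<mu>2 \<cdot>\<^sub>v w2"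
    "\<And>u. u \<in> carrier_vec k \<Longrightarrow> u \<bullet> ((- S) *\<^sub>v u) \<le> \<mu>2 * (u \<bullet> u)"
    using next_eigenvector[OF nS k] by (metis less_nat_zero_code)
  \<comment> \<open>\<open>Q\<close> is the spectral norm. It may be attained at either end of the
    spectrum, hence the maximisation for both \<open>S\<close> and \<open>- S\<close> and the case
    distinction for \<open>w\<close>.\<close>
  define Q where "Q = max \<mu>1 \<mu>2"
  have bound: "\<bar>u \<bullet> (S *\<^sub>v u)\<bar> \<le> Q * (u \<bullet> u)" if "u \<in> carrier_vec k" for u
  proof -
    have "u \<bullet> (S *\<^sub>v u) \<le> \<mu>1 * (u \<bullet> u)" "- (u \<bullet> (S *\<^sub>v u)) \<le> \<mu>2 * (u \<bullet> u)"
      using w1(4)[OF that] w2(4)[OF that] nSu[OF that] that S by auto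
    moreover have "\<mu>1 * (u \<bullet> u) \<le> Q * (u \<bullet> u)" "\<mu>2 * (u \<bullet> u) \<le> Q * (u \<bullet> u)"
      by (auto simp: Q_def intro!: mult_right_mono scalar_prod_self_nonneg)
    ultimately show ?thesis by linarith
  qed
  have Q0: "0 \<le> Q" using bound[OF w1(1)] w1(2) by simp
  obtain w \<sigma> where w: "w \<in> carrier_vec k" "w \<bullet> w = 1" "S *\<^sub>v w = \<sigma> \<cdot>\<^sub>v w" "\<bar>\<sigma>\<bar> = Q"
  proof (cases "\<mu>2 \<le> \<mu>1")
    case True
    then show ?thesis using that[OF w1(1-3)] Q0 by (simp add: Q_def)
  next
    case False
    have "S *\<^sub>v w2 = (- \<mu>2) \<cdot>\<^sub>v w2"
    proof -
      have "- (S *\<^sub>v w2) = \<mu>2 \<cdot>\<^sub>v w2" using w2(3) nSu[OF w2(1)] by simp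
      then have "- (- (S *\<^sub>v w2)) = - (\<mu>2 \<cdot>\<^sub>v w2)" by simp
      also have "- (\<mu>2 \<cdot>\<^sub>v w2) = (- \<mu>2) \<cdot>\<^sub>v w2" by (intro eq_vecI) auto
      finally show ?thesis by simp
    qed
    then show ?thesis using that[OF w2(1,2)] False Q0 by (simp add: Q_def)
  qed
  obtain a where a: "a \<in> N" "l2_norm (w - a) \<le> 1 / 1000"
    using N w(1,2) by (auto simp: sphere_net_def)
  have ac: "a \<in> carrier_vec k" "a \<bullet> a = 1" using N a(1) by (auto simp: sphere_net_def)
  define r where "r = a - w"
  have rc: "r \<in> carrier_vec k" using ac w by (simp add: r_def)
  have rn: "l2_norm r \<le> 1 / 1000"
    using a(2) l2_norm_minus_commute[OF w(1) ac(1)] by (simp add: r_def)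
  have rr: "r \<bullet> r \<le> (1 / 1000)\<^sup>2" by (rule iffD1[OF l2_norm_le_iff rn]) simp
  have ar: "a = w + r" using ac w by (intro eq_vecI) (auto simp: r_def)
  have Sr: "S *\<^sub>v r \<in> carrier_vec k" using S rc by simp
  have wSr: "w \<bullet> (S *\<^sub>v r) = \<sigma> * (w \<bullet> r)"
    using symmetric_scalar_prod[OF S sym w(1) rc] w rc by simp
  have "a \<bullet> (S *\<^sub>v a) = \<sigma> + 2 * \<sigma> * (w \<bullet> r) + r \<bullet> (S *\<^sub>v r)"
  proof -
    have "S *\<^sub>v a = \<sigma> \<cdot>\<^sub>v w + S *\<^sub>v r"
      unfolding ar using S w rc by (simp add: mult_add_distrib_mat_vec[of _ k k])
    then have "a \<bullet> (S *\<^sub>v a) = (w + r) \<bullet> (\<sigma> \<cdot>\<^sub>v w + S *\<^sub>v r)" by (simp add: ar)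
    also have "\<dots> = \<sigma> * (w \<bullet> w) + w \<bullet> (S *\<^sub>v r) + (\<sigma> * (r \<bullet> w) + r \<bullet> (S *\<^sub>v r))"
      using w(1) rc Sr by (simp add: add_scalar_prod_distrib[of _ k] scalar_prod_add_distrib[of _ k] distrib_left)
    finally show ?thesis using wSr w(2) comm_scalar_prod[OF w(1) rc] by simp
  qed
  moreover have "\<bar>2 * \<sigma> * (w \<bullet> r)\<bar> \<le> 2 * Q * (1 / 1000)"
  proof -
    have "\<bar>w \<bullet> r\<bar> \<le> 1 / 1000"
      using abs_scalar_prod_le[OF w(1) rc] rn w(2) by (simp add: l2_norm_def)
    then show ?thesis unfolding abs_mult w(4) using Q0 by (intro mult_mono) auto
  qed
  moreover have "\<bar>r \<bullet> (S *\<^sub>v r)\<bar> \<le> Q * (1 / 1000)"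
  proof -
    have "Q * (r \<bullet> r) \<le> Q * (1 / 1000)"
      using rr Q0 by (intro mult_left_mono) (auto simp: power2_eq_square)
    then show ?thesis using bound[OF rc] by linarith
  qed
  ultimately have "Q \<le> c + 3 * Q / 1000" using c[OF a(1)] w(4) by linarith
  then have "Q \<le> 101 / 100 * c" using Q0 by linarith
  then have "Q * (u \<bullet> u) \<le> 101 / 100 * c * (u \<bullet> u)"
    by (intro mult_right_mono scalar_prod_self_nonneg)
  then show ?thesis using bound[OF u] by linarith
qed

text \<open>A common form for the moment matrix (weights \<open>y\<^sup>2 / n\<close>), the sample
  covariance (unit weights) and the rank-two part of the expected moment matrix (two weights, with
  the regressors as vectors).\<close>

definition weighted_gram :: "nat \<Rightarrow> 'i set \<Rightarrow> ('i \<Rightarrow> real) \<Rightarrow> ('i \<Rightarrow> real vec) \<Rightarrow> real mat" where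
  "weighted_gram k J c x = mat k k (\<lambda>(a, b). \<Sum>i\<in>J. c i * (x i $ a * x i $ b))"

lemma weighted_gram_carrier [simp]: "weighted_gram k J c x \<in> carrier_mat k k"
  by (simp add: weighted_gram_def)

lemma transpose_weighted_gram [simp]: "transpose_mat (weighted_gram k J c x) = weighted_gram k J c x"
  by (intro eq_matI) (auto simp: weighted_gram_def mult.commute)

lemma weighted_gram_quadratic_form:
  assumes u: "u \<in> carrier_vec k"
  shows "u \<bullet> (weighted_gram k J c x *\<^sub>v u) = (\<Sum>i\<in>J. c i * (x i \<bullet> u)\<^sup>2)"
proof -
  have d: "dim_vec u = k" using u by simp
  have "u \<bullet> (weighted_gram k J c x *\<^sub>v u)
      = (\<Sum>a<k. u $ a * (\<Sum>b<k. (\<Sum>i\<in>J. c i * (x i $ a * x i $ b)) * u $ b))"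
    using d by (simp add: weighted_gram_def scalar_prod_def row_def lessThan_atLeast0)
  also have "\<dots> = (\<Sum>a<k. \<Sum>b<k. \<Sum>i\<in>J. c i * (x i $ a * u $ a) * (x i $ b * u $ b))"
    by (simp add: sum_distrib_left sum_distrib_right mult.assoc mult.left_commute)
  also have "\<dots> = (\<Sum>i\<in>J. \<Sum>a<k. \<Sum>b<k. c i * (x i $ a * u $ a) * (x i $ b * u $ b))"
    by (subst sum.swap[of _ J], subst sum.swap[of _ J]) simp
  also have "\<dots> = (\<Sum>i\<in>J. c i * (x i \<bullet> u)\<^sup>2)"
  proof (rule sum.cong[OF refl])
    fix i
    have "(x i \<bullet> u)\<^sup>2 = (\<Sum>a<k. \<Sum>b<k. (x i $ a * u $ a) * (x i $ b * u $ b))"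
      using d by (simp add: scalar_prod_def lessThan_atLeast0 power2_eq_square sum_product)
    then show "(\<Sum>a<k. \<Sum>b<k. c i * (x i $ a * u $ a) * (x i $ b * u $ b)) = c i * (x i \<bullet> u)\<^sup>2"
      by (simp only: sum_distrib_left mult.assoc)
  qed
  finally show ?thesis .
qed

section \<open>Tail bounds for Gaussian designs\<close>

text \<open>The Chernoff parameter is absorbed into the variables, and the moment bounds come
  already in exponential form, so that they add up under independence. Nonnegative integrals make
  finiteness part of the hypothesis \<open>mgf\<close>.\<close>

lemma (in prob_space) chernoff_indep_sum:
  fixes Y :: "'i \<Rightarrow> 'a \<Rightarrow> real"
  assumes J: "finite J" and ind: "indep_vars (\<lambda>_. borel) Y J"
    and mgf: "\<And>i. i \<in> J \<Longrightarrow> (\<integral>\<^sup>+\<omega>. ennreal (exp (Y i \<omega>)) \<partial>M) \<le> ennreal (exp (c i))"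
  shows "prob {\<omega> \<in> space M. (\<Sum>i\<in>J. c i) + t \<le> (\<Sum>i\<in>J. Y i \<omega>)} \<le> exp (- t)"
proof -
  have rv: "Y i \<in> borel_measurable M" if "i \<in> J" for i
    using ind that by (auto simp: indep_vars_def)
  have ind': "indep_vars (\<lambda>_. borel) (\<lambda>i \<omega>. ennreal (exp (Y i \<omega>))) J"
    by (rule indep_vars_compose2[OF ind]) measurable
  have "(\<integral>\<^sup>+\<omega>. ennreal (exp (\<Sum>i\<in>J. Y i \<omega>)) \<partial>M) = (\<integral>\<^sup>+\<omega>. (\<Prod>i\<in>J. ennreal (exp (Y i \<omega>))) \<partial>M)"
    using J by (intro nn_integral_cong) (simp add: exp_sum prod_ennreal)
  also have "\<dots> = (\<Prod>i\<in>J. \<integral>\<^sup>+\<omega>. ennreal (exp (Y i \<omega>)) \<partial>M)"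
    by (rule indep_vars_nn_integral[OF J ind']) simp
  also have "\<dots> \<le> (\<Prod>i\<in>J. ennreal (exp (c i)))"
    by (intro prod_mono_ennreal mgf)
  also have "\<dots> = ennreal (exp (\<Sum>i\<in>J. c i))"
    using J by (simp add: exp_sum prod_ennreal)
  finally have le: "(\<integral>\<^sup>+\<omega>. ennreal (exp (\<Sum>i\<in>J. Y i \<omega>)) \<partial>M) \<le> ennreal (exp (\<Sum>i\<in>J. c i))" .
  let ?S = "\<lambda>\<omega>. \<Sum>i\<in>J. Y i \<omega>"
  have S: "?S \<in> borel_measurable M" using rv by measurable
  let ?A = "{\<omega> \<in> space M. (\<Sum>i\<in>J. c i) + t \<le> ?S \<omega>}"
  have "emeasure M ?A \<le> (\<integral>\<^sup>+\<omega>. ennreal (exp (- ((\<Sum>i\<in>J. c i) + t))) * ennreal (exp (?S \<omega>)) \<partial>M)"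
  proof -
    have "emeasure M ?A = (\<integral>\<^sup>+\<omega>. indicator ?A \<omega> \<partial>M)" using S by simp
    also have "\<dots> \<le> (\<integral>\<^sup>+\<omega>. ennreal (exp (- ((\<Sum>i\<in>J. c i) + t))) * ennreal (exp (?S \<omega>)) \<partial>M)"
      by (intro nn_integral_mono)
        (auto simp: indicator_def ennreal_mult'[symmetric] exp_add[symmetric] simp flip: ennreal_1
          intro!: ennreal_leI)
    finally show ?thesis .
  qed
  also have "\<dots> = ennreal (exp (- ((\<Sum>i\<in>J. c i) + t))) * (\<integral>\<^sup>+\<omega>. ennreal (exp (?S \<omega>)) \<partial>M)"
    by (intro nn_integral_cmult measurable_compose[OF S]) measurable
  also have "\<dots> \<le> ennreal (exp (- ((\<Sum>i\<in>J. c i) + t))) * ennreal (exp (\<Sum>i\<in>J. c i))"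
    by (intro mult_left_mono le) simp
  also have "\<dots> = ennreal (exp (- t))"
    by (simp add: ennreal_mult'[symmetric] exp_add[symmetric])
  finally show ?thesis by (simp add: emeasure_eq_measure)
qed

text \<open>Tilting the standard normal density by \<open>exp (x\<^sup>2 / 4)\<close> gives
  \<open>sqrt 2\<close> times the centred normal density of variance 2.\<close>

lemma (in prob_space) std_normal_exp_quarter_square:
  assumes g: "distributed M lborel g std_normal_density"
  shows "integrable M (\<lambda>\<omega>. exp ((g \<omega>)\<^sup>2 / 4))" "expectation (\<lambda>\<omega>. exp ((g \<omega>)\<^sup>2 / 4)) = sqrt 2"
proof -
  have eq: "std_normal_density x * exp (x\<^sup>2 / 4) = sqrt 2 * normal_density 0 (sqrt 2) x" for x :: real
  proof -
    have "exp (- (x\<^sup>2 / 2)) * exp (x\<^sup>2 / 4) = exp (- (x\<^sup>2 / 4))"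
      by (simp add: exp_add[symmetric] field_simps)
    then show ?thesis
      by (simp add: normal_density_def real_sqrt_mult field_simps)
  qed
  have m: "(\<lambda>x :: real. exp (x\<^sup>2 / 4)) \<in> borel_measurable lborel" by simp
  have "integrable lborel (\<lambda>x. std_normal_density x * exp (x\<^sup>2 / 4))"
    unfolding eq by (intro integrable_mult_right integrable_normal_density) simp
  then show "integrable M (\<lambda>\<omega>. exp ((g \<omega>)\<^sup>2 / 4))"
    using distributed_integrable[OF g m] by simp
  have "expectation (\<lambda>\<omega>. exp ((g \<omega>)\<^sup>2 / 4)) = (\<integral>x. std_normal_density x * exp (x\<^sup>2 / 4) \<partial>lborel)"
    using distributed_integral[OF g m] by simp
  then show "expectation (\<lambda>\<omega>. exp ((g \<omega>)\<^sup>2 / 4)) = sqrt 2"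
    unfolding eq by (simp add: integral_normal_density)
qed

lemma (in prob_space) std_normal_fourth_moment:
  assumes g: "distributed M lborel g std_normal_density"
  shows "integrable M (\<lambda>\<omega>. (g \<omega>) ^ 4)" "expectation (\<lambda>\<omega>. (g \<omega>) ^ 4) = 3"
proof -
  have m: "(\<lambda>x :: real. x ^ 4) \<in> borel_measurable lborel" by simp
  have h: "has_bochner_integral lborel (\<lambda>x. std_normal_density x * x ^ 4) 3"
    using std_normal_moment_even[of 2] by (simp add: fact_numeral)
  show "integrable M (\<lambda>\<omega>. (g \<omega>) ^ 4)"
    using distributed_integrable[OF g m] has_bochner_integral_iff[THEN iffD1, OF h] by simp
  show "expectation (\<lambda>\<omega>. (g \<omega>) ^ 4) = 3"
    using distributed_integral[OF g m] has_bochner_integral_iff[THEN iffD1, OF h] by simp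
qed

text \<open>The density is at most 41/100 and the interval has length 7/10.\<close>

lemma (in prob_space) std_normal_small_ball:
  assumes g: "distributed M lborel g std_normal_density"
  shows "prob {\<omega> \<in> space M. \<bar>g \<omega>\<bar> < 7 / 20} \<le> 287 / 1000"
proof -
  let ?A = "{-7/20<..<7/20 :: real}"
  have "{\<omega> \<in> space M. \<bar>g \<omega>\<bar> < 7 / 20} = g -` ?A \<inter> space M" by (auto simp: abs_less_iff)
  then have "emeasure M {\<omega> \<in> space M. \<bar>g \<omega>\<bar> < 7 / 20}
      = (\<integral>\<^sup>+x. ennreal (std_normal_density x) * indicator ?A x \<partial>lborel)"
    using distributed_emeasure[OF g, of ?A] by simp
  also have "\<dots> \<le> (\<integral>\<^sup>+x. ennreal (41 / 100) * indicator ?A x \<partial>lborel)"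
  proof (intro nn_integral_mono mult_right_mono ennreal_leI)
    fix x :: real
    have "sqrt (2 * pi) \<ge> 100 / 41"
      using pi_gt3 by (intro real_le_rsqrt) (simp add: power2_eq_square)
    then have "1 / sqrt (2 * pi) \<le> 41 / 100" by (simp add: field_simps)
    moreover have "exp (- (x\<^sup>2 / 2)) \<le> 1" by simp
    ultimately have "1 / sqrt (2 * pi) * exp (- (x\<^sup>2 / 2)) \<le> 41 / 100 * 1"
      by (intro mult_mono) auto
    then show "std_normal_density x \<le> 41 / 100" by (simp add: std_normal_density_def)
  qed simp
  also have "\<dots> = ennreal (287 / 1000)"
    by (simp add: nn_integral_cmult_indicator ennreal_mult'[symmetric])
  finally show ?thesis by (simp add: emeasure_eq_measure)
qed

text \<open>The factor \<open>exp x\<close> in the first remainder is what forces truncation for the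
  upper tail. The second bound, from \<open>exp (- x) \<le> 1 / (1 + x)\<close>, has a plain square
  as remainder, so the lower tail works without truncation.\<close>

lemma exp_le_quadratic:
  assumes "0 \<le> (x :: real)"
  shows "exp x \<le> 1 + x + x\<^sup>2 * exp x" "exp (- x) \<le> 1 - x + x\<^sup>2"
proof -
  have "(1 - x) * exp x \<le> exp (- x) * exp x"
    using exp_ge_add_one_self[of "- x"] by (intro mult_right_mono) auto
  then have *: "exp x - 1 \<le> x * exp x" by (simp add: exp_minus algebra_simps)
  then have "x * (exp x - 1) \<le> x * (x * exp x)" using assms by (intro mult_left_mono) auto
  with * show "exp x \<le> 1 + x + x\<^sup>2 * exp x" by (simp add: power2_eq_square algebra_simps)
  have "exp (- x) \<le> 1 / (1 + x)"
    using exp_ge_add_one_self[of x] assms by (simp add: exp_minus field_simps)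
  also have "\<dots> \<le> 1 - x + x\<^sup>2"
  proof -
    have "(1 - x + x\<^sup>2) * (1 + x) = 1 + x ^ 3" by (simp add: power2_eq_square power3_eq_cube algebra_simps)
    then have "1 \<le> (1 - x + x\<^sup>2) * (1 + x)" using assms by simp
    then show ?thesis using assms by (simp add: divide_le_eq)
  qed
  finally show "exp (- x) \<le> 1 - x + x\<^sup>2" .
qed

text \<open>Fourth power of t \<le> exp t at \<open>t = x\<^sup>2 / 32\<close>; the constant is
  \<open>32 ^ 4\<close>.\<close>

lemma power8_le_exp_square: "(x :: real) ^ 8 \<le> 2 ^ 20 * exp (x\<^sup>2 / 8)"
proof -
  have "x\<^sup>2 / 32 \<le> exp (x\<^sup>2 / 32)" using exp_ge_add_one_self[of "x\<^sup>2 / 32"] by linarith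
  then have "(x\<^sup>2 / 32) ^ 4 \<le> exp (x\<^sup>2 / 32) ^ 4" by (intro power_mono) auto
  also have "\<dots> = exp (x\<^sup>2 / 8)" by (simp add: exp_of_nat_mult[symmetric])
  finally show ?thesis by (simp add: power_divide power_mult[symmetric])
qed

text \<open>Young's inequality decouples the response from the direction, so that only the marginal
  laws of \<open>y\<close> and \<open>g\<close> matter for the second-order term of the moment generating functions.\<close>

lemma fourth_powers_exp_le:
  fixes y g :: real
  shows "y ^ 4 * g ^ 4 * exp (g\<^sup>2 / 16) \<le> 2 ^ 19 * (exp (y\<^sup>2 / 4) + exp (g\<^sup>2 / 4))"
proof -
  have "2 * (y ^ 4) * (g ^ 4 * exp (g\<^sup>2 / 16)) \<le> (y ^ 4)\<^sup>2 + (g ^ 4 * exp (g\<^sup>2 / 16))\<^sup>2"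
    by (rule sum_squares_bound)
  also have "\<dots> = y ^ 8 + g ^ 8 * exp (g\<^sup>2 / 8)"
    by (simp add: power_mult_distrib power_mult[symmetric] exp_double[symmetric])
  also have "\<dots> \<le> 2 ^ 20 * exp (y\<^sup>2 / 4) + 2 ^ 20 * exp (g\<^sup>2 / 4)"
  proof (rule add_mono)
    have "exp (y\<^sup>2 / 8) \<le> exp (y\<^sup>2 / 4)" by simp
    then show "y ^ 8 \<le> 2 ^ 20 * exp (y\<^sup>2 / 4)"
      by (intro order_trans[OF power8_le_exp_square]) simp
    have "g ^ 8 * exp (g\<^sup>2 / 8) \<le> 2 ^ 20 * exp (g\<^sup>2 / 8) * exp (g\<^sup>2 / 8)"
      by (intro mult_right_mono power8_le_exp_square) simp
    also have "\<dots> = 2 ^ 20 * exp (g\<^sup>2 / 4)" by (simp add: exp_add[symmetric])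
    finally show "g ^ 8 * exp (g\<^sup>2 / 8) \<le> 2 ^ 20 * exp (g\<^sup>2 / 4)" .
  qed
  finally show ?thesis by simp
qed

text \<open>Capping the squared response at \<open>T\<close> with \<open>s * T \<le> 1 / 16\<close>
  keeps the exponent below \<open>g\<^sup>2 / 16\<close>, so the quadratic remainder is dominated by
  the Gaussian-integrable \<open>H\<close>. The linear term keeps the uncapped product, so its
  expectation is exactly the mixed fourth moment.\<close>

lemma exp_square_product_bounds:
  fixes y g s T :: real
  assumes s: "0 \<le> s" and T: "s * T \<le> 1 / 16"
  defines "H \<equiv> 2 ^ 19 * (exp (y\<^sup>2 / 4) + exp (g\<^sup>2 / 4))"
  shows "exp (s * (min (y\<^sup>2) T * g\<^sup>2)) \<le> 1 + s * (y\<^sup>2 * g\<^sup>2) + s\<^sup>2 * H"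
    and "exp (- (s * (y\<^sup>2 * g\<^sup>2))) \<le> 1 - s * (y\<^sup>2 * g\<^sup>2) + s\<^sup>2 * H"
proof -
  have H: "y ^ 4 * g ^ 4 * exp (g\<^sup>2 / 16) \<le> H" unfolding H_def by (rule fourth_powers_exp_le)
  have sq: "(y\<^sup>2 * g\<^sup>2)\<^sup>2 = y ^ 4 * g ^ 4" by (simp add: power_mult_distrib power_mult[symmetric])
  have "y ^ 4 * g ^ 4 * 1 \<le> y ^ 4 * g ^ 4 * exp (g\<^sup>2 / 16)"
    by (intro mult_left_mono) (auto simp: zero_le_even_power)
  then have "(y\<^sup>2 * g\<^sup>2)\<^sup>2 \<le> H" using H sq by linarith
  then have "(s * (y\<^sup>2 * g\<^sup>2))\<^sup>2 \<le> s\<^sup>2 * H"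
    by (subst power_mult_distrib) (intro mult_left_mono, auto)
  then show "exp (- (s * (y\<^sup>2 * g\<^sup>2))) \<le> 1 - s * (y\<^sup>2 * g\<^sup>2) + s\<^sup>2 * H"
    using exp_le_quadratic(2)[of "s * (y\<^sup>2 * g\<^sup>2)"] s by simp
  show "exp (s * (min (y\<^sup>2) T * g\<^sup>2)) \<le> 1 + s * (y\<^sup>2 * g\<^sup>2) + s\<^sup>2 * H"
  proof (cases "T \<ge> 0")
    case True
    let ?V = "min (y\<^sup>2) T * g\<^sup>2"
    have V: "0 \<le> ?V" "?V \<le> y\<^sup>2 * g\<^sup>2" using True by (auto intro!: mult_right_mono)
    have sV: "s * ?V \<le> s * (y\<^sup>2 * g\<^sup>2)" using V(2) s by (rule mult_left_mono)
    have "s * ?V \<le> s * (T * g\<^sup>2)" using s by (intro mult_left_mono mult_right_mono) auto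
    also have "\<dots> = (s * T) * g\<^sup>2" by simp
    also have "\<dots> \<le> 1 / 16 * g\<^sup>2" using T by (intro mult_right_mono) auto
    finally have e: "exp (s * ?V) \<le> exp (g\<^sup>2 / 16)" by simp
    have "(s * ?V)\<^sup>2 * exp (s * ?V) \<le> (s * (y\<^sup>2 * g\<^sup>2))\<^sup>2 * exp (g\<^sup>2 / 16)"
      using V(1) s by (intro mult_mono[OF power_mono[OF sV] e]) simp_all
    also have "\<dots> = s\<^sup>2 * (y ^ 4 * g ^ 4 * exp (g\<^sup>2 / 16))"
      by (simp add: power_mult_distrib power_mult[symmetric])
    also have "\<dots> \<le> s\<^sup>2 * H" using H by (intro mult_left_mono) auto
    finally show ?thesis
      using exp_le_quadratic(1)[of "s * ?V"] s V(1) sV by (simp add: mult_nonneg_nonneg)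
  next
    case False
    have "min (y\<^sup>2) T * g\<^sup>2 \<le> 0" using False by (intro mult_nonpos_nonneg) auto
    then have "s * (min (y\<^sup>2) T * g\<^sup>2) \<le> 0" using s by (simp add: mult_nonneg_nonpos)
    then have "exp (s * (min (y\<^sup>2) T * g\<^sup>2)) \<le> 1" by simp
    moreover have "0 \<le> s * (y\<^sup>2 * g\<^sup>2)" "0 \<le> s\<^sup>2 * H" using s by (auto simp: H_def)
    ultimately show ?thesis by linarith
  qed
qed

text \<open>Isolates the covariates. Labels will enter only through deterministic index subsets and
  deterministic vectors attached to the indices.\<close>

locale gaussian_design = prob_space M for M :: "'a measure" +
  fixes k :: nat and I :: "nat set" and X :: "nat \<Rightarrow> 'a \<Rightarrow> real vec"
  assumes finite_I: "finite I"
    and normal: "\<And>i j. i \<in> I \<Longrightarrow> j < k \<Longrightarrow> distributed M lborel (\<lambda>\<omega>. X i \<omega> $ j) std_normal_density"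
    and indep: "indep_vars (\<lambda>_. borel) (\<lambda>(i, j) \<omega>. X i \<omega> $ j) (I \<times> {..<k})"
begin

section \<open>Linear functionals of a Gaussian design\<close>

lemma inner_eq_sum: "a \<in> carrier_vec k \<Longrightarrow> X i \<omega> \<bullet> a = (\<Sum>j<k. X i \<omega> $ j * a $ j)"
  by (simp add: scalar_prod_def lessThan_atLeast0)

lemma coordinate_measurable [measurable]:
  "i \<in> I \<Longrightarrow> j < k \<Longrightarrow> (\<lambda>\<omega>. X i \<omega> $ j) \<in> borel_measurable M"
  using distributed_measurable[OF normal] by simp

lemma inner_measurable [measurable]:
  assumes "i \<in> I" "a \<in> carrier_vec k"
  shows "(\<lambda>\<omega>. X i \<omega> \<bullet> a) \<in> borel_measurable M"
  unfolding inner_eq_sum[OF assms(2)] using coordinate_measurable[OF assms(1)]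
  by (intro borel_measurable_sum borel_measurable_times) auto

lemma inner_normal:
  assumes i: "i \<in> I" and a: "a \<in> carrier_vec k" "a \<bullet> a = 1"
  shows "distributed M lborel (\<lambda>\<omega>. X i \<omega> \<bullet> a) std_normal_density"
proof -
  \<comment> \<open>Coordinates with zero coefficient are dropped, because a normal density needs a
    positive standard deviation.\<close>
  define J where "J = {j. j < k \<and> a $ j \<noteq> 0}"
  have fin: "finite J" by (simp add: J_def)
  have sum_J: "(\<Sum>j<k. f j * a $ j) = (\<Sum>j\<in>J. f j * a $ j)" for f :: "nat \<Rightarrow> real"
    by (intro sum.mono_neutral_right) (auto simp: J_def)
  have sq: "(\<Sum>j\<in>J. (a $ j)\<^sup>2) = 1"
    using sum_J[of "\<lambda>j. a $ j"] a by (simp add: scalar_prod_def lessThan_atLeast0 power2_eq_square)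
  then have "J \<noteq> {}" by auto
  define J' where "J' = Pair i ` J"
  have "indep_vars (\<lambda>_. borel) (\<lambda>(i, j) \<omega>. X i \<omega> $ j) J'"
    by (rule indep_vars_subset[OF indep]) (use i in \<open>auto simp: J_def J'_def\<close>)
  then have ind: "indep_vars (\<lambda>_. borel) (\<lambda>p \<omega>. (case p of (i, j) \<Rightarrow> \<lambda>\<omega>. X i \<omega> $ j) \<omega> * a $ snd p) J'"
    by (rule indep_vars_compose2[where Y = "\<lambda>p x. x * a $ snd p"]) measurable
  have dist: "distributed M lborel (\<lambda>\<omega>. (case p of (i, j) \<Rightarrow> \<lambda>\<omega>. X i \<omega> $ j) \<omega> * a $ snd p)
      (normal_density ((\<lambda>_. 0) p) \<bar>a $ snd p\<bar>)" if "p \<in> J'" for p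
    using normal_density_affine[OF normal[OF i, of "snd p"], of "a $ snd p" 0] that
    by (auto simp: J_def J'_def mult.commute)
  have inj: "inj_on (Pair i) J" by (simp add: inj_on_def)
  have "distributed M lborel (\<lambda>\<omega>. \<Sum>p\<in>J'. (case p of (i, j) \<Rightarrow> \<lambda>\<omega>. X i \<omega> $ j) \<omega> * a $ snd p)
      (normal_density (\<Sum>p\<in>J'. 0) (sqrt (\<Sum>p\<in>J'. \<bar>a $ snd p\<bar>\<^sup>2)))"
    using fin \<open>J \<noteq> {}\<close> by (intro sum_indep_normal ind dist) (auto simp: J_def J'_def)
  then show ?thesis unfolding inner_eq_sum[OF a(1)] sum_J J'_def sum.reindex[OF inj] using sq by simp
qed

text \<open>Each variable depends only on the coordinate block of its own sample, and disjoint
  blocks of independent coordinates are independent. A pair is needed because the response and the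
  projection of the same sample are dependent in general.\<close>

lemma indep_vars_inner_pair:
  fixes \<phi> :: "nat \<Rightarrow> real \<times> real \<Rightarrow> real"
  assumes "J \<subseteq> I" and a: "\<And>i. i \<in> J \<Longrightarrow> a i \<in> carrier_vec k" "\<And>i. i \<in> J \<Longrightarrow> b i \<in> carrier_vec k"
    and \<phi>: "\<And>i. i \<in> J \<Longrightarrow> \<phi> i \<in> borel_measurable (borel \<Otimes>\<^sub>M borel)"
  shows "indep_vars (\<lambda>_. borel) (\<lambda>i \<omega>. \<phi> i (X i \<omega> \<bullet> a i, X i \<omega> \<bullet> b i)) J"
proof -
  let ?Q = "\<lambda>i. {i} \<times> {..<k}"
  let ?x = "\<lambda>(i, j) \<omega>. X i \<omega> $ j"
  have "indep_vars (\<lambda>i. Pi\<^sub>M (?Q i) (\<lambda>_. borel)) (\<lambda>i \<omega>. \<lambda>p\<in>?Q i. ?x p \<omega>) J"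
    by (rule indep_vars_restrict[OF indep]) (use assms(1) in \<open>auto simp: disjoint_family_on_def\<close>)
  moreover define G where "G i v = \<phi> i (\<Sum>j<k. v (i, j) * a i $ j, \<Sum>j<k. v (i, j) * b i $ j)"
    for i and v :: "nat \<times> nat \<Rightarrow> real"
  have "G i \<in> borel_measurable (Pi\<^sub>M (?Q i) (\<lambda>_. borel))" if "i \<in> J" for i
  proof -
    have *: "(\<lambda>v. v (i, j)) \<in> borel_measurable (Pi\<^sub>M (?Q i) (\<lambda>_. borel :: real measure))" if "j < k" for j
      by (rule measurable_component_singleton) (use that in auto)
    have "(\<lambda>v. (\<Sum>j<k. v (i, j) * a i $ j, \<Sum>j<k. v (i, j) * b i $ j))
        \<in> Pi\<^sub>M (?Q i) (\<lambda>_. borel) \<rightarrow>\<^sub>M borel \<Otimes>\<^sub>M borel"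
      by (intro measurable_Pair borel_measurable_sum borel_measurable_times borel_measurable_const *) auto
    from measurable_compose[OF this \<phi>[OF that]] show ?thesis by (simp add: G_def[abs_def])
  qed
  ultimately have "indep_vars (\<lambda>_. borel) (\<lambda>i \<omega>. G i (\<lambda>p\<in>?Q i. ?x p \<omega>)) J"
    by (rule indep_vars_compose2)
  moreover have "G i (\<lambda>p\<in>?Q i. ?x p \<omega>) = \<phi> i (X i \<omega> \<bullet> a i, X i \<omega> \<bullet> b i)" if "i \<in> J" for i \<omega>
    using that by (simp add: G_def inner_eq_sum a)
  ultimately show ?thesis by (simp cong: indep_vars_cong)
qed

lemma inner_fourth_moment:
  assumes i: "i \<in> I" and v: "v \<in> carrier_vec k"
  shows "integrable M (\<lambda>\<omega>. (X i \<omega> \<bullet> v) ^ 4)" "expectation (\<lambda>\<omega>. (X i \<omega> \<bullet> v) ^ 4) = 3 * (v \<bullet> v)\<^sup>2"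
proof -
  have "integrable M (\<lambda>\<omega>. (X i \<omega> \<bullet> v) ^ 4) \<and> expectation (\<lambda>\<omega>. (X i \<omega> \<bullet> v) ^ 4) = 3 * (v \<bullet> v)\<^sup>2"
  proof (cases "v = 0\<^sub>v k")
    case True
    then have "X i \<omega> \<bullet> v = 0" for \<omega> unfolding inner_eq_sum[OF v] by simp
    then show ?thesis using True by simp
  next
    case False
    note u = unit_normalize[OF v False]
    let ?u = "(1 / l2_norm v) \<cdot>\<^sub>v v"
    have "X i \<omega> \<bullet> v = l2_norm v * (X i \<omega> \<bullet> ?u)" for \<omega>
      unfolding inner_eq_sum[OF v] inner_eq_sum[OF u(1)] using v u(4)
      by (simp add: sum_distrib_left)
    then have eq: "(X i \<omega> \<bullet> v) ^ 4 = (v \<bullet> v)\<^sup>2 * (X i \<omega> \<bullet> ?u) ^ 4" for \<omega>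
      by (simp add: power_mult_distrib flip: l2_norm_sq)
    show ?thesis unfolding eq
      using std_normal_fourth_moment[OF inner_normal[OF i u(1,2)]] by simp
  qed
  then show "integrable M (\<lambda>\<omega>. (X i \<omega> \<bullet> v) ^ 4)" "expectation (\<lambda>\<omega>. (X i \<omega> \<bullet> v) ^ 4) = 3 * (v \<bullet> v)\<^sup>2"
    by auto
qed

text \<open>Polarisation reduces the mixed fourth moment to pure ones.\<close>

lemma inner_mixed_fourth_moment:
  assumes i: "i \<in> I" and b: "b \<in> carrier_vec k" "b \<bullet> b = 1" and a: "a \<in> carrier_vec k" "a \<bullet> a = 1"
  shows "integrable M (\<lambda>\<omega>. (X i \<omega> \<bullet> b)\<^sup>2 * (X i \<omega> \<bullet> a)\<^sup>2)"
    "expectation (\<lambda>\<omega>. (X i \<omega> \<bullet> b)\<^sup>2 * (X i \<omega> \<bullet> a)\<^sup>2) = 1 + 2 * (b \<bullet> a)\<^sup>2"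
proof -
  have c: "b + a \<in> carrier_vec k" "b - a \<in> carrier_vec k" using a b by auto
  have add: "X i \<omega> \<bullet> (b + a) = X i \<omega> \<bullet> b + X i \<omega> \<bullet> a" for \<omega>
    unfolding inner_eq_sum[OF a(1)] inner_eq_sum[OF b(1)] inner_eq_sum[OF c(1)]
    using a(1) by (simp add: sum.distrib distrib_left)
  have sub: "X i \<omega> \<bullet> (b - a) = X i \<omega> \<bullet> b - X i \<omega> \<bullet> a" for \<omega>
    unfolding inner_eq_sum[OF a(1)] inner_eq_sum[OF b(1)] inner_eq_sum[OF c(2)]
    using a(1) by (simp add: sum_subtractf right_diff_distrib)
  have pol: "y\<^sup>2 * g\<^sup>2 = ((y + g) ^ 4 + (y - g) ^ 4 - 2 * y ^ 4 - 2 * g ^ 4) / 12" for y g :: real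
    by (simp add: power4_eq_xxxx power2_eq_square algebra_simps)
  have eq: "(X i \<omega> \<bullet> b)\<^sup>2 * (X i \<omega> \<bullet> a)\<^sup>2 = ((X i \<omega> \<bullet> (b + a)) ^ 4 + (X i \<omega> \<bullet> (b - a)) ^ 4
      - 2 * (X i \<omega> \<bullet> b) ^ 4 - 2 * (X i \<omega> \<bullet> a) ^ 4) / 12" for \<omega>
    unfolding add sub by (rule pol)
  note m = inner_fourth_moment[OF i c(1)] inner_fourth_moment[OF i c(2)]
    inner_fourth_moment[OF i a(1)] inner_fourth_moment[OF i b(1)]
  show "integrable M (\<lambda>\<omega>. (X i \<omega> \<bullet> b)\<^sup>2 * (X i \<omega> \<bullet> a)\<^sup>2)"
    unfolding eq using m by simp
  have "expectation (\<lambda>\<omega>. (X i \<omega> \<bullet> b)\<^sup>2 * (X i \<omega> \<bullet> a)\<^sup>2)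
      = (3 * ((b + a) \<bullet> (b + a))\<^sup>2 + 3 * ((b - a) \<bullet> (b - a))\<^sup>2 - 2 * 3 - 2 * 3) / 12"
    unfolding eq using m a b by simp
  also have "\<dots> = 1 + 2 * (b \<bullet> a)\<^sup>2"
    using a b by (simp add: scalar_prod_add_self[of _ k] scalar_prod_minus_self[of _ k]
        power2_eq_square algebra_simps)
  finally show "expectation (\<lambda>\<omega>. (X i \<omega> \<bullet> b)\<^sup>2 * (X i \<omega> \<bullet> a)\<^sup>2) = 1 + 2 * (b \<bullet> a)\<^sup>2" .
qed

text \<open>Chernoff at parameter 1/4, where the moment generating function is
  \<open>sqrt 2 \<le> exp (7 / 20)\<close>. The exponent 3/8 of the threshold exceeds 7/20 by
  1/40.\<close>

lemma inner_square_upper_tail: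
  assumes J: "J \<subseteq> I" and a: "a \<in> carrier_vec k" "a \<bullet> a = 1"
  shows "prob {\<omega> \<in> space M. 3 / 2 * real (card J) \<le> (\<Sum>i\<in>J. (X i \<omega> \<bullet> a)\<^sup>2)} \<le> exp (- (real (card J) / 40))"
proof -
  let ?Y = "\<lambda>i \<omega>. (X i \<omega> \<bullet> a)\<^sup>2 / 4"
  have fin: "finite J" using J finite_I finite_subset by blast
  have ind: "indep_vars (\<lambda>_. borel) ?Y J"
    using indep_vars_inner_pair[OF J, of "\<lambda>_. a" "\<lambda>_. a" "\<lambda>_ p. (fst p)\<^sup>2 / 4"] a by simp
  have mgf: "(\<integral>\<^sup>+\<omega>. ennreal (exp (?Y i \<omega>)) \<partial>M) \<le> ennreal (exp (7 / 20))" if "i \<in> J" for i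
  proof -
    note n = std_normal_exp_quarter_square[OF inner_normal[OF _ a, of i]]
    have i: "i \<in> I" using that J by blast
    have "(\<integral>\<^sup>+\<omega>. ennreal (exp (?Y i \<omega>)) \<partial>M) = ennreal (sqrt 2)"
      using nn_integral_eq_integral[OF n(1)[OF i]] n(2)[OF i] by simp
    also have "sqrt 2 \<le> exp (7 / 20 :: real)"
    proof (rule real_le_lsqrt)
      have "2 = exp (ln 2 :: real)" by simp
      also have "\<dots> \<le> exp (7 / 10)" unfolding exp_le_cancel_iff using ln2_le_25_over_36 by linarith
      also have "\<dots> = (exp (7 / 20 :: real))\<^sup>2" by (simp add: exp_double[symmetric])
      finally show "2 \<le> (exp (7 / 20 :: real))\<^sup>2" .
    qed auto
    finally show ?thesis by (simp add: ennreal_leI)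
  qed
  show ?thesis
    using chernoff_indep_sum[OF fin ind mgf, of "real (card J) / 40"]
    by (simp add: sum_divide_distrib[symmetric] field_simps)
qed

text \<open>Chernoff at parameter 1/10: the moment generating function is at most 1 + 11/100 *
  287/1000, below \<open>exp (316 / 10000)\<close>, while the threshold contributes 320/10000. The
  gap is 1/2500.\<close>

lemma small_ball_count_tail:
  assumes J: "J \<subseteq> I" and a: "a \<in> carrier_vec k" "a \<bullet> a = 1"
  shows "prob {\<omega> \<in> space M. 8 / 25 * real (card J) \<le> real (card {i \<in> J. \<bar>X i \<omega> \<bullet> a\<bar> < 7 / 20})}
    \<le> exp (- (real (card J) / 2500))"
proof -
  let ?B = "\<lambda>x. indicator {x. \<bar>x\<bar> < 7 / 20} (x :: real) :: real"
  let ?Y = "\<lambda>i \<omega>. ?B (X i \<omega> \<bullet> a) / 10"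
  have fin: "finite J" using J finite_I finite_subset by blast
  have ind: "indep_vars (\<lambda>_. borel) ?Y J"
    using indep_vars_inner_pair[OF J, of "\<lambda>_. a" "\<lambda>_. a" "\<lambda>_ p. ?B (fst p) / 10"] a by simp
  have mgf: "(\<integral>\<^sup>+\<omega>. ennreal (exp (?Y i \<omega>)) \<partial>M) \<le> ennreal (exp (316 / 10000))" if "i \<in> J" for i
  proof -
    let ?A = "{\<omega> \<in> space M. \<bar>X i \<omega> \<bullet> a\<bar> < 7 / 20}"
    have i: "i \<in> I" using that J by blast
    have A: "?A \<in> sets M" using inner_measurable[OF i a(1)] by measurable
    have "(\<integral>\<^sup>+\<omega>. ennreal (exp (?Y i \<omega>)) \<partial>M) \<le> (\<integral>\<^sup>+\<omega>. 1 + ennreal (11 / 100) * indicator ?A \<omega> \<partial>M)"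
    proof (rule nn_integral_mono)
      fix \<omega> assume "\<omega> \<in> space M"
      have "exp (1 / 10 :: real) \<le> 1 + 11 / 100" using exp_bound[of "1 / 10"] by (simp add: power2_eq_square)
      then have "ennreal (exp (1 / 10)) \<le> 1 + ennreal (11 / 100)"
        by (simp add: ennreal_leI flip: ennreal_plus ennreal_1)
      then show "ennreal (exp (?Y i \<omega>)) \<le> 1 + ennreal (11 / 100) * indicator ?A \<omega>"
        using \<open>\<omega> \<in> space M\<close> by (simp add: indicator_def)
    qed
    also have "\<dots> = 1 + ennreal (11 / 100) * ennreal (prob ?A)"
      using A by (simp add: nn_integral_add nn_integral_cmult_indicator emeasure_eq_measure prob_space)
    also have "\<dots> = ennreal (1 + 11 / 100 * prob ?A)"
      using ennreal_plus[of 1 "11 / 100 * prob ?A"] ennreal_mult'[of "11 / 100" "prob ?A"] by simp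
    also have "\<dots> \<le> ennreal (exp (316 / 10000))"
    proof (rule ennreal_leI)
      show "1 + 11 / 100 * prob ?A \<le> exp (316 / 10000)"
        using std_normal_small_ball[OF inner_normal[OF i a]] exp_ge_add_one_self[of "316 / 10000 :: real"]
        by linarith
    qed
    finally show ?thesis .
  qed
  have sum_Y: "(\<Sum>i\<in>J. ?Y i \<omega>) = real (card {i \<in> J. \<bar>X i \<omega> \<bullet> a\<bar> < 7 / 20}) / 10" for \<omega>
    using fin by (simp add: indicator_def sum_divide_distrib[symmetric] Int_def flip: sum.inter_filter)
  have threshold: "(\<Sum>i\<in>J. 316 / 10000) + real (card J) / 2500 \<le> C / 10 \<longleftrightarrow> 8 / 25 * real (card J) \<le> C"
    for C :: real by auto
  show ?thesis
    using chernoff_indep_sum[OF fin ind mgf, of "real (card J) / 2500"] unfolding sum_Y threshold .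
qed

text \<open>The first-order term is the exact mixed fourth moment; 1500000 bounds
  \<open>2 ^ 20 * sqrt 2\<close>, the expectation of the dominating function of the second-order
  term.\<close>

lemma response_square_mgf:
  assumes i: "i \<in> I" and b: "b \<in> carrier_vec k" "b \<bullet> b = 1" and a: "a \<in> carrier_vec k" "a \<bullet> a = 1"
    and s: "0 \<le> s" "s * T \<le> 1 / 16"
  shows "(\<integral>\<^sup>+\<omega>. ennreal (exp (s * (min ((X i \<omega> \<bullet> b)\<^sup>2) T * (X i \<omega> \<bullet> a)\<^sup>2))) \<partial>M)
      \<le> ennreal (exp (s * (1 + 2 * (b \<bullet> a)\<^sup>2) + s\<^sup>2 * 1500000))"
    and "(\<integral>\<^sup>+\<omega>. ennreal (exp (- (s * ((X i \<omega> \<bullet> b)\<^sup>2 * (X i \<omega> \<bullet> a)\<^sup>2)))) \<partial>M)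
      \<le> ennreal (exp (- s * (1 + 2 * (b \<bullet> a)\<^sup>2) + s\<^sup>2 * 1500000))"
proof -
  let ?W = "\<lambda>\<omega>. (X i \<omega> \<bullet> b)\<^sup>2 * (X i \<omega> \<bullet> a)\<^sup>2"
  let ?H = "\<lambda>\<omega>. 2 ^ 19 * (exp ((X i \<omega> \<bullet> b)\<^sup>2 / 4) + exp ((X i \<omega> \<bullet> a)\<^sup>2 / 4))"
  note W = inner_mixed_fourth_moment[OF i b a]
  note na = std_normal_exp_quarter_square[OF inner_normal[OF i a]]
  note nb = std_normal_exp_quarter_square[OF inner_normal[OF i b]]
  have H: "integrable M ?H" "expectation ?H = 2 ^ 20 * sqrt 2" using na nb by simp_all
  have "sqrt 2 \<le> 143 / 100" by (rule real_le_lsqrt) (simp_all add: power2_eq_square)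
  then have K: "2 ^ 20 * sqrt 2 \<le> 1500000" by simp
  have bound: "(\<integral>\<^sup>+\<omega>. ennreal (F \<omega>) \<partial>M) \<le> ennreal (exp (t * (1 + 2 * (b \<bullet> a)\<^sup>2) + s\<^sup>2 * 1500000))"
    if F: "\<And>\<omega>. 0 \<le> F \<omega>" "\<And>\<omega>. F \<omega> \<le> 1 + t * ?W \<omega> + s\<^sup>2 * ?H \<omega>" for F t
  proof -
    have int: "integrable M (\<lambda>\<omega>. 1 + t * ?W \<omega> + s\<^sup>2 * ?H \<omega>)"
      by (intro Bochner_Integration.integrable_add integrable_mult_right W H) simp
    have "(\<integral>\<^sup>+\<omega>. ennreal (F \<omega>) \<partial>M) \<le> (\<integral>\<^sup>+\<omega>. ennreal (1 + t * ?W \<omega> + s\<^sup>2 * ?H \<omega>) \<partial>M)"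
      by (intro nn_integral_mono ennreal_leI F)
    also have "\<dots> = ennreal (expectation (\<lambda>\<omega>. 1 + t * ?W \<omega> + s\<^sup>2 * ?H \<omega>))"
      by (rule nn_integral_eq_integral[OF int]) (use order_trans[OF F] in auto)
    also have "expectation (\<lambda>\<omega>. 1 + t * ?W \<omega> + s\<^sup>2 * ?H \<omega>)
        = expectation (\<lambda>\<omega>. 1 + t * ?W \<omega>) + expectation (\<lambda>\<omega>. s\<^sup>2 * ?H \<omega>)"
      by (intro Bochner_Integration.integral_add Bochner_Integration.integrable_add
          integrable_mult_right W H) simp
    also have "\<dots> = 1 + t * (1 + 2 * (b \<bullet> a)\<^sup>2) + s\<^sup>2 * (2 ^ 20 * sqrt 2)"
      using W H(2) by (simp add: prob_space)
    also have "\<dots> \<le> 1 + (t * (1 + 2 * (b \<bullet> a)\<^sup>2) + s\<^sup>2 * 1500000)"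
      using mult_left_mono[OF K, of "s\<^sup>2"] by simp
    also have "\<dots> \<le> exp (t * (1 + 2 * (b \<bullet> a)\<^sup>2) + s\<^sup>2 * 1500000)" by (rule exp_ge_add_one_self)
    finally show ?thesis by (simp add: ennreal_leI)
  qed
  show "(\<integral>\<^sup>+\<omega>. ennreal (exp (s * (min ((X i \<omega> \<bullet> b)\<^sup>2) T * (X i \<omega> \<bullet> a)\<^sup>2))) \<partial>M)
      \<le> ennreal (exp (s * (1 + 2 * (b \<bullet> a)\<^sup>2) + s\<^sup>2 * 1500000))"
    by (rule bound) (use exp_square_product_bounds(1)[OF s] in auto)
  show "(\<integral>\<^sup>+\<omega>. ennreal (exp (- (s * ((X i \<omega> \<bullet> b)\<^sup>2 * (X i \<omega> \<bullet> a)\<^sup>2)))) \<partial>M)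
      \<le> ennreal (exp (- s * (1 + 2 * (b \<bullet> a)\<^sup>2) + s\<^sup>2 * 1500000))"
    by (rule bound) (use exp_square_product_bounds(2)[OF s] in auto)
qed

text \<open>Each sample carries its own vector \<open>b i\<close>, which covers both regressors once
  the labels are fixed. The choice of \<open>s\<close> is left open, since it depends on the
  truncation level as well as on the accuracy.\<close>

lemma response_square_tails:
  fixes b :: "nat \<Rightarrow> real vec"
  assumes J: "J \<subseteq> I" and b: "\<And>i. i \<in> J \<Longrightarrow> b i \<in> carrier_vec k" "\<And>i. i \<in> J \<Longrightarrow> b i \<bullet> b i = 1"
    and a: "a \<in> carrier_vec k" "a \<bullet> a = 1" and s: "0 < s" "s * T \<le> 1 / 16"
  defines "m \<equiv> \<Sum>i\<in>J. 1 + 2 * (b i \<bullet> a)\<^sup>2"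
  shows "prob {\<omega> \<in> space M. m + \<eta> * real (card J) \<le> (\<Sum>i\<in>J. min ((X i \<omega> \<bullet> b i)\<^sup>2) T * (X i \<omega> \<bullet> a)\<^sup>2)}
      \<le> exp (- (real (card J) * (s * \<eta> - s\<^sup>2 * 1500000)))"
    and "prob {\<omega> \<in> space M. (\<Sum>i\<in>J. (X i \<omega> \<bullet> b i)\<^sup>2 * (X i \<omega> \<bullet> a)\<^sup>2) \<le> m - \<eta> * real (card J)}
      \<le> exp (- (real (card J) * (s * \<eta> - s\<^sup>2 * 1500000)))"
proof -
  have fin: "finite J" using J finite_I finite_subset by blast
  have iI: "i \<in> I" if "i \<in> J" for i using that J by blast
  let ?t = "real (card J) * (s * \<eta> - s\<^sup>2 * 1500000)"
  let ?U = "\<lambda>i \<omega>. s * (min ((X i \<omega> \<bullet> b i)\<^sup>2) T * (X i \<omega> \<bullet> a)\<^sup>2)"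
  let ?cU = "\<lambda>i. s * (1 + 2 * (b i \<bullet> a)\<^sup>2) + s\<^sup>2 * 1500000"
  have indU: "indep_vars (\<lambda>_. borel) ?U J"
    using indep_vars_inner_pair[OF J, of b "\<lambda>_. a" "\<lambda>_ p. s * (min ((fst p)\<^sup>2) T * (snd p)\<^sup>2)"] a b
    by simp
  have "(\<Sum>i\<in>J. ?cU i) + ?t = s * (m + \<eta> * real (card J))"
    by (simp add: m_def sum.distrib sum_distrib_left algebra_simps)
  moreover have "(\<Sum>i\<in>J. ?U i \<omega>) = s * (\<Sum>i\<in>J. min ((X i \<omega> \<bullet> b i)\<^sup>2) T * (X i \<omega> \<bullet> a)\<^sup>2)" for \<omega>
    by (simp add: sum_distrib_left)
  ultimately show "prob {\<omega> \<in> space M. m + \<eta> * real (card J) \<le> (\<Sum>i\<in>J. min ((X i \<omega> \<bullet> b i)\<^sup>2) T * (X i \<omega> \<bullet> a)\<^sup>2)}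
      \<le> exp (- ?t)"
    using chernoff_indep_sum[OF fin indU response_square_mgf(1)[OF iI b a less_imp_le[OF s(1)] s(2)], of ?t] s(1)
    by (simp only: mult_le_cancel_left_pos)
  let ?L = "\<lambda>i \<omega>. - (s * ((X i \<omega> \<bullet> b i)\<^sup>2 * (X i \<omega> \<bullet> a)\<^sup>2))"
  let ?cL = "\<lambda>i. - s * (1 + 2 * (b i \<bullet> a)\<^sup>2) + s\<^sup>2 * 1500000"
  have indL: "indep_vars (\<lambda>_. borel) ?L J"
    using indep_vars_inner_pair[OF J, of b "\<lambda>_. a" "\<lambda>_ p. - (s * ((fst p)\<^sup>2 * (snd p)\<^sup>2))"] a b
    by simp
  have "(\<Sum>i\<in>J. ?cL i) + ?t = - (s * (m - \<eta> * real (card J)))"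
    by (simp add: m_def sum.distrib sum_distrib_left sum_negf sum_subtractf algebra_simps)
  moreover have "(\<Sum>i\<in>J. ?L i \<omega>) = - (s * (\<Sum>i\<in>J. (X i \<omega> \<bullet> b i)\<^sup>2 * (X i \<omega> \<bullet> a)\<^sup>2))" for \<omega>
    by (simp add: sum_distrib_left sum_negf)
  ultimately show "prob {\<omega> \<in> space M. (\<Sum>i\<in>J. (X i \<omega> \<bullet> b i)\<^sup>2 * (X i \<omega> \<bullet> a)\<^sup>2) \<le> m - \<eta> * real (card J)}
      \<le> exp (- ?t)"
    using chernoff_indep_sum[OF fin indL response_square_mgf(2)[OF iI b a less_imp_le[OF s(1)] s(2)], of ?t] s(1)
    by (simp only: mult_le_cancel_left_pos neg_le_iff_le)
qed

lemma inner_square_large: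
  assumes i: "i \<in> I" and b: "b \<in> carrier_vec k" "b \<bullet> b = 1"
  shows "prob {\<omega> \<in> space M. T < (X i \<omega> \<bullet> b)\<^sup>2} \<le> 2 * exp (- (T / 4))"
proof -
  note n = std_normal_exp_quarter_square[OF inner_normal[OF i b]]
  have [measurable]: "(\<lambda>\<omega>. X i \<omega> \<bullet> b) \<in> borel_measurable M" by (rule inner_measurable[OF i b(1)])
  have "prob {\<omega> \<in> space M. T < (X i \<omega> \<bullet> b)\<^sup>2}
      \<le> prob {\<omega> \<in> space M. exp (T / 4) \<le> exp ((X i \<omega> \<bullet> b)\<^sup>2 / 4)}"
  proof (rule finite_measure_mono)
    show "{\<omega> \<in> space M. exp (T / 4) \<le> exp ((X i \<omega> \<bullet> b)\<^sup>2 / 4)} \<in> events" by measurable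
  qed auto
  also have "\<dots> \<le> expectation (\<lambda>\<omega>. exp ((X i \<omega> \<bullet> b)\<^sup>2 / 4)) / exp (T / 4)"
    by (rule integral_Markov_inequality_measure[OF n(1), where A = "{}"]) auto
  also have "\<dots> = sqrt 2 * exp (- (T / 4))"
    by (simp only: n(2) exp_minus inverse_eq_divide times_divide_eq_right mult_1_right)
  also have "\<dots> \<le> 2 * exp (- (T / 4))"
    by (intro mult_right_mono real_le_lsqrt) auto
  finally show ?thesis .
qed

end

section \<open>Deterministic consequences of concentration\<close>

lemma scalar_prod_vec_minus:
  assumes "x \<in> carrier_vec k" "a \<in> carrier_vec k" "b \<in> carrier_vec k"
  shows "x \<bullet> (a - b) = x \<bullet> a - x \<bullet> (b :: real vec)"
  using assms by (rule scalar_prod_minus_distrib)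

lemma sum_inner_square_le:
  assumes k: "0 < k" and N: "sphere_net k N"
    and up: "\<And>a. a \<in> N \<Longrightarrow> (\<Sum>i\<in>J. (x i \<bullet> a)\<^sup>2) \<le> 3 / 2 * real (card J)"
    and u: "u \<in> carrier_vec k"
  shows "(\<Sum>i\<in>J. (x i \<bullet> u)\<^sup>2) \<le> 2 * real (card J) * (u \<bullet> u)"
proof -
  let ?S = "weighted_gram k J (\<lambda>_. 1) x"
  have q: "v \<bullet> (?S *\<^sub>v v) = (\<Sum>i\<in>J. (x i \<bullet> v)\<^sup>2)" if "v \<in> carrier_vec k" for v
    using weighted_gram_quadratic_form[OF that, of J "\<lambda>_. 1" x] by simp
  have "\<bar>u \<bullet> (?S *\<^sub>v u)\<bar> \<le> 101 / 100 * (3 / 2 * real (card J)) * (u \<bullet> u)"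
  proof (rule quadratic_form_net_bound[OF weighted_gram_carrier transpose_weighted_gram k N _ u])
    fix a assume a: "a \<in> N"
    then have "a \<in> carrier_vec k" using N by (auto simp: sphere_net_def)
    then show "\<bar>a \<bullet> (?S *\<^sub>v a)\<bar> \<le> 3 / 2 * real (card J)"
      using up[OF a] by (simp add: q sum_nonneg)
  qed
  also have "\<dots> \<le> 2 * real (card J) * (u \<bullet> u)"
    by (intro mult_right_mono scalar_prod_self_nonneg) simp
  finally show ?thesis unfolding q[OF u] by (simp add: sum_nonneg)
qed

text \<open>Counts are not continuous in \<open>u\<close>, so the net argument leaves a margin:
  moving from a net point to \<open>u\<close> can add an index only if its inner product with the
  difference is at least 1/60 = 7/20 - 1/3. The second moment bound allows this for at most 72/10000
  of the sample, and 8/25 + 72/10000 < 1/3.\<close>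

lemma small_ball_count_le:
  assumes k: "0 < k" and N: "sphere_net k N" and J: "finite J"
    and x: "\<And>i. i \<in> J \<Longrightarrow> x i \<in> carrier_vec k"
    and up: "\<And>a. a \<in> N \<Longrightarrow> (\<Sum>i\<in>J. (x i \<bullet> a)\<^sup>2) \<le> 3 / 2 * real (card J)"
    and small: "\<And>a. a \<in> N \<Longrightarrow> real (card {i \<in> J. \<bar>x i \<bullet> a\<bar> < 7 / 20}) \<le> 8 / 25 * real (card J)"
    and u: "u \<in> carrier_vec k" "u \<bullet> u = 1"
  shows "real (card {i \<in> J. \<bar>x i \<bullet> u\<bar> < 1 / 3}) \<le> real (card J) / 3"
proof -
  obtain a where a: "a \<in> N" "l2_norm (u - a) \<le> 1 / 1000"
    using N u by (auto simp: sphere_net_def)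
  have ac: "a \<in> carrier_vec k" using N a(1) by (auto simp: sphere_net_def)
  have uc: "u - a \<in> carrier_vec k" using u ac by simp
  define F where "F = {i \<in> J. 1 / 60 \<le> \<bar>x i \<bullet> (u - a)\<bar>}"
  have "{i \<in> J. \<bar>x i \<bullet> u\<bar> < 1 / 3} \<subseteq> {i \<in> J. \<bar>x i \<bullet> a\<bar> < 7 / 20} \<union> F"
  proof
    fix i assume i: "i \<in> {i \<in> J. \<bar>x i \<bullet> u\<bar> < 1 / 3}"
    then have "x i \<bullet> (u - a) = x i \<bullet> u - x i \<bullet> a" using x u ac by (auto intro: scalar_prod_vec_minus)
    then have "\<bar>x i \<bullet> a\<bar> \<le> \<bar>x i \<bullet> u\<bar> + \<bar>x i \<bullet> (u - a)\<bar>" by linarith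
    moreover have "i \<in> J" "\<bar>x i \<bullet> u\<bar> < 1 / 3" using i by auto
    ultimately have "\<bar>x i \<bullet> a\<bar> < 7 / 20 \<or> 1 / 60 \<le> \<bar>x i \<bullet> (u - a)\<bar>" by linarith
    then show "i \<in> {i \<in> J. \<bar>x i \<bullet> a\<bar> < 7 / 20} \<union> F" using \<open>i \<in> J\<close> by (simp add: F_def)
  qed
  then have "card {i \<in> J. \<bar>x i \<bullet> u\<bar> < 1 / 3} \<le> card ({i \<in> J. \<bar>x i \<bullet> a\<bar> < 7 / 20} \<union> F)"
    using J by (intro card_mono) (auto simp: F_def)
  also have "\<dots> \<le> card {i \<in> J. \<bar>x i \<bullet> a\<bar> < 7 / 20} + card F" by (rule card_Un_le)
  finally have le: "real (card {i \<in> J. \<bar>x i \<bullet> u\<bar> < 1 / 3}) \<le> 8 / 25 * real (card J) + real (card F)"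
    using small[OF a(1)] by linarith
  have "real (card F) * (1 / 60)\<^sup>2 = (\<Sum>i\<in>F. (1 / 60)\<^sup>2)" by simp
  also have "\<dots> \<le> (\<Sum>i\<in>F. (x i \<bullet> (u - a))\<^sup>2)"
  proof (rule sum_mono)
    fix i assume "i \<in> F"
    then have "\<bar>1 / 60\<bar> \<le> \<bar>x i \<bullet> (u - a)\<bar>" by (simp add: F_def)
    then show "(1 / 60)\<^sup>2 \<le> (x i \<bullet> (u - a))\<^sup>2" by (simp only: abs_le_square_iff)
  qed
  also have "\<dots> \<le> (\<Sum>i\<in>J. (x i \<bullet> (u - a))\<^sup>2)"
    using J by (intro sum_mono2) (auto simp: F_def)
  also have "\<dots> \<le> 2 * real (card J) * ((u - a) \<bullet> (u - a))"
    by (rule sum_inner_square_le[OF k N up uc])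
  also have "\<dots> \<le> 2 * real (card J) * (1 / 1000)\<^sup>2"
    using a(2) by (intro mult_left_mono) (auto simp flip: l2_norm_le_iff)
  finally have "real (card F) \<le> real (card J) * 72 / 10000" by (simp add: power2_eq_square)
  then show ?thesis using le by linarith
qed

text \<open>At most a third of the sample is small for \<open>a\<close> and at most a third for
  \<open>b\<close>, so a third is small for neither. There both squares are at least a ninth of the
  squared norms, whichever attains the minimum; 27 = 3 * 9.\<close>

lemma sum_min_inner_square_ge:
  assumes J: "finite J"
    and count: "\<And>u. u \<in> carrier_vec k \<Longrightarrow> u \<bullet> u = 1 \<Longrightarrow>
      real (card {i \<in> J. \<bar>x i \<bullet> u\<bar> < 1 / 3}) \<le> real (card J) / 3"
    and a: "a \<in> carrier_vec k" and b: "b \<in> carrier_vec k"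
  shows "real (card J) / 27 * min (a \<bullet> a) (b \<bullet> b) \<le> (\<Sum>i\<in>J. min ((x i \<bullet> a)\<^sup>2) ((x i \<bullet> b)\<^sup>2))"
proof (cases "a = 0\<^sub>v k \<or> b = 0\<^sub>v k")
  case True
  then have "min (a \<bullet> a) (b \<bullet> b) \<le> 0" using scalar_prod_self_nonneg[of a] by auto
  then have "real (card J) / 27 * min (a \<bullet> a) (b \<bullet> b) \<le> 0" by (intro mult_nonneg_nonpos) auto
  also have "0 \<le> (\<Sum>i\<in>J. min ((x i \<bullet> a)\<^sup>2) ((x i \<bullet> b)\<^sup>2))" by (intro sum_nonneg) auto
  finally show ?thesis .
next
  case False
  define S where "S v = {i \<in> J. \<bar>x i \<bullet> ((1 / l2_norm v) \<cdot>\<^sub>v v)\<bar> < 1 / 3}" for v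
  have S: "real (card (S v)) \<le> real (card J) / 3" "i \<in> J \<Longrightarrow> i \<notin> S v \<Longrightarrow> v \<bullet> v / 9 \<le> (x i \<bullet> v)\<^sup>2"
    if v: "v \<in> carrier_vec k" "v \<noteq> 0\<^sub>v k" for v i
  proof -
    note u = unit_normalize[OF v]
    show "real (card (S v)) \<le> real (card J) / 3" unfolding S_def by (rule count[OF u(1,2)])
    assume i: "i \<in> J" "i \<notin> S v"
    let ?u = "(1 / l2_norm v) \<cdot>\<^sub>v v"
    have "x i \<bullet> v = l2_norm v * (x i \<bullet> ?u)" using u(4) by (simp add: scalar_prod_def sum_distrib_left)
    then have "(x i \<bullet> v)\<^sup>2 = (v \<bullet> v) * (x i \<bullet> ?u)\<^sup>2" by (simp add: power_mult_distrib l2_norm_sq)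
    moreover have "(1 / 3)\<^sup>2 \<le> (x i \<bullet> ?u)\<^sup>2"
    proof -
      have "\<bar>1 / 3\<bar> \<le> \<bar>x i \<bullet> ?u\<bar>" using i by (auto simp: S_def)
      then show ?thesis by (simp only: abs_le_square_iff)
    qed
    ultimately show "v \<bullet> v / 9 \<le> (x i \<bullet> v)\<^sup>2"
      using mult_left_mono[of "(1 / 3)\<^sup>2" "(x i \<bullet> ?u)\<^sup>2" "v \<bullet> v"] scalar_prod_self_nonneg[of v]
      by (simp add: power2_eq_square)
  qed
  note Sa = S[OF a] and Sb = S[OF b]
  define G where "G = J - (S a \<union> S b)"
  have "card (S a \<union> S b) \<le> card (S a) + card (S b)" by (rule card_Un_le)
  moreover have "card J \<le> card G + card (S a \<union> S b)"
  proof -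
    have "card J \<le> card (G \<union> (S a \<union> S b))" using J by (intro card_mono) (auto simp: G_def S_def)
    then show ?thesis using card_Un_le[of G "S a \<union> S b"] by linarith
  qed
  ultimately have G: "real (card J) / 3 \<le> real (card G)"
    using Sa(1) Sb(1) False by linarith
  have "real (card J) / 27 * min (a \<bullet> a) (b \<bullet> b) = real (card J) / 3 * (min (a \<bullet> a) (b \<bullet> b) / 9)" by simp
  also have "\<dots> \<le> real (card G) * (min (a \<bullet> a) (b \<bullet> b) / 9)"
    using G by (intro mult_right_mono) (auto simp: scalar_prod_self_nonneg)
  also have "\<dots> = (\<Sum>i\<in>G. min (a \<bullet> a) (b \<bullet> b) / 9)" by simp
  also have "\<dots> \<le> (\<Sum>i\<in>G. min ((x i \<bullet> a)\<^sup>2) ((x i \<bullet> b)\<^sup>2))"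
  proof (rule sum_mono)
    fix i assume i: "i \<in> G"
    have "a \<bullet> a / 9 \<le> (x i \<bullet> a)\<^sup>2" "b \<bullet> b / 9 \<le> (x i \<bullet> b)\<^sup>2"
      using Sa(2)[of i] Sb(2)[of i] False i by (auto simp: G_def)
    then show "min (a \<bullet> a) (b \<bullet> b) / 9 \<le> min ((x i \<bullet> a)\<^sup>2) ((x i \<bullet> b)\<^sup>2)" by linarith
  qed
  also have "\<dots> \<le> (\<Sum>i\<in>J. min ((x i \<bullet> a)\<^sup>2) ((x i \<bullet> b)\<^sup>2))"
    using J by (intro sum_mono2) (auto simp: G_def)
  finally show ?thesis .
qed

lemma loss_split:
  assumes S: "finite S" "S = J1 \<union> J2" "J1 \<inter> J2 = {}"
    and x: "\<And>i. i \<in> S \<Longrightarrow> x i \<in> carrier_vec k"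
    and y: "\<And>i. i \<in> J1 \<Longrightarrow> y i = x i \<bullet> \<beta>1" "\<And>i. i \<in> J2 \<Longrightarrow> y i = x i \<bullet> \<beta>2"
    and c: "\<beta>1 \<in> carrier_vec k" "\<beta>2 \<in> carrier_vec k" "u1 \<in> carrier_vec k" "u2 \<in> carrier_vec k"
  shows "loss S y x (u1, u2) =
    (\<Sum>i\<in>J1. min ((x i \<bullet> (u1 - \<beta>1))\<^sup>2) ((x i \<bullet> (u2 - \<beta>1))\<^sup>2)) +
    (\<Sum>i\<in>J2. min ((x i \<bullet> (u1 - \<beta>2))\<^sup>2) ((x i \<bullet> (u2 - \<beta>2))\<^sup>2))"
proof -
  have "loss S y x (u1, u2) = (\<Sum>i\<in>J1. min ((y i - x i \<bullet> u1)\<^sup>2) ((y i - x i \<bullet> u2)\<^sup>2)) +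
      (\<Sum>i\<in>J2. min ((y i - x i \<bullet> u1)\<^sup>2) ((y i - x i \<bullet> u2)\<^sup>2))"
    using S unfolding loss_def by (simp add: sum.union_disjoint)
  moreover have "(y i - x i \<bullet> u)\<^sup>2 = (x i \<bullet> (u - \<beta>))\<^sup>2"
    if "i \<in> S" "y i = x i \<bullet> \<beta>" "u \<in> carrier_vec k" "\<beta> \<in> carrier_vec k" for i u \<beta>
    using that scalar_prod_vec_minus[OF x[OF that(1)] that(3,4)] by (simp add: power2_commute)
  ultimately show ?thesis using S(2) y c by (simp cong: sum.cong)
qed

text \<open>The minimiser loses at most \<open>2 d\<close> per sample, as \<open>(g1, g2)\<close>
  does, whereas one label class alone costs at least \<open>p / 27\<close> times the smaller squared
  distance to its regressor: hence 54 = 2 * 27. Both orders appear in the conclusion because the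
  loss does not tell which component belongs to which regressor.\<close>

lemma argmin_close:
  fixes \<beta>1 \<beta>2 :: "real vec"
  assumes S: "finite S" "S = J1 \<union> J2" "J1 \<inter> J2 = {}" "S \<noteq> {}"
    and x: "\<And>i. i \<in> S \<Longrightarrow> x i \<in> carrier_vec k"
    and y: "\<And>i. i \<in> J1 \<Longrightarrow> y i = x i \<bullet> \<beta>1" "\<And>i. i \<in> J2 \<Longrightarrow> y i = x i \<bullet> \<beta>2"
    and \<beta>: "\<beta>1 \<in> carrier_vec k" "\<beta>2 \<in> carrier_vec k"
    and up: "\<And>J u. J \<in> {J1, J2} \<Longrightarrow> u \<in> carrier_vec k \<Longrightarrow>
      (\<Sum>i\<in>J. (x i \<bullet> u)\<^sup>2) \<le> 2 * real (card J) * (u \<bullet> u)"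
    and lo: "\<And>J a b. J \<in> {J1, J2} \<Longrightarrow> a \<in> carrier_vec k \<Longrightarrow> b \<in> carrier_vec k \<Longrightarrow>
      real (card J) / 27 * min (a \<bullet> a) (b \<bullet> b) \<le> (\<Sum>i\<in>J. min ((x i \<bullet> a)\<^sup>2) ((x i \<bullet> b)\<^sup>2))"
    and p: "0 < p" "p * real (card S) \<le> real (card J1)" "p * real (card S) \<le> real (card J2)"
    and G: "G \<subseteq> carrier_vec k" "g1 \<in> G" "g2 \<in> G"
    and g: "(g1 - \<beta>1) \<bullet> (g1 - \<beta>1) \<le> d" "(g2 - \<beta>2) \<bullet> (g2 - \<beta>2) \<le> d"
    and B: "0 \<le> B" "54 * d \<le> p * B\<^sup>2" "2 * B < l2_norm (\<beta>1 - \<beta>2)"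
    and min: "is_arg_min (loss S y x) (\<lambda>w. w \<in> G \<times> G) (u1, u2)"
  shows "err \<beta>1 \<beta>2 (u1, u2) \<le> B \<or> err \<beta>1 \<beta>2 (u2, u1) \<le> B"
proof -
  have u: "u1 \<in> G" "u2 \<in> G" "loss S y x (u1, u2) \<le> loss S y x (g1, g2)"
    using min G by (auto simp: is_arg_min_def not_less)
  have c: "u1 \<in> carrier_vec k" "u2 \<in> carrier_vec k" "g1 \<in> carrier_vec k" "g2 \<in> carrier_vec k"
    using u G by auto
  have split: "loss S y x (v1, v2) =
      (\<Sum>i\<in>J1. min ((x i \<bullet> (v1 - \<beta>1))\<^sup>2) ((x i \<bullet> (v2 - \<beta>1))\<^sup>2)) +
      (\<Sum>i\<in>J2. min ((x i \<bullet> (v1 - \<beta>2))\<^sup>2) ((x i \<bullet> (v2 - \<beta>2))\<^sup>2))"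
    if "v1 \<in> carrier_vec k" "v2 \<in> carrier_vec k" for v1 v2
    by (rule loss_split[OF S(1-3) _ _ _ \<beta> that]) (use x y in auto)
  have card: "real (card S) = real (card J1) + real (card J2)"
    using S by (simp add: card_Un_disjoint)
  have pos: "real (card S) > 0" using S by (simp add: card_gt_0_iff)
  have "loss S y x (g1, g2) \<le> (\<Sum>i\<in>J1. (x i \<bullet> (g1 - \<beta>1))\<^sup>2) + (\<Sum>i\<in>J2. (x i \<bullet> (g2 - \<beta>2))\<^sup>2)"
    unfolding split[OF c(3,4)] by (intro add_mono sum_mono) auto
  also have "\<dots> \<le> 2 * real (card J1) * ((g1 - \<beta>1) \<bullet> (g1 - \<beta>1)) + 2 * real (card J2) * ((g2 - \<beta>2) \<bullet> (g2 - \<beta>2))"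
    using c \<beta> by (intro add_mono up) auto
  also have "\<dots> \<le> 2 * real (card J1) * d + 2 * real (card J2) * d"
    by (intro add_mono mult_left_mono g) auto
  also have "\<dots> = 2 * d * real (card S)" by (simp add: card algebra_simps)
  finally have L: "loss S y x (u1, u2) \<le> 2 * d * real (card S)" using u(3) by linarith
  \<comment> \<open>Both class contributions are nonnegative, so each one alone is bounded by the
    total loss.\<close>
  have near: "min ((u1 - \<beta>) \<bullet> (u1 - \<beta>)) ((u2 - \<beta>) \<bullet> (u2 - \<beta>)) \<le> B\<^sup>2"
    if J: "J \<in> {J1, J2}" and b: "\<beta> \<in> carrier_vec k"
      and le: "(\<Sum>i\<in>J. min ((x i \<bullet> (u1 - \<beta>))\<^sup>2) ((x i \<bullet> (u2 - \<beta>))\<^sup>2)) \<le> loss S y x (u1, u2)"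
    for J \<beta>
  proof -
    let ?m = "min ((u1 - \<beta>) \<bullet> (u1 - \<beta>)) ((u2 - \<beta>) \<bullet> (u2 - \<beta>))"
    have m: "0 \<le> ?m" by (simp add: scalar_prod_self_nonneg)
    have "real (card J) / 27 * ?m \<le> 2 * d * real (card S)"
      using lo[OF J, of "u1 - \<beta>" "u2 - \<beta>"] c b le L by force
    moreover have "p * real (card S) / 27 * ?m \<le> real (card J) / 27 * ?m"
      using p J m by (intro mult_right_mono divide_right_mono) auto
    ultimately have "real (card S) * (p * ?m) \<le> real (card S) * (54 * d)" by (simp add: algebra_simps)
    then have "p * ?m \<le> 54 * d" using pos mult_le_cancel_left_pos by blast
    then have "p * ?m \<le> p * B\<^sup>2" using B(2) by linarith
    then show ?thesis using p(1) mult_le_cancel_left_pos by blast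
  qed
  have "min ((u1 - \<beta>1) \<bullet> (u1 - \<beta>1)) ((u2 - \<beta>1) \<bullet> (u2 - \<beta>1)) \<le> B\<^sup>2"
    by (rule near[of J1]) (auto simp: split[OF c(1,2)] \<beta> intro!: sum_nonneg)
  then have n1: "l2_norm (u1 - \<beta>1) \<le> B \<or> l2_norm (u2 - \<beta>1) \<le> B"
    unfolding l2_norm_le_iff[OF B(1)] by (auto simp: min_le_iff_disj)
  have "min ((u1 - \<beta>2) \<bullet> (u1 - \<beta>2)) ((u2 - \<beta>2) \<bullet> (u2 - \<beta>2)) \<le> B\<^sup>2"
    by (rule near[of J2]) (auto simp: split[OF c(1,2)] \<beta> intro!: sum_nonneg)
  then have n2: "l2_norm (u1 - \<beta>2) \<le> B \<or> l2_norm (u2 - \<beta>2) \<le> B"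
    unfolding l2_norm_le_iff[OF B(1)] by (auto simp: min_le_iff_disj)
  have excl: "\<not> (l2_norm (v - \<beta>1) \<le> B \<and> l2_norm (v - \<beta>2) \<le> B)" if "v \<in> carrier_vec k" for v
  proof
    assume v: "l2_norm (v - \<beta>1) \<le> B \<and> l2_norm (v - \<beta>2) \<le> B"
    have "\<beta>1 - \<beta>2 = (\<beta>1 - v) + (v - \<beta>2)" using that \<beta> by (intro eq_vecI) auto
    then have "l2_norm (\<beta>1 - \<beta>2) \<le> l2_norm (\<beta>1 - v) + l2_norm (v - \<beta>2)"
      using l2_norm_triangle[of "\<beta>1 - v" k "v - \<beta>2"] that \<beta> by simp
    then show False using v B(3) l2_norm_minus_commute[OF that \<beta>(1)] by linarith
  qed
  show ?thesis using n1 n2 excl[OF c(1)] excl[OF c(2)] by (auto simp: err_def)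
qed

text \<open>The isotropic part \<open>w \<bullet> w\<close> cancels between the upper bound
  transferred from \<open>b\<close> and the lower bound at \<open>w\<close>. The two errors \<eta>
  that remain are absorbed by the factor 2 in front of \<open>p1\<close> and
  \<open>p2\<close>.\<close>

lemma orthogonal_top_two_bound:
  assumes A: "A \<in> carrier_mat k k" "transpose_mat A = A" and top: "top_two_eigenvectors A v1 v2"
    and \<beta>: "\<beta>1 \<in> carrier_vec k" "\<beta>2 \<in> carrier_vec k" and p: "0 \<le> p1" "0 \<le> p2"
    and approx: "\<And>u. u \<in> carrier_vec k \<Longrightarrow>
      \<bar>u \<bullet> (A *\<^sub>v u) - (u \<bullet> u + 2 * p1 * (\<beta>1 \<bullet> u)\<^sup>2 + 2 * p2 * (\<beta>2 \<bullet> u)\<^sup>2)\<bar> \<le> \<eta> * (u \<bullet> u)"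
    and w: "w \<in> carrier_vec k" "v1 \<bullet> w = 0" "v2 \<bullet> w = 0"
  shows "p1 * (\<beta>1 \<bullet> w)\<^sup>2 + p2 * (\<beta>2 \<bullet> w)\<^sup>2 \<le> \<eta> * (w \<bullet> w)"
proof (cases "w = 0\<^sub>v k")
  case True
  then show ?thesis using \<beta> by simp
next
  case False
  obtain b where b: "b \<in> carrier_vec k" "b \<noteq> 0\<^sub>v k" "\<beta>1 \<bullet> b = 0" "\<beta>2 \<bullet> b = 0"
    "(w \<bullet> (A *\<^sub>v w)) * (b \<bullet> b) \<le> (b \<bullet> (A *\<^sub>v b)) * (w \<bullet> w)"
    using top_two_eigenvectors_courant_fischer[OF A top w False \<beta>] by blast
  have bb: "b \<bullet> b > 0" using scalar_prod_self_pos[OF b(1,2)] .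
  have "b \<bullet> (A *\<^sub>v b) \<le> (1 + \<eta>) * (b \<bullet> b)"
    using approx[OF b(1)] b(3,4) by (simp add: abs_le_iff algebra_simps)
  then have "(b \<bullet> (A *\<^sub>v b)) * (w \<bullet> w) \<le> (1 + \<eta>) * (b \<bullet> b) * (w \<bullet> w)"
    by (intro mult_right_mono scalar_prod_self_nonneg)
  then have "(w \<bullet> (A *\<^sub>v w)) * (b \<bullet> b) \<le> ((1 + \<eta>) * (w \<bullet> w)) * (b \<bullet> b)"
    using b(5) by (simp add: ac_simps)
  then have "w \<bullet> (A *\<^sub>v w) \<le> (1 + \<eta>) * (w \<bullet> w)" using bb mult_le_cancel_right_pos by blast
  then show ?thesis using approx[OF w(1)] by (simp add: abs_le_iff algebra_simps)
qed

text \<open>For the residual \<open>w\<close> of \<open>\<beta>\<close> after projection to the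
  plane, \<open>\<beta> \<bullet> w = w \<bullet> w\<close>, so \<open>orth\<close> bounds the
  squared residual by \<delta>^2 / 100. The projection then has length \<open>R\<close> at least 1 -
  \<delta>^2 / 100 and its angle is within \<delta> / 2 of a grid angle, whose cosine costs
  \<delta>^2 / 8; and 2 (1/100 + 1/8) = 27/100.\<close>

lemma grid_point_close:
  assumes v: "v1 \<in> carrier_vec k" "v2 \<in> carrier_vec k" "v1 \<bullet> v1 = 1" "v2 \<bullet> v2 = 1" "v1 \<bullet> v2 = 0"
    and \<beta>: "\<beta> \<in> carrier_vec k" "\<beta> \<bullet> \<beta> = 1" and \<delta>: "0 < \<delta>" "\<delta> \<le> 1" and p: "0 < p"
    and orth: "\<And>w. w \<in> carrier_vec k \<Longrightarrow> v1 \<bullet> w = 0 \<Longrightarrow> v2 \<bullet> w = 0 \<Longrightarrow>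
      p * (\<beta> \<bullet> w)\<^sup>2 \<le> p * (\<delta>\<^sup>2 / 100) * (w \<bullet> w)"
  shows "\<exists>g\<in>grid \<delta> v1 v2. (g - \<beta>) \<bullet> (g - \<beta>) \<le> 27 / 100 * \<delta>\<^sup>2"
proof -
  define c1 c2 where "c1 = v1 \<bullet> \<beta>" and "c2 = v2 \<bullet> \<beta>"
  have v21: "v2 \<bullet> v1 = 0" using comm_scalar_prod[OF v(1,2)] v(5) by simp
  define w where "w = \<beta> - (c1 \<cdot>\<^sub>v v1 + c2 \<cdot>\<^sub>v v2)"
  have q: "c1 \<cdot>\<^sub>v v1 + c2 \<cdot>\<^sub>v v2 \<in> carrier_vec k" using v by simp
  have wc: "w \<in> carrier_vec k" using \<beta> q by (simp add: w_def)
  have w0: "v1 \<bullet> w = 0" "v2 \<bullet> w = 0"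
    unfolding w_def using v v21 \<beta> q
    by (simp_all add: scalar_prod_minus_distrib[of _ k] scalar_prod_add_distrib[of _ k] c1_def c2_def)
  have bw: "\<beta> \<bullet> w = 1 - (c1\<^sup>2 + c2\<^sup>2)"
    unfolding w_def using v \<beta> q comm_scalar_prod[OF \<beta>(1) v(1)] comm_scalar_prod[OF \<beta>(1) v(2)]
    by (simp add: scalar_prod_minus_distrib[of _ k] scalar_prod_add_distrib[of _ k] c1_def c2_def power2_eq_square)
  have ww: "w \<bullet> w = \<beta> \<bullet> w"
  proof -
    have "w \<bullet> w = \<beta> \<bullet> w - (c1 \<cdot>\<^sub>v v1 + c2 \<cdot>\<^sub>v v2) \<bullet> w"
      using wc \<beta> q by (subst (1) w_def) (simp add: minus_scalar_prod_distrib[of _ k])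
    also have "(c1 \<cdot>\<^sub>v v1 + c2 \<cdot>\<^sub>v v2) \<bullet> w = 0"
      using w0 v wc by (simp add: add_scalar_prod_distrib[of _ k])
    finally show ?thesis by simp
  qed
  have resid: "\<beta> \<bullet> w \<le> \<delta>\<^sup>2 / 100"
  proof (cases "\<beta> \<bullet> w = 0")
    case False
    then have pos: "\<beta> \<bullet> w > 0" using scalar_prod_self_nonneg[of w] ww by linarith
    have "(p * (\<beta> \<bullet> w)) * (\<beta> \<bullet> w) \<le> (p * (\<beta> \<bullet> w)) * (\<delta>\<^sup>2 / 100)"
      using orth[OF wc w0] unfolding ww by (simp add: power2_eq_square ac_simps)
    then show ?thesis using pos p mult_le_cancel_left_pos[of "p * (\<beta> \<bullet> w)"] by simp
  qed simp
  define R where "R = sqrt (c1\<^sup>2 + c2\<^sup>2)"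
  have R2: "R\<^sup>2 = c1\<^sup>2 + c2\<^sup>2" by (simp add: R_def)
  have \<delta>2: "\<delta>\<^sup>2 \<le> 1" using \<delta> by (simp add: power_le_one)
  have Rpos: "R > 0"
  proof -
    have "c1\<^sup>2 + c2\<^sup>2 > 0" using resid bw \<delta>2 by linarith
    then show ?thesis by (simp add: R_def)
  qed
  have R1: "R \<le> 1"
  proof -
    have "R\<^sup>2 \<le> 1\<^sup>2" using R2 bw ww scalar_prod_self_nonneg[of w] by simp
    then show ?thesis by (rule power2_le_imp_le) simp
  qed
  have Rlow: "1 - R \<le> \<delta>\<^sup>2 / 100"
  proof -
    have "1 - R \<le> (1 - R) * (1 + R)" using R1 Rpos by (simp add: algebra_simps)
    also have "\<dots> = 1 - R\<^sup>2" by (simp add: power2_eq_square algebra_simps)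
    finally show ?thesis using R2 bw resid by linarith
  qed
  have "(c1 / R)\<^sup>2 + (c2 / R)\<^sup>2 = 1"
    using Rpos by (simp add: power_divide flip: add_divide_distrib R2)
  then obtain \<phi> where \<phi>: "0 \<le> \<phi>" "\<phi> < 2 * pi" "c1 / R = cos \<phi>" "c2 / R = sin \<phi>"
    by (rule sincos_total_2pi)
  then have c: "c1 = R * cos \<phi>" "c2 = R * sin \<phi>" using Rpos by (auto simp: field_simps)
  \<comment> \<open>Rounding to the nearest index may go up past \<open>2 * pi / \<delta>\<close>,
    but not past its ceiling, which the grid includes.\<close>
  define t where "t = nat (round (\<phi> / \<delta>))"
  have nn: "0 \<le> \<phi> / \<delta>" using \<phi>(1) \<delta>(1) by simp
  have r0: "0 \<le> round (\<phi> / \<delta>)" using round_mono[OF nn] by simp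
  have "real t = of_int (round (\<phi> / \<delta>))" using r0 by (simp add: t_def)
  then have "\<bar>real t - \<phi> / \<delta>\<bar> \<le> 1 / 2" using of_int_round_abs_le[of "\<phi> / \<delta>"] by simp
  then have "\<bar>\<delta> * (real t - \<phi> / \<delta>)\<bar> \<le> \<delta> * (1 / 2)"
    using \<delta>(1) unfolding abs_mult by (intro mult_mono) auto
  then have close: "\<bar>\<delta> * real t - \<phi>\<bar> \<le> \<bar>\<delta> / 2\<bar>" using \<delta>(1) by (simp add: right_diff_distrib)
  have "\<phi> / \<delta> \<le> 2 * pi / \<delta>" using \<phi>(2) \<delta>(1) by (intro divide_right_mono) auto
  then have "round (\<phi> / \<delta>) \<le> \<lceil>2 * pi / \<delta>\<rceil>"
    using round_mono[of "\<phi> / \<delta>" "2 * pi / \<delta>"] ceiling_ge_round[of "2 * pi / \<delta>"] by linarith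
  then have t: "t \<le> nat \<lceil>2 * pi / \<delta>\<rceil>" unfolding t_def by (rule nat_mono)
  define \<psi> where "\<psi> = \<delta> * real t"
  define g where "g = cos \<psi> \<cdot>\<^sub>v v1 + sin \<psi> \<cdot>\<^sub>v v2"
  have gc: "g \<in> carrier_vec k" using v by (simp add: g_def)
  have "g \<in> grid \<delta> v1 v2" using t by (auto simp: grid_def g_def \<psi>_def)
  moreover have "(g - \<beta>) \<bullet> (g - \<beta>) \<le> 27 / 100 * \<delta>\<^sup>2"
  proof -
    have gg: "g \<bullet> g = 1"
      using v v21 by (simp add: g_def add_scalar_prod_distrib[of _ k] scalar_prod_add_distrib[of _ k]
          flip: power2_eq_square)
    have gb: "g \<bullet> \<beta> = R * cos (\<psi> - \<phi>)"
      using v \<beta> by (simp add: g_def add_scalar_prod_distrib[of _ k] flip: c1_def c2_def)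
        (simp add: c cos_diff algebra_simps)
    have "(\<psi> - \<phi>)\<^sup>2 \<le> (\<delta> / 2)\<^sup>2" using close unfolding \<psi>_def by (simp only: abs_le_square_iff)
    moreover have "1 - (\<psi> - \<phi>)\<^sup>2 / 2 \<le> cos (\<psi> - \<phi>)"
    proof -
      define h where "h = (\<psi> - \<phi>) / 2"
      have "(sin h)\<^sup>2 \<le> h\<^sup>2"
        using abs_sin_x_le_abs_x[of h] by (simp only: abs_le_square_iff)
      moreover have "cos (2 * h) = 1 - 2 * (sin h)\<^sup>2" by (rule cos_double_sin)
      moreover have "\<psi> - \<phi> = 2 * h" by (simp add: h_def)
      ultimately show ?thesis by (simp add: power_mult_distrib)
    qed
    ultimately have "1 - \<delta>\<^sup>2 / 8 \<le> cos (\<psi> - \<phi>)" by (simp add: power_divide)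
    then have "R * (1 - \<delta>\<^sup>2 / 8) \<le> g \<bullet> \<beta>" unfolding gb using Rpos by (intro mult_left_mono) auto
    moreover have "R * (\<delta>\<^sup>2 / 8) \<le> 1 * (\<delta>\<^sup>2 / 8)" using R1 by (intro mult_right_mono) auto
    ultimately have "1 - \<delta>\<^sup>2 / 100 - \<delta>\<^sup>2 / 8 \<le> g \<bullet> \<beta>" using Rlow by (simp add: right_diff_distrib)
    then show ?thesis unfolding scalar_prod_minus_self[OF gc \<beta>(1)] gg \<beta>(2) by simp
  qed
  ultimately show ?thesis by blast
qed

section \<open>Uniform concentration over the net\<close>

text \<open>For \<open>n \<le> k\<^sup>3\<close> the factor \<open>(ln k)\<^sup>2\<close> absorbs \<open>ln n\<close>; beyond that, powers of \<open>n\<close> do.\<close>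

lemma sample_size_rates:
  fixes D k n \<eta> :: real
  assumes D: "1 \<le> D" and k: "2 \<le> k" and \<eta>: "0 < \<eta>" "\<eta> \<le> 1"
    and n: "(3 + 5 * D + 21 * D\<^sup>2) * k * (ln k)\<^sup>2 / \<eta>\<^sup>2 \<le> n"
  shows "D * k \<le> n * \<eta>\<^sup>2" "D * k * ln n \<le> n * \<eta>" "k \<le> n"
proof -
  \<comment> \<open>The summands serve \<open>k \<le> n\<close>, the case n \<le> k^3 (where
    \<open>3 * D \<le> C * (2 / 3)\<close> is needed) and the case n > k^3 (where
    \<open>9 * D\<^sup>2 \<le> C * (4 / 9)\<close> is needed).\<close>
  define C where "C = 3 + 5 * D + 21 * D\<^sup>2"
  have C: "C \<ge> 3" "C \<ge> 5 * D" "C \<ge> 21 * D\<^sup>2" using D by (auto simp: C_def)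
  have lnk: "2 / 3 \<le> ln k" using ln2_ge_two_thirds ln_mono[of 2 k] k by linarith
  have "(2 / 3)\<^sup>2 \<le> (ln k)\<^sup>2" using lnk by (intro power_mono) auto
  then have lnk2: "4 / 9 \<le> (ln k)\<^sup>2" by (simp add: power2_eq_square)
  have \<eta>2: "\<eta>\<^sup>2 \<le> \<eta>" "\<eta>\<^sup>2 > 0" using \<eta> by (auto simp: power2_eq_square mult_left_le)
  have n2: "C * k * (ln k)\<^sup>2 \<le> n * \<eta>\<^sup>2" using n \<eta>2(2) by (simp add: C_def pos_divide_le_eq)
  have Ck: "0 \<le> C * k" using C k by simp
  have base: "C * k * (4 / 9) \<le> n * \<eta>\<^sup>2" using mult_left_mono[OF lnk2 Ck] n2 by linarith
  have Dk: "D * k \<le> C * k * (4 / 9)" "k \<le> C * k * (4 / 9)" using C D k by (auto simp: field_simps)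
  show "D * k \<le> n * \<eta>\<^sup>2" using base Dk by linarith
  have npos: "0 < n"
  proof -
    have "0 < n * \<eta>\<^sup>2" using base Dk k by linarith
    then show ?thesis using \<eta>2(2) by (simp add: zero_less_mult_iff)
  qed
  have "n * \<eta>\<^sup>2 \<le> n * 1" using npos \<eta>2 \<eta> by (intro mult_left_mono) auto
  then show kn: "k \<le> n" using base Dk by linarith
  show "D * k * ln n \<le> n * \<eta>"
  proof (cases "n \<le> k ^ 3")
    case True
    have "ln n \<le> ln (k ^ 3)" using True npos k by (intro ln_mono) auto
    also have "\<dots> = 3 * ln k" using k by (simp add: ln_realpow)
    finally have "D * k * ln n \<le> D * k * (3 * ln k)" using D k by (intro mult_left_mono) auto
    also have "\<dots> = (3 * D) * (k * ln k)" by simp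
    also have "\<dots> \<le> (C * (2 / 3)) * (k * ln k)"
      using C D k lnk by (intro mult_right_mono) auto
    also have "\<dots> = (C * k * ln k) * (2 / 3)" by simp
    also have "\<dots> \<le> (C * k * ln k) * ln k"
      using C k lnk by (intro mult_left_mono) auto
    also have "\<dots> \<le> n * \<eta>\<^sup>2" using n2 by (simp add: power2_eq_square mult.assoc)
    also have "\<dots> \<le> n * \<eta>" using npos \<eta>2 by (intro mult_left_mono) auto
    finally show ?thesis .
  next
    case False
    \<comment> \<open>With both \<open>k \<le> r\<close> and \<open>ln n \<le> 3 * r\<close>, the
      product \<open>k * (ln n)\<^sup>2\<close> is at most 9 n. This proves the squared
      claim.\<close>
    define r where "r = root 3 n"
    have r: "r ^ 3 = n" "r > 0" using npos by (auto simp: r_def real_root_pow_pos)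
    have "k ^ 3 \<le> r ^ 3" using False r by simp
    then have kr: "k \<le> r" using r(2) power_mono_iff[of k r 3] k by simp
    have "ln n = 3 * ln r" using r by (metis ln_realpow of_nat_numeral)
    then have lnn: "ln n \<le> 3 * r" using ln_le_minus_one[OF r(2)] by linarith
    have "1 \<le> n" using kn k by linarith
    then have lnn0: "0 \<le> ln n" by simp
    have "(D * k * ln n)\<^sup>2 = D\<^sup>2 * k * (k * (ln n)\<^sup>2)" by (simp add: power2_eq_square)
    also have "\<dots> \<le> D\<^sup>2 * k * (r * (3 * r)\<^sup>2)"
      using lnn lnn0 kr k by (intro mult_left_mono mult_mono power_mono) auto
    also have "r * (3 * r)\<^sup>2 = 9 * n" using r(1) by (simp add: power2_eq_square power3_eq_cube flip: r(1))
    also have "D\<^sup>2 * k * (9 * n) = (9 * D\<^sup>2 * k) * n" by simp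
    also have "\<dots> \<le> (C * k * (4 / 9)) * n"
      using C k npos by (intro mult_right_mono) (auto simp: mult.assoc)
    also have "\<dots> \<le> (n * \<eta>\<^sup>2) * n" using base npos by (intro mult_right_mono) auto
    also have "\<dots> = (n * \<eta>)\<^sup>2" by (simp add: power2_eq_square)
    finally show ?thesis using npos \<eta> by (intro power2_le_imp_le[of "D * k * ln n" "n * \<eta>"]) auto
  qed
qed

definition covariance_good :: "real vec set \<Rightarrow> nat set \<Rightarrow> (nat \<Rightarrow> real vec) \<Rightarrow> bool" where
  "covariance_good N J x \<longleftrightarrow> (\<forall>a\<in>N. (\<Sum>i\<in>J. (x i \<bullet> a)\<^sup>2) \<le> 3 / 2 * real (card J) \<and>
     real (card {i \<in> J. \<bar>x i \<bullet> a\<bar> < 7 / 20}) \<le> 8 / 25 * real (card J))"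

text \<open>Half of the accuracy is reserved for the passage from the net to all vectors.\<close>

definition moment_good ::
  "real vec set \<Rightarrow> nat set \<Rightarrow> (nat \<Rightarrow> real vec) \<Rightarrow> real \<Rightarrow> (nat \<Rightarrow> real vec) \<Rightarrow> bool" where
  "moment_good N J b \<eta> x \<longleftrightarrow> (\<forall>a\<in>N.
     \<bar>(\<Sum>i\<in>J. (x i \<bullet> b i)\<^sup>2 * (x i \<bullet> a)\<^sup>2) - (\<Sum>i\<in>J. 1 + 2 * (b i \<bullet> a)\<^sup>2)\<bar> \<le> \<eta> / 2 * real (card J))"

text \<open>Stated for an arbitrary \<sigma>-algebra that makes the coordinates measurable:
  independence from the labels requires the good events to lie in the one generated by the
  covariates.\<close>

lemma good_measurable:
  fixes X :: "nat \<Rightarrow> 'a \<Rightarrow> real vec"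
  assumes X: "\<And>i j. i \<in> J \<Longrightarrow> j < k \<Longrightarrow> (\<lambda>\<omega>. X i \<omega> $ j) \<in> borel_measurable L"
    and J: "finite J" and N: "finite N" "N \<subseteq> carrier_vec k" and b: "\<And>i. i \<in> J \<Longrightarrow> b i \<in> carrier_vec k"
  shows "{\<omega> \<in> space L. covariance_good N J (\<lambda>i. X i \<omega>)} \<in> sets L"
    and "{\<omega> \<in> space L. moment_good N J b \<eta> (\<lambda>i. X i \<omega>)} \<in> sets L"
proof -
  have inner: "(\<lambda>\<omega>. X i \<omega> \<bullet> a) \<in> borel_measurable L" if "i \<in> J" "a \<in> carrier_vec k" for i a
  proof -
    have "(\<lambda>\<omega>. X i \<omega> \<bullet> a) = (\<lambda>\<omega>. \<Sum>j<k. X i \<omega> $ j * a $ j)"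
      using that(2) by (simp add: scalar_prod_def lessThan_atLeast0)
    then show ?thesis using X[OF that(1)] by (simp add: borel_measurable_sum borel_measurable_times)
  qed
  have 1: "{\<omega> \<in> space L. (\<Sum>i\<in>J. (X i \<omega> \<bullet> a)\<^sup>2) \<le> c} \<in> sets L" if "a \<in> N" for a c
  proof -
    have "(\<lambda>\<omega>. \<Sum>i\<in>J. (X i \<omega> \<bullet> a)\<^sup>2) \<in> borel_measurable L"
      using inner that N(2) by (intro borel_measurable_sum borel_measurable_power) auto
    then show ?thesis by measurable
  qed
  have 2: "{\<omega> \<in> space L. real (card {i \<in> J. \<bar>X i \<omega> \<bullet> a\<bar> < 7 / 20}) \<le> c} \<in> sets L" if "a \<in> N" for a c
  proof -
    have "real (card {i \<in> J. \<bar>X i \<omega> \<bullet> a\<bar> < 7 / 20})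
        = (\<Sum>i\<in>J. indicator {-7/20<..<7/20} (X i \<omega> \<bullet> a))" for \<omega>
    proof -
      have "(\<Sum>i\<in>J. indicator {-7/20<..<7/20} (X i \<omega> \<bullet> a) :: real)
          = (\<Sum>i\<in>J. if \<bar>X i \<omega> \<bullet> a\<bar> < 7 / 20 then 1 else 0)"
        by (intro sum.cong refl) (simp add: indicator_def abs_less_iff, linarith)
      then show ?thesis using J by (simp add: Int_def flip: sum.inter_filter)
    qed
    moreover have "(\<lambda>\<omega>. indicator {-7/20<..<7/20} (X i \<omega> \<bullet> a) :: real) \<in> borel_measurable L" if "i \<in> J" for i
    proof -
      have "(indicator {-7/20<..<7/20} :: real \<Rightarrow> real) \<in> borel_measurable borel" by simp
      then show ?thesis using inner[OF that, of a] \<open>a \<in> N\<close> N(2) measurable_compose by blast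
    qed
    then have "(\<lambda>\<omega>. \<Sum>i\<in>J. indicator {-7/20<..<7/20} (X i \<omega> \<bullet> a) :: real) \<in> borel_measurable L"
      by (rule borel_measurable_sum)
    ultimately show ?thesis by simp
  qed
  have 3: "{\<omega> \<in> space L. \<bar>(\<Sum>i\<in>J. (X i \<omega> \<bullet> b i)\<^sup>2 * (X i \<omega> \<bullet> a)\<^sup>2) - m\<bar> \<le> c} \<in> sets L" if "a \<in> N" for a m c
  proof -
    have "(\<lambda>\<omega>. \<Sum>i\<in>J. (X i \<omega> \<bullet> b i)\<^sup>2 * (X i \<omega> \<bullet> a)\<^sup>2) \<in> borel_measurable L"
      using inner that N(2) b
      by (intro borel_measurable_sum borel_measurable_times borel_measurable_power) auto
    then show ?thesis by measurable
  qed
  show "{\<omega> \<in> space L. covariance_good N J (\<lambda>i. X i \<omega>)} \<in> sets L"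
    unfolding covariance_good_def
    by (intro sets.sets_Collect_finite_All sets.sets_Collect_conj 1 2 N(1))
      (auto simp: N)
  show "{\<omega> \<in> space L. moment_good N J b \<eta> (\<lambda>i. X i \<omega>)} \<in> sets L"
    unfolding moment_good_def
    by (intro sets.sets_Collect_finite_All 3 N(1)) (auto simp: N)
qed

text \<open>Of the rate \<open>(ln D + 1) * k\<close>, the part \<open>ln D * k\<close> pays for the
  size of the net and the rest is the failure probability.\<close>

lemma net_union_bound:
  assumes "1 \<le> D" "real (card N) \<le> D ^ k" "(ln D + 1) * real k \<le> r"
  shows "real (card N) * exp (- r) \<le> exp (- real k)"
proof -
  have "real (card N) * exp (- r) \<le> D ^ k * exp (- ((ln D + 1) * real k))"
    using assms by (intro mult_mono) auto
  also have "D ^ k = exp (real k * ln D)" using assms(1) by (simp add: exp_of_nat_mult)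
  also have "\<dots> * exp (- ((ln D + 1) * real k)) = exp (- real k)"
    by (simp add: exp_add[symmetric] algebra_simps)
  finally show ?thesis .
qed

context gaussian_design
begin

section \<open>Failure probabilities for a fixed labelling\<close>

lemma prob_net_union:
  assumes N: "finite N" and P: "\<And>a. a \<in> N \<Longrightarrow> {\<omega> \<in> space M. P a \<omega>} \<in> events"
    and le: "\<And>a. a \<in> N \<Longrightarrow> prob {\<omega> \<in> space M. P a \<omega>} \<le> exp (- r)"
    and D: "1 \<le> D" "real (card N) \<le> D ^ l" "(ln D + 1) * real l \<le> r"
  shows "prob {\<omega> \<in> space M. \<exists>a\<in>N. P a \<omega>} \<le> exp (- real l)"
proof -
  have "{\<omega> \<in> space M. \<exists>a\<in>N. P a \<omega>} = (\<Union>a\<in>N. {\<omega> \<in> space M. P a \<omega>})" by auto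
  then have "prob {\<omega> \<in> space M. \<exists>a\<in>N. P a \<omega>} \<le> (\<Sum>a\<in>N. prob {\<omega> \<in> space M. P a \<omega>})"
    using finite_measure_subadditive_finite[OF N, of "\<lambda>a. {\<omega> \<in> space M. P a \<omega>}"] P by auto
  also have "\<dots> \<le> (\<Sum>a\<in>N. exp (- r))" by (intro sum_mono le)
  also have "\<dots> = real (card N) * exp (- r)" by simp
  also have "\<dots> \<le> exp (- real l)" by (rule net_union_bound[OF D])
  finally show ?thesis .
qed

text \<open>The factor 2500 is the reciprocal of the slower of the two Chernoff rates, 1/40 and
  1/2500.\<close>

lemma prob_covariance_bad:
  assumes N: "sphere_net k N" and D: "1 \<le> D" "real (card N) \<le> D ^ k"
    and J: "J \<subseteq> I" "2500 * (ln D + 1) * real k \<le> real (card J)"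
  shows "prob {\<omega> \<in> space M. \<not> covariance_good N J (\<lambda>i. X i \<omega>)} \<le> 2 * exp (- real k)"
proof -
  have fin: "finite J" using J finite_I finite_subset by blast
  have Nf: "finite N" and Nc: "\<And>a. a \<in> N \<Longrightarrow> a \<in> carrier_vec k" "\<And>a. a \<in> N \<Longrightarrow> a \<bullet> a = 1"
    using N by (auto simp: sphere_net_def)
  define A where "A = {\<omega> \<in> space M. \<exists>a\<in>N. 3 / 2 * real (card J) \<le> (\<Sum>i\<in>J. (X i \<omega> \<bullet> a)\<^sup>2)}"
  define B where "B = {\<omega> \<in> space M. \<exists>a\<in>N. 8 / 25 * real (card J) \<le> real (card {i \<in> J. \<bar>X i \<omega> \<bullet> a\<bar> < 7 / 20})}"
  have m: "(\<lambda>\<omega>. X i \<omega> \<bullet> a) \<in> borel_measurable M" if "i \<in> J" "a \<in> N" for i a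
    using inner_measurable[of i a] that J Nc by blast
  have mA: "{\<omega> \<in> space M. 3 / 2 * real (card J) \<le> (\<Sum>i\<in>J. (X i \<omega> \<bullet> a)\<^sup>2)} \<in> events" if "a \<in> N" for a
  proof -
    have "(\<lambda>\<omega>. \<Sum>i\<in>J. (X i \<omega> \<bullet> a)\<^sup>2) \<in> borel_measurable M"
      using m that by (intro borel_measurable_sum borel_measurable_power) auto
    then show ?thesis by measurable
  qed
  have mB: "{\<omega> \<in> space M. 8 / 25 * real (card J) \<le> real (card {i \<in> J. \<bar>X i \<omega> \<bullet> a\<bar> < 7 / 20})} \<in> events"
    if "a \<in> N" for a
  proof -
    have "(\<lambda>\<omega>. real (card {i \<in> J. \<bar>X i \<omega> \<bullet> a\<bar> < 7 / 20})) \<in> borel_measurable M"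
    proof -
      have "real (card {i \<in> J. \<bar>X i \<omega> \<bullet> a\<bar> < 7 / 20}) = (\<Sum>i\<in>J. if \<bar>X i \<omega> \<bullet> a\<bar> < 7 / 20 then 1 else 0)" for \<omega>
        using fin by (simp add: Int_def flip: sum.inter_filter)
      moreover have "(\<lambda>\<omega>. if \<bar>X i \<omega> \<bullet> a\<bar> < 7 / 20 then 1 else 0 :: real) \<in> borel_measurable M" if "i \<in> J" for i
        using m[OF that \<open>a \<in> N\<close>] by measurable
      ultimately show ?thesis by (simp add: borel_measurable_sum)
    qed
    then show ?thesis by measurable
  qed
  have "0 \<le> (ln D + 1) * real k" "2500 * ((ln D + 1) * real k) \<le> real (card J)"
    using D(1) J(2) by (simp_all only: mult.assoc) simp
  then have r: "(ln D + 1) * real k \<le> real (card J) / 40" "(ln D + 1) * real k \<le> real (card J) / 2500"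
    by linarith+
  have "prob A \<le> exp (- real k)"
    unfolding A_def
    by (rule prob_net_union[OF Nf mA inner_square_upper_tail[OF J(1) Nc] D r(1)])
  moreover have "prob B \<le> exp (- real k)"
    unfolding B_def
    by (rule prob_net_union[OF Nf mB small_ball_count_tail[OF J(1) Nc] D r(2)])
  moreover have AB: "A \<in> events" "B \<in> events"
    unfolding A_def B_def using sets.sets_Collect_finite_Ex[OF mA Nf] sets.sets_Collect_finite_Ex[OF mB Nf]
    by simp_all
  moreover have "prob {\<omega> \<in> space M. \<not> covariance_good N J (\<lambda>i. X i \<omega>)} \<le> prob (A \<union> B)"
  proof (rule finite_measure_mono)
    show "{\<omega> \<in> space M. \<not> covariance_good N J (\<lambda>i. X i \<omega>)} \<subseteq> A \<union> B"
    proof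
      fix \<omega> assume \<omega>: "\<omega> \<in> {\<omega> \<in> space M. \<not> covariance_good N J (\<lambda>i. X i \<omega>)}"
      then obtain a where a: "a \<in> N" "\<not> ((\<Sum>i\<in>J. (X i \<omega> \<bullet> a)\<^sup>2) \<le> 3 / 2 * real (card J) \<and>
          real (card {i \<in> J. \<bar>X i \<omega> \<bullet> a\<bar> < 7 / 20}) \<le> 8 / 25 * real (card J))"
        unfolding covariance_good_def by blast
      then have "3 / 2 * real (card J) \<le> (\<Sum>i\<in>J. (X i \<omega> \<bullet> a)\<^sup>2) \<or>
          8 / 25 * real (card J) \<le> real (card {i \<in> J. \<bar>X i \<omega> \<bullet> a\<bar> < 7 / 20})"
        by linarith
      then show "\<omega> \<in> A \<union> B" using \<omega> a(1) unfolding A_def B_def by blast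
    qed
  qed (use AB in blast)
  moreover have "prob (A \<union> B) \<le> prob A + prob B" using AB by (rule measure_Un_le)
  ultimately show ?thesis by linarith
qed

text \<open>Unless some squared response exceeds \<open>T\<close>, truncated and full sums agree and
  the upper tail transfers. The exponent in \<open>rate\<close> is governed by either of two
  constraints on the Chernoff parameter, truncation or accuracy; hence the two requirements
  \<open>n2\<close> and \<open>n1\<close> on the sample size.\<close>

lemma prob_moment_bad:
  fixes b :: "nat \<Rightarrow> real vec"
  assumes N: "sphere_net k N" and D: "1 \<le> D" "real (card N) \<le> D ^ k"
    and J: "J \<subseteq> I" and b: "\<And>i. i \<in> J \<Longrightarrow> b i \<in> carrier_vec k" "\<And>i. i \<in> J \<Longrightarrow> b i \<bullet> b i = 1"
    and k: "2 \<le> k" and \<eta>: "0 < \<eta>" "\<eta> \<le> 1"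
    and n1: "24000000 * (ln D + 1) * real k \<le> real (card J) * \<eta>\<^sup>2"
    and n2: "24000000 * (ln D + 1) * real k * ln (real (card J)) \<le> real (card J) * \<eta>"
    and n3: "real k \<le> real (card J)"
  shows "prob {\<omega> \<in> space M. \<not> moment_good N J b \<eta> (\<lambda>i. X i \<omega>)} \<le> 2 * exp (- real k) + 2 / real k ^ 3"
proof -
  define n where "n = real (card J)"
  have n: "2 \<le> n" using n3 k by (simp add: n_def)
  \<comment> \<open>A single squared response exceeds \<open>T\<close> with probability at most 2 /
    n^4, so a union over the n samples still leaves 2 / n^3.\<close>
  define T where "T = 16 * ln n"
  have lnn: "ln n > 0" using n by simp
  \<comment> \<open>The first bound is the truncation constraint; the second makes the quadratic
    term at most half of the linear one. In the two cases \<open>n * (s * (\<eta> / 4))\<close>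
    equals \<open>n * \<eta> / (1024 * ln n)\<close> and
    \<open>n * \<eta>\<^sup>2 / 24000000\<close>.\<close>
  define s where "s = min (1 / (16 * T)) (\<eta> / 6000000)"
  have s: "0 < s" "s * T \<le> 1 / 16"
  proof -
    show "0 < s" using lnn \<eta> by (simp add: s_def T_def)
    have "s * T \<le> 1 / (16 * T) * T" using lnn by (intro mult_right_mono) (auto simp: s_def T_def)
    then show "s * T \<le> 1 / 16" using lnn by (simp add: T_def)
  qed
  define l where "l = (ln D + 1) * real k"
  have l: "0 \<le> l" "24000000 * l \<le> n * \<eta>\<^sup>2" "24000000 * (l * ln n) \<le> n * \<eta>"
    using D(1) n1 n2 by (simp_all only: l_def n_def mult.assoc) simp
  have rate: "(ln D + 1) * real k \<le> n * (s * (\<eta> / 2) - s\<^sup>2 * 1500000)"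
  proof -
    have "s * (s * 1500000) \<le> s * (\<eta> / 4)" using s(1) by (intro mult_left_mono) (auto simp: s_def)
    then have "s * (\<eta> / 4) \<le> s * (\<eta> / 2) - s\<^sup>2 * 1500000"
      by (simp add: power2_eq_square algebra_simps)
    then have "n * (s * (\<eta> / 4)) \<le> n * (s * (\<eta> / 2) - s\<^sup>2 * 1500000)" using n by (intro mult_left_mono) auto
    moreover have "l \<le> n * (s * (\<eta> / 4))"
    proof (cases "1 / (16 * T) \<le> \<eta> / 6000000")
      case True
      then have eq: "n * (s * (\<eta> / 4)) = n * \<eta> / (1024 * ln n)" by (simp add: s_def T_def)
      have "0 \<le> l * ln n" using l(1) lnn by simp
      then have "l * (1024 * ln n) \<le> n * \<eta>" using l(3) by linarith
      then show ?thesis unfolding eq using lnn by (simp add: pos_le_divide_eq)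
    next
      case False
      then have "n * (s * (\<eta> / 4)) = n * \<eta>\<^sup>2 / 24000000" by (simp add: s_def power2_eq_square)
      then show ?thesis using l(2) by linarith
    qed
    ultimately show ?thesis unfolding l_def by linarith
  qed
  have fin: "finite J" using J finite_I finite_subset by blast
  have Nf: "finite N" and Nc: "\<And>a. a \<in> N \<Longrightarrow> a \<in> carrier_vec k" "\<And>a. a \<in> N \<Longrightarrow> a \<bullet> a = 1"
    using N by (auto simp: sphere_net_def)
  define m where "m a = (\<Sum>i\<in>J. 1 + 2 * (b i \<bullet> a)\<^sup>2)" for a
  define W where "W a \<omega> = (\<Sum>i\<in>J. (X i \<omega> \<bullet> b i)\<^sup>2 * (X i \<omega> \<bullet> a)\<^sup>2)" for a \<omega>
  define V where "V a \<omega> = (\<Sum>i\<in>J. min ((X i \<omega> \<bullet> b i)\<^sup>2) T * (X i \<omega> \<bullet> a)\<^sup>2)" for a \<omega>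
  have mX: "(\<lambda>\<omega>. X i \<omega> \<bullet> a) \<in> borel_measurable M" "(\<lambda>\<omega>. X i \<omega> \<bullet> b i) \<in> borel_measurable M"
    if "i \<in> J" "a \<in> N" for i a
    using inner_measurable[of i] that J Nc b by blast+
  have mW: "W a \<in> borel_measurable M" if "a \<in> N" for a
    unfolding W_def[abs_def] using mX that
    by (intro borel_measurable_sum borel_measurable_times borel_measurable_power) auto
  have mV: "V a \<in> borel_measurable M" if "a \<in> N" for a
    unfolding V_def[abs_def] using mX that
    by (intro borel_measurable_sum borel_measurable_times borel_measurable_power borel_measurable_min) auto
  define A where "A = {\<omega> \<in> space M. \<exists>a\<in>N. m a + \<eta> / 2 * n \<le> V a \<omega>}"
  define B where "B = {\<omega> \<in> space M. \<exists>a\<in>N. W a \<omega> \<le> m a - \<eta> / 2 * n}"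
  define C where "C = {\<omega> \<in> space M. \<exists>i\<in>J. T < (X i \<omega> \<bullet> b i)\<^sup>2}"
  have eA: "{\<omega> \<in> space M. m a + \<eta> / 2 * n \<le> V a \<omega>} \<in> events" if "a \<in> N" for a
    using mV[OF that] by measurable
  have eB: "{\<omega> \<in> space M. W a \<omega> \<le> m a - \<eta> / 2 * n} \<in> events" if "a \<in> N" for a
    using mW[OF that] by measurable
  have eC: "{\<omega> \<in> space M. T < (X i \<omega> \<bullet> b i)\<^sup>2} \<in> events" if "i \<in> J" for i
  proof -
    have "(\<lambda>\<omega>. X i \<omega> \<bullet> b i) \<in> borel_measurable M"
      using inner_measurable[of i "b i"] that J b by blast
    then show ?thesis by measurable
  qed
  have ev: "A \<in> events" "B \<in> events" "C \<in> events"
    unfolding A_def B_def C_def using sets.sets_Collect_finite_Ex[OF eA Nf]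
      sets.sets_Collect_finite_Ex[OF eB Nf] sets.sets_Collect_finite_Ex[OF eC fin] by simp_all
  have pA: "prob A \<le> exp (- real k)"
    unfolding A_def
  proof (rule prob_net_union[OF Nf eA _ D rate])
    fix a assume "a \<in> N"
    then show "prob {\<omega> \<in> space M. m a + \<eta> / 2 * n \<le> V a \<omega>} \<le> exp (- (n * (s * (\<eta> / 2) - s\<^sup>2 * 1500000)))"
      unfolding m_def V_def n_def
      by (intro response_square_tails(1)[where b = b, OF J _ _ Nc s] b)
  qed
  have pB: "prob B \<le> exp (- real k)"
    unfolding B_def
  proof (rule prob_net_union[OF Nf eB _ D rate])
    fix a assume "a \<in> N"
    then show "prob {\<omega> \<in> space M. W a \<omega> \<le> m a - \<eta> / 2 * n} \<le> exp (- (n * (s * (\<eta> / 2) - s\<^sup>2 * 1500000)))"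
      unfolding m_def W_def n_def
      by (intro response_square_tails(2)[where b = b, OF J _ _ Nc s] b)
  qed
  have pC: "prob C \<le> 2 / real k ^ 3"
  proof -
    have "C = (\<Union>i\<in>J. {\<omega> \<in> space M. T < (X i \<omega> \<bullet> b i)\<^sup>2})" by (auto simp: C_def)
    then have "prob C \<le> (\<Sum>i\<in>J. prob {\<omega> \<in> space M. T < (X i \<omega> \<bullet> b i)\<^sup>2})"
      using finite_measure_subadditive_finite[OF fin, of "\<lambda>i. {\<omega> \<in> space M. T < (X i \<omega> \<bullet> b i)\<^sup>2}"] eC by auto
    also have "\<dots> \<le> (\<Sum>i\<in>J. 2 * exp (- (T / 4)))"
      using J b by (intro sum_mono inner_square_large) auto
    also have "\<dots> = 2 * (n * exp (- (T / 4)))" by (simp add: n_def)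
    also have "exp (- (T / 4)) = 1 / n ^ 4"
    proof -
      have "exp (T / 4) = exp (real 4 * ln n)" by (simp add: T_def)
      also have "\<dots> = n ^ 4" using n by (subst exp_of_nat_mult) simp
      finally show ?thesis by (simp add: exp_minus inverse_eq_divide)
    qed
    also have "n * (1 / n ^ 4) = 1 / n ^ 3" using n by (simp add: power3_eq_cube power4_eq_xxxx)
    also have "\<dots> \<le> 1 / real k ^ 3"
      using n3 k by (intro divide_left_mono power_mono mult_pos_pos) (auto simp: n_def)
    finally show ?thesis by simp
  qed
  have "prob {\<omega> \<in> space M. \<not> moment_good N J b \<eta> (\<lambda>i. X i \<omega>)} \<le> prob ((A \<union> B) \<union> C)"
  proof (rule finite_measure_mono)
    show "{\<omega> \<in> space M. \<not> moment_good N J b \<eta> (\<lambda>i. X i \<omega>)} \<subseteq> (A \<union> B) \<union> C"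
    proof
      fix \<omega> assume \<omega>: "\<omega> \<in> {\<omega> \<in> space M. \<not> moment_good N J b \<eta> (\<lambda>i. X i \<omega>)}"
      then obtain a where a: "a \<in> N" "\<eta> / 2 * n < \<bar>W a \<omega> - m a\<bar>"
        by (auto simp: moment_good_def W_def m_def n_def not_le)
      show "\<omega> \<in> (A \<union> B) \<union> C"
      proof (cases "\<omega> \<in> C")
        case False
        then have "V a \<omega> = W a \<omega>" using \<omega> unfolding V_def W_def C_def
          by (intro sum.cong) (auto simp: not_less min_def)
        then have "m a + \<eta> / 2 * n \<le> V a \<omega> \<or> W a \<omega> \<le> m a - \<eta> / 2 * n" using a(2) by linarith
        then show ?thesis using \<omega> a(1) by (auto simp: A_def B_def)
      qed simp
    qed
  qed (use ev in auto)
  also have "\<dots> \<le> prob (A \<union> B) + prob C" using ev by (intro measure_Un_le) auto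
  also have "prob (A \<union> B) \<le> prob A + prob B" using ev by (intro measure_Un_le) auto
  finally show ?thesis using pA pB pC by linarith
qed

end

section \<open>The procedure on a good sample\<close>

lemma unit_inner_abs_less_1:
  fixes u v :: "real vec"
  assumes u: "u \<in> carrier_vec k" "u \<bullet> u = 1" and v: "v \<in> carrier_vec k" "v \<bullet> v = 1"
    and ne: "u \<noteq> v" "u \<noteq> - v"
  shows "\<bar>u \<bullet> v\<bar> < 1"
proof -
  have "u - v \<noteq> 0\<^sub>v k"
  proof
    assume *: "u - v = 0\<^sub>v k"
    have "u $ i = v $ i" if "i < k" for i
      using arg_cong[OF *, of "\<lambda>w. w $ i"] that u v by simp
    then have "u = v" using u v by (intro eq_vecI) auto
    then show False using ne by simp
  qed
  then have "0 < (u - v) \<bullet> (u - v)" using u v by (intro scalar_prod_self_pos[of _ k]) auto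
  moreover have "u + v \<noteq> 0\<^sub>v k"
  proof
    assume *: "u + v = 0\<^sub>v k"
    have "u $ i = (- v) $ i" if "i < k" for i
      using arg_cong[OF *, of "\<lambda>w. w $ i"] that u v by simp
    then have "u = - v" using u v by (intro eq_vecI) auto
    then show False using ne by simp
  qed
  then have "0 < (u + v) \<bullet> (u + v)" using u v by (intro scalar_prod_self_pos[of _ k]) auto
  ultimately show ?thesis
    by (simp add: scalar_prod_add_self[OF u(1) v(1)] scalar_prod_minus_self[OF u(1) v(1)] u(2) v(2) abs_less_iff)
qed

text \<open>By AM-GM, 4 p1 p2 \<le> 1, so the argument of the square root is nonnegative; it is
  below 1 because the regressors are not parallel. Positivity gives meaning to the reciprocal, and
  the upper bound makes it at least 384 / \<delta>^2.\<close>

lemma delta_tilde_bounds: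
  assumes "\<bar>\<beta>1 \<bullet> \<beta>2\<bar> < 1" "0 < p1" "0 < p2" "p1 + p2 = 1" "0 < \<delta>"
  shows "0 < delta_tilde \<delta> \<beta>1 \<beta>2 p1 p2" "delta_tilde \<delta> \<beta>1 \<beta>2 p1 p2 \<le> \<delta>\<^sup>2 / 384"
proof -
  define c where "c = 1 - (\<beta>1 \<bullet> \<beta>2)\<^sup>2"
  have "(\<beta>1 \<bullet> \<beta>2)\<^sup>2 < 1" using assms(1) by (simp add: abs_square_less_1)
  then have c: "0 < c" "c \<le> 1" by (auto simp: c_def)
  have "4 * (p1 * p2) \<le> (p1 + p2)\<^sup>2"
    using sum_squares_bound[of p1 p2] by (simp add: power2_sum)
  then have pp: "4 * (p1 * p2) \<le> 1" "0 < p1 * p2" using assms by auto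
  have "c * (4 * (p1 * p2)) \<le> 1 * 1" using c pp by (intro mult_mono) auto
  moreover have "0 < c * (4 * (p1 * p2))" using c pp by simp
  ultimately have s: "0 \<le> 1 - 4 * c * p1 * p2" "1 - 4 * c * p1 * p2 < 1" by (auto simp: ac_simps)
  then have "0 \<le> sqrt (1 - 4 * c * p1 * p2)" "sqrt (1 - 4 * c * p1 * p2) < 1" by auto
  then show "0 < delta_tilde \<delta> \<beta>1 \<beta>2 p1 p2" "delta_tilde \<delta> \<beta>1 \<beta>2 p1 p2 \<le> \<delta>\<^sup>2 / 384"
    using assms(5) by (auto simp: delta_tilde_def c_def[symmetric] mult_left_le)
qed

lemma moment_good_cong:
  assumes "\<And>i. i \<in> J \<Longrightarrow> b i = b' i"
  shows "moment_good N J b \<eta> x = moment_good N J b' \<eta> x"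
proof -
  have "(\<Sum>i\<in>J. (x i \<bullet> b i)\<^sup>2 * (x i \<bullet> a)\<^sup>2) = (\<Sum>i\<in>J. (x i \<bullet> b' i)\<^sup>2 * (x i \<bullet> a)\<^sup>2)"
    "(\<Sum>i\<in>J. 1 + 2 * (b i \<bullet> a)\<^sup>2) = (\<Sum>i\<in>J. 1 + 2 * (b' i \<bullet> a)\<^sup>2)" for a
    using assms by (auto intro!: sum.cong)
  then show ?thesis by (simp add: moment_good_def)
qed

text \<open>The bound on the net is applied to the difference of the moment matrix and its
  expectation, identity plus rank two. Since the label fractions are exact, averaging the per-sample
  expectations gives the weights \<open>p1\<close> and \<open>p2\<close> without an error
  term.\<close>

lemma moment_matrix_approx:
  assumes k: "0 < k" and N: "sphere_net k N" and S: "finite S" "S \<noteq> {}"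
    and \<beta>: "\<beta>1 \<in> carrier_vec k" "\<beta>2 \<in> carrier_vec k"
    and b: "\<And>i. i \<in> S \<Longrightarrow> b i = (if i \<in> J1 then \<beta>1 else \<beta>2)" "J1 \<subseteq> S"
    and y: "\<And>i. i \<in> S \<Longrightarrow> y i = x i \<bullet> b i"
    and p: "real (card J1) = p1 * real (card S)" "real (card (S - J1)) = p2 * real (card S)"
    and good: "moment_good N S b \<eta> x" and \<eta>: "0 \<le> \<eta>"
    and u: "u \<in> carrier_vec k"
  shows "\<bar>u \<bullet> (moment_matrix k S y x *\<^sub>v u) - (u \<bullet> u + 2 * p1 * (\<beta>1 \<bullet> u)\<^sup>2 + 2 * p2 * (\<beta>2 \<bullet> u)\<^sup>2)\<bar>
    \<le> \<eta> * (u \<bullet> u)"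
proof -
  define n where "n = real (card S)"
  have n: "n > 0" using S by (simp add: n_def card_gt_0_iff)
  let ?A = "weighted_gram k S (\<lambda>i. (y i)\<^sup>2 / n) x"
  let ?B = "weighted_gram k {0, 1 :: nat} (\<lambda>i. if i = 0 then 2 * p1 else 2 * p2) (\<lambda>i. if i = 0 then \<beta>1 else \<beta>2)"
  let ?D = "?A - (1\<^sub>m k + ?B)"
  have A: "moment_matrix k S y x = ?A"
    by (intro eq_matI) (auto simp: moment_matrix_def weighted_gram_def n_def sum_distrib_left)
  have D: "?D \<in> carrier_mat k k" by (intro minus_carrier_mat add_carrier_mat weighted_gram_carrier)
  have sym: "transpose_mat ?D = ?D"
    by (intro eq_matI) (auto simp: weighted_gram_def mult.commute)
  have q: "v \<bullet> (?D *\<^sub>v v) = (\<Sum>i\<in>S. (x i \<bullet> b i)\<^sup>2 * (x i \<bullet> v)\<^sup>2) / n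
      - (v \<bullet> v + 2 * p1 * (\<beta>1 \<bullet> v)\<^sup>2 + 2 * p2 * (\<beta>2 \<bullet> v)\<^sup>2)" if v: "v \<in> carrier_vec k" for v
  proof -
    have "?D *\<^sub>v v = ?A *\<^sub>v v - (v + ?B *\<^sub>v v)"
      using v by (simp add: minus_mult_distrib_mat_vec[of _ k k] add_mult_distrib_mat_vec[of _ k k])
    moreover have "?A *\<^sub>v v \<in> carrier_vec k" "?B *\<^sub>v v \<in> carrier_vec k"
      using v by (auto intro!: mult_mat_vec_carrier[of _ k k])
    ultimately have "v \<bullet> (?D *\<^sub>v v) = v \<bullet> (?A *\<^sub>v v) - (v \<bullet> v + v \<bullet> (?B *\<^sub>v v))"
      using v by (simp add: scalar_prod_minus_distrib[of _ k] scalar_prod_add_distrib[of _ k])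
    moreover have "v \<bullet> (?A *\<^sub>v v) = (\<Sum>i\<in>S. (x i \<bullet> b i)\<^sup>2 * (x i \<bullet> v)\<^sup>2) / n"
      unfolding weighted_gram_quadratic_form[OF v] sum_divide_distrib using y by (intro sum.cong) auto
    ultimately show ?thesis unfolding weighted_gram_quadratic_form[OF v] by simp
  qed
  have "\<bar>u \<bullet> (?D *\<^sub>v u)\<bar> \<le> 101 / 100 * (\<eta> / 2) * (u \<bullet> u)"
  proof (rule quadratic_form_net_bound[OF D sym k N _ u])
    fix a assume a: "a \<in> N"
    then have ac: "a \<in> carrier_vec k" "a \<bullet> a = 1" using N by (auto simp: sphere_net_def)
    have "(\<Sum>i\<in>S. 1 + 2 * (b i \<bullet> a)\<^sup>2) = n + 2 * (\<Sum>i\<in>S. (b i \<bullet> a)\<^sup>2)"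
      by (simp add: sum.distrib sum_distrib_left n_def)
    also have "(\<Sum>i\<in>S. (b i \<bullet> a)\<^sup>2) = (\<Sum>i\<in>J1. (b i \<bullet> a)\<^sup>2) + (\<Sum>i\<in>S - J1. (b i \<bullet> a)\<^sup>2)"
      using S(1) b(2) by (simp add: sum.subset_diff)
    also have "(\<Sum>i\<in>J1. (b i \<bullet> a)\<^sup>2) = (\<Sum>i\<in>J1. (\<beta>1 \<bullet> a)\<^sup>2)"
      using b by (intro sum.cong) auto
    also have "(\<Sum>i\<in>S - J1. (b i \<bullet> a)\<^sup>2) = (\<Sum>i\<in>S - J1. (\<beta>2 \<bullet> a)\<^sup>2)"
      using b by (intro sum.cong) auto
    finally have m: "(\<Sum>i\<in>S. 1 + 2 * (b i \<bullet> a)\<^sup>2) = n * (1 + 2 * p1 * (\<beta>1 \<bullet> a)\<^sup>2 + 2 * p2 * (\<beta>2 \<bullet> a)\<^sup>2)"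
      using p by (simp add: n_def algebra_simps)
    let ?W = "\<Sum>i\<in>S. (x i \<bullet> b i)\<^sup>2 * (x i \<bullet> a)\<^sup>2"
    have "\<bar>?W - n * (1 + 2 * p1 * (\<beta>1 \<bullet> a)\<^sup>2 + 2 * p2 * (\<beta>2 \<bullet> a)\<^sup>2)\<bar> \<le> \<eta> / 2 * n"
      using good a unfolding m[symmetric] by (simp add: moment_good_def n_def)
    moreover have "a \<bullet> (?D *\<^sub>v a) = (?W - n * (1 + 2 * p1 * (\<beta>1 \<bullet> a)\<^sup>2 + 2 * p2 * (\<beta>2 \<bullet> a)\<^sup>2)) / n"
      unfolding q[OF ac(1)] ac(2) using n by (simp add: diff_divide_distrib)
    ultimately show "\<bar>a \<bullet> (?D *\<^sub>v a)\<bar> \<le> \<eta> / 2"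
      using n by (simp add: abs_divide pos_divide_le_eq)
  qed
  also have "\<dots> \<le> \<eta> * (u \<bullet> u)" using \<eta> by (intro mult_right_mono scalar_prod_self_nonneg) auto
  finally have "\<bar>u \<bullet> (?D *\<^sub>v u)\<bar> \<le> \<eta> * (u \<bullet> u)" .
  moreover have "u \<bullet> (moment_matrix k S y x *\<^sub>v u) = (\<Sum>i\<in>S. (x i \<bullet> b i)\<^sup>2 * (x i \<bullet> u)\<^sup>2) / n"
    unfolding A weighted_gram_quadratic_form[OF u] sum_divide_distrib using y by (intro sum.cong) auto
  ultimately show ?thesis unfolding q[OF u] by simp
qed

section \<open>The grid and the set of outputs\<close>

lemma loss_swap: "loss S y x (u1, u2) = loss S y x (u2, u1)"
  by (simp add: loss_def min.commute)

lemma finite_grid: "finite (grid \<delta> v1 v2)"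
proof -
  have "grid \<delta> v1 v2 = (\<lambda>t. cos (\<delta> * real t) \<cdot>\<^sub>v v1 + sin (\<delta> * real t) \<cdot>\<^sub>v v2) ` {..nat \<lceil>2 * pi / \<delta>\<rceil>}"
    by (auto simp: grid_def)
  then show ?thesis by simp
qed

lemma grid_carrier: "v1 \<in> carrier_vec k \<Longrightarrow> v2 \<in> carrier_vec k \<Longrightarrow> grid \<delta> v1 v2 \<subseteq> carrier_vec k"
  by (auto simp: grid_def)

lemma init_output_nonempty:
  assumes "2 \<le> k"
  shows "init_output k \<delta> S1 S2 y x \<noteq> {}"
proof -
  have "moment_matrix k S1 y x \<in> carrier_mat k k" by (simp add: moment_matrix_def)
  moreover have "transpose_mat (moment_matrix k S1 y x) = moment_matrix k S1 y x"
    by (intro eq_matI) (auto simp: moment_matrix_def mult.commute)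
  ultimately obtain v1 v2 where v: "top_two_eigenvectors (moment_matrix k S1 y x) v1 v2"
    using exists_top_two_eigenvectors assms by blast
  let ?G = "grid \<delta> v1 v2"
  have "finite (?G \<times> ?G)" by (simp add: finite_grid)
  moreover have "?G \<times> ?G \<noteq> {}" by (auto simp: grid_def)
  ultimately obtain w where "is_arg_min (loss S2 y x) (\<lambda>w. w \<in> ?G \<times> ?G) w"
    using ex_is_arg_min_if_finite by blast
  then show ?thesis using v by (cases w) (auto simp: init_output_def)
qed

text \<open>By symmetry of the loss and of the search set, an output with its components in the
  wrong order certifies that the correctly ordered pair is an output too.\<close>

lemma init_output_swap:
  assumes "(u1, u2) \<in> init_output k \<delta> S1 S2 y x"
  shows "(u2, u1) \<in> init_output k \<delta> S1 S2 y x"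
proof -
  obtain v1 v2 where v: "top_two_eigenvectors (moment_matrix k S1 y x) v1 v2"
    "is_arg_min (loss S2 y x) (\<lambda>w. w \<in> grid \<delta> v1 v2 \<times> grid \<delta> v1 v2) (u1, u2)"
    using assms by (auto simp: init_output_def)
  then have "is_arg_min (loss S2 y x) (\<lambda>w. w \<in> grid \<delta> v1 v2 \<times> grid \<delta> v1 v2) (u2, u1)"
    by (simp add: is_arg_min_def loss_swap[of S2 y x u2 u1])
  then show ?thesis using v(1) by (auto simp: init_output_def)
qed

sublocale noiseless_mlr \<subseteq> gaussian_design M k "Sstar \<union> Splus" X
  by unfold_locales (use samples X_normal X_indep in auto)

context noiseless_mlr
begin

section \<open>The model on a good realisation\<close>

lemma beta_unit: "\<beta>1 \<bullet> \<beta>1 = 1" "\<beta>2 \<bullet> \<beta>2 = 1"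
  using beta_norm by (auto simp: l2_norm_one_iff)

lemma beta_inner: "\<bar>\<beta>1 \<bullet> \<beta>2\<bar> < 1"
  by (rule unit_inner_abs_less_1[OF beta_dim(1) beta_unit(1) beta_dim(2) beta_unit(2) beta_neq])

text \<open>In dimension one, unit vectors agree up to sign. Dimension two is needed for two leading
  eigenvectors and keeps \<open>ln k\<close> away from 0.\<close>

lemma dim_ge_2: "2 \<le> k"
proof (rule ccontr)
  assume "\<not> 2 \<le> k"
  then consider "k = 0" | "k = 1" by linarith
  then show False
  proof cases
    case 1
    then show False using beta_unit(1) beta_dim(1) by (simp add: scalar_prod_def)
  next
    case 2
    then have "(\<beta>1 $ 0)\<^sup>2 = 1" "(\<beta>2 $ 0)\<^sup>2 = 1" and ip: "\<beta>1 \<bullet> \<beta>2 = \<beta>1 $ 0 * \<beta>2 $ 0"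
      using beta_unit beta_dim by (auto simp: scalar_prod_def power2_eq_square)
    then have "(\<beta>1 \<bullet> \<beta>2)\<^sup>2 = 1" by (simp add: ip power_mult_distrib)
    then show False using beta_inner abs_square_less_1[of "\<beta>1 \<bullet> \<beta>2"] by simp
  qed
qed

lemma grid_resolution_bounds:
  assumes chat: "0 < chat" "chat < 1 / 2" and \<delta>: "0 < \<delta>"
    and \<delta>_le: "\<delta> \<le> 2 / 11 * chat * l2_norm (\<beta>1 - \<beta>2) * sqrt (min p1 p2) ^ 3"
  shows "0 < l2_norm (\<beta>1 - \<beta>2)"
    "\<delta>\<^sup>2 \<le> 4 / 121 * chat\<^sup>2 * (l2_norm (\<beta>1 - \<beta>2))\<^sup>2 * min p1 p2 ^ 3" "\<delta> \<le> 1"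
proof -
  define p where "p = min p1 p2"
  define L where "L = l2_norm (\<beta>1 - \<beta>2)"
  have p: "0 < p" "p \<le> 1" using fractions by (auto simp: p_def min_def)
  have L0: "0 < L" "L \<le> 2"
  proof -
    have "L\<^sup>2 = 2 - 2 * (\<beta>1 \<bullet> \<beta>2)"
      by (simp add: L_def l2_norm_sq scalar_prod_minus_self[OF beta_dim] beta_unit)
    then have "0 < L\<^sup>2" "L\<^sup>2 \<le> 2\<^sup>2" using beta_inner by (auto simp: abs_less_iff)
    moreover have "0 \<le> L" by (simp add: L_def)
    ultimately show "0 < L" "L \<le> 2" using power2_le_imp_le[of L 2] by (auto simp: less_le)
  qed
  have \<delta>2: "\<delta>\<^sup>2 \<le> 4 / 121 * chat\<^sup>2 * L\<^sup>2 * p ^ 3"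
  proof -
    have "\<delta>\<^sup>2 \<le> (2 / 11 * chat * L * sqrt p ^ 3)\<^sup>2"
      using \<delta>_le \<delta> by (intro power_mono) (auto simp: L_def p_def)
    also have "\<dots> = (2 / 11)\<^sup>2 * chat\<^sup>2 * L\<^sup>2 * (sqrt p ^ 2) ^ 3"
      by (simp only: power_mult_distrib power_mult[symmetric]) simp
    also have "sqrt p ^ 2 = p" using p by simp
    finally show ?thesis by (simp add: power2_eq_square)
  qed
  have \<delta>1: "\<delta> \<le> 1"
  proof -
    have "chat\<^sup>2 \<le> 1\<^sup>2" using chat by (intro power_mono) auto
    moreover have "L\<^sup>2 \<le> 2\<^sup>2" using L0 by (intro power_mono) auto
    moreover have "p ^ 3 \<le> 1" using p by (intro power_le_one) auto
    ultimately have "chat\<^sup>2 * L\<^sup>2 * p ^ 3 \<le> 1\<^sup>2 * 2\<^sup>2 * 1" using p by (intro mult_mono) auto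
    then have "\<delta>\<^sup>2 \<le> 1\<^sup>2" using \<delta>2 by simp
    then show ?thesis by (rule power2_le_imp_le) simp
  qed
  show "0 < l2_norm (\<beta>1 - \<beta>2)" "\<delta> \<le> 1"
    "\<delta>\<^sup>2 \<le> 4 / 121 * chat\<^sup>2 * (l2_norm (\<beta>1 - \<beta>2))\<^sup>2 * min p1 p2 ^ 3"
    using L0 \<delta>1 \<delta>2 by (auto simp: L_def p_def)
qed

lemma init_output_accurate:
  fixes chat \<delta> :: real
  assumes \<omega>: "\<omega> \<in> space M" and chat: "0 < chat" "chat < 1 / 2" and \<delta>: "0 < \<delta>"
    and \<delta>_le: "\<delta> \<le> 2 / 11 * chat * l2_norm (\<beta>1 - \<beta>2) * sqrt (min p1 p2) ^ 3"
    and N: "sphere_net k N" and S: "Sstar \<noteq> {}" "Splus \<noteq> {}"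
    and moment: "moment_good N Sstar (\<lambda>i. if Z i \<omega> = 1 then \<beta>1 else \<beta>2) (min p1 p2 * \<delta>\<^sup>2 / 100) (\<lambda>i. X i \<omega>)"
    and cov: "covariance_good N {i \<in> Splus. Z i \<omega> = 1} (\<lambda>i. X i \<omega>)"
      "covariance_good N {i \<in> Splus. Z i \<omega> = 0} (\<lambda>i. X i \<omega>)"
    and out: "(u1, u2) \<in> init_output k \<delta> Sstar Splus (\<lambda>i. response \<beta>1 \<beta>2 (Z i \<omega>) (X i \<omega>)) (\<lambda>i. X i \<omega>)"
  shows "err \<beta>1 \<beta>2 (u1, u2) \<le> chat * min p1 p2 * l2_norm (\<beta>1 - \<beta>2) \<or>
    err \<beta>1 \<beta>2 (u2, u1) \<le> chat * min p1 p2 * l2_norm (\<beta>1 - \<beta>2)"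
proof -
  define x where "x = (\<lambda>i. X i \<omega>)"
  define y where "y = (\<lambda>i. response \<beta>1 \<beta>2 (Z i \<omega>) (X i \<omega>))"
  define p where "p = min p1 p2"
  define L where "L = l2_norm (\<beta>1 - \<beta>2)"
  have p: "0 < p" "p \<le> p1" "p \<le> p2" "p \<le> 1 / 2" using fractions by (auto simp: p_def min_def)
  have k: "0 < k" using dim_ge_2 by simp
  have xc: "x i \<in> carrier_vec k" if "i \<in> Sstar \<union> Splus" for i using X_dim[OF that \<omega>] by (simp add: x_def)
  have Z01: "Z i \<omega> = 0 \<or> Z i \<omega> = 1" if "i \<in> Sstar \<union> Splus" for i using Z_label[OF that \<omega>] by auto
  have y: "y i = x i \<bullet> (if Z i \<omega> = 1 then \<beta>1 else \<beta>2)" if "i \<in> Sstar \<union> Splus" for i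
    using Z01[OF that] by (auto simp: y_def x_def response_def)
  have L0: "0 < L" and \<delta>2: "\<delta>\<^sup>2 \<le> 4 / 121 * chat\<^sup>2 * L\<^sup>2 * p ^ 3" and \<delta>1: "\<delta> \<le> 1"
    using grid_resolution_bounds[OF chat \<delta> \<delta>_le] by (auto simp: L_def p_def)
  define \<eta> where "\<eta> = p * \<delta>\<^sup>2 / 100"
  have \<eta>: "0 \<le> \<eta>" using p by (simp add: \<eta>_def)
  let ?A = "moment_matrix k Sstar y x"
  obtain v1 v2 where top: "top_two_eigenvectors ?A v1 v2"
    and amin: "is_arg_min (loss Splus y x) (\<lambda>w. w \<in> grid \<delta> v1 v2 \<times> grid \<delta> v1 v2) (u1, u2)"
    using out by (auto simp: init_output_def x_def y_def)
  have A: "?A \<in> carrier_mat k k" "transpose_mat ?A = ?A"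
  proof -
    show "?A \<in> carrier_mat k k" by (simp add: moment_matrix_def)
    show "transpose_mat ?A = ?A" by (intro eq_matI) (auto simp: moment_matrix_def mult.commute)
  qed
  have v: "v1 \<in> carrier_vec k" "v2 \<in> carrier_vec k" "v1 \<bullet> v1 = 1" "v2 \<bullet> v2 = 1" "v1 \<bullet> v2 = 0"
    using top A(1) by (auto simp: top_two_eigenvectors_def eigenvector_def)
  have fracS: "real (card {i \<in> S. Z i \<omega> = 1}) = p1 * real (card S)"
    "real (card {i \<in> S. Z i \<omega> = 0}) = p2 * real (card S)" if "S \<in> {Sstar, Splus}" for S
    using Z_fraction[OF that \<omega>] by auto
  have approx: "\<bar>u \<bullet> (?A *\<^sub>v u) - (u \<bullet> u + 2 * p1 * (\<beta>1 \<bullet> u)\<^sup>2 + 2 * p2 * (\<beta>2 \<bullet> u)\<^sup>2)\<bar> \<le> \<eta> * (u \<bullet> u)"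
    if "u \<in> carrier_vec k" for u
  proof (rule moment_matrix_approx[OF k N samples(1) S(1) beta_dim _ _ _ _ _ _ \<eta> that])
    show "moment_good N Sstar (\<lambda>i. if Z i \<omega> = 1 then \<beta>1 else \<beta>2) \<eta> x"
      using moment by (simp add: \<eta>_def p_def x_def)
    have "Sstar - {i \<in> Sstar. Z i \<omega> = 1} = {i \<in> Sstar. Z i \<omega> = 0}" using Z01 by auto
    then show "real (card (Sstar - {i \<in> Sstar. Z i \<omega> = 1})) = p2 * real (card Sstar)"
      using fracS(2)[of Sstar] by simp
    show "real (card {i \<in> Sstar. Z i \<omega> = 1}) = p1 * real (card Sstar)" using fracS(1)[of Sstar] by simp
  qed (use y in auto)
  have orth: "p1 * (\<beta>1 \<bullet> w)\<^sup>2 + p2 * (\<beta>2 \<bullet> w)\<^sup>2 \<le> \<eta> * (w \<bullet> w)"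
    if "w \<in> carrier_vec k" "v1 \<bullet> w = 0" "v2 \<bullet> w = 0" for w
    using orthogonal_top_two_bound[OF A top beta_dim _ _ approx that] fractions by simp
  have \<eta>w: "\<eta> * (w \<bullet> w) \<le> q * (\<delta>\<^sup>2 / 100) * (w \<bullet> w)" if "p \<le> q" for q w
    using that by (intro mult_right_mono scalar_prod_self_nonneg) (auto simp: \<eta>_def mult_right_mono)
  obtain g1 where g1: "g1 \<in> grid \<delta> v1 v2" "(g1 - \<beta>1) \<bullet> (g1 - \<beta>1) \<le> 27 / 100 * \<delta>\<^sup>2"
  proof -
    have "p1 * (\<beta>1 \<bullet> w)\<^sup>2 \<le> p1 * (\<delta>\<^sup>2 / 100) * (w \<bullet> w)"
      if "w \<in> carrier_vec k" "v1 \<bullet> w = 0" "v2 \<bullet> w = 0" for w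
    proof -
      have "0 \<le> p2 * (\<beta>2 \<bullet> w)\<^sup>2" using fractions by simp
      then show ?thesis using orth[OF that] \<eta>w[OF p(2), of w] by linarith
    qed
    from grid_point_close[OF v beta_dim(1) beta_unit(1) \<delta> \<delta>1 fractions(1) this] show ?thesis using that by blast
  qed
  obtain g2 where g2: "g2 \<in> grid \<delta> v1 v2" "(g2 - \<beta>2) \<bullet> (g2 - \<beta>2) \<le> 27 / 100 * \<delta>\<^sup>2"
  proof -
    have "p2 * (\<beta>2 \<bullet> w)\<^sup>2 \<le> p2 * (\<delta>\<^sup>2 / 100) * (w \<bullet> w)"
      if "w \<in> carrier_vec k" "v1 \<bullet> w = 0" "v2 \<bullet> w = 0" for w
    proof -
      have "0 \<le> p1 * (\<beta>1 \<bullet> w)\<^sup>2" using fractions by simp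
      then show ?thesis using orth[OF that] \<eta>w[OF p(3), of w] by linarith
    qed
    from grid_point_close[OF v beta_dim(2) beta_unit(2) \<delta> \<delta>1 fractions(2) this] show ?thesis using that by blast
  qed
  define J1 J2 where "J1 = {i \<in> Splus. Z i \<omega> = 1}" and "J2 = {i \<in> Splus. Z i \<omega> = 0}"
  have J: "Splus = J1 \<union> J2" "J1 \<inter> J2 = {}" using Z01 by (auto simp: J1_def J2_def)
  have fin: "finite J1" "finite J2" using samples by (auto simp: J1_def J2_def)
  have good: "covariance_good N J1 x" "covariance_good N J2 x"
    using cov by (auto simp: J1_def J2_def x_def)
  have up: "(\<Sum>i\<in>J. (x i \<bullet> u)\<^sup>2) \<le> 2 * real (card J) * (u \<bullet> u)"
    if "J \<in> {J1, J2}" "u \<in> carrier_vec k" for J u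
    using that good by (intro sum_inner_square_le[OF k N]) (auto simp: covariance_good_def)
  have lo: "real (card J) / 27 * min (a \<bullet> a) (b \<bullet> b) \<le> (\<Sum>i\<in>J. min ((x i \<bullet> a)\<^sup>2) ((x i \<bullet> b)\<^sup>2))"
    if "J \<in> {J1, J2}" "a \<in> carrier_vec k" "b \<in> carrier_vec k" for J a b
  proof (rule sum_min_inner_square_ge[OF _ _ that(2,3)])
    show "finite J" using that fin by auto
    then show "real (card {i \<in> J. \<bar>x i \<bullet> u\<bar> < 1 / 3}) \<le> real (card J) / 3"
      if "u \<in> carrier_vec k" "u \<bullet> u = 1" for u
      using \<open>J \<in> {J1, J2}\<close> good xc J(1) that
      by (intro small_ball_count_le[OF k N]) (auto simp: covariance_good_def)
  qed
  have cardJ: "p * real (card Splus) \<le> real (card J1)" "p * real (card Splus) \<le> real (card J2)"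
    using fracS[of Splus] p by (auto simp: J1_def J2_def intro!: mult_right_mono)
  \<comment> \<open>The target accuracy. The factor \<open>p * B\<^sup>2\<close> equals
    \<open>chat\<^sup>2 * L\<^sup>2 * p ^ 3\<close>, the shape of the bound on the squared
    resolution, and \<open>2 * B < L\<close> follows from \<open>chat < 1 / 2\<close> and
    \<open>p \<le> 1 / 2\<close>.\<close>
  define B where "B = chat * p * L"
  have B: "0 \<le> B" "54 * (27 / 100 * \<delta>\<^sup>2) \<le> p * B\<^sup>2" "2 * B < l2_norm (\<beta>1 - \<beta>2)"
  proof -
    show "0 \<le> B" using chat p L0 by (simp add: B_def)
    have eq: "p * B\<^sup>2 = chat\<^sup>2 * L\<^sup>2 * p ^ 3"
      by (simp add: B_def power_mult_distrib power2_eq_square power3_eq_cube)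
    have "0 \<le> chat\<^sup>2 * L\<^sup>2 * p ^ 3" using p by simp
    then show "54 * (27 / 100 * \<delta>\<^sup>2) \<le> p * B\<^sup>2" unfolding eq using \<delta>2 by linarith
    have "chat * p \<le> (1 / 2) * (1 / 2)" using chat p by (intro mult_mono) auto
    then have "chat * p * L \<le> (1 / 2) * (1 / 2) * L" using L0 by (intro mult_right_mono) auto
    then show "2 * B < l2_norm (\<beta>1 - \<beta>2)" using L0 by (simp add: B_def L_def[symmetric])
  qed
  have "err \<beta>1 \<beta>2 (u1, u2) \<le> B \<or> err \<beta>1 \<beta>2 (u2, u1) \<le> B"
  proof (rule argmin_close[OF samples(2) J S(2) _ _ _ beta_dim up lo p(1) cardJ
        grid_carrier[OF v(1,2)] g1(1) g2(1) g1(2) g2(2) B amin])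
    show "x i \<in> carrier_vec k" if "i \<in> Splus" for i using xc that by simp
    show "y i = x i \<bullet> \<beta>1" if "i \<in> J1" for i using y[of i] that by (simp add: J1_def)
    show "y i = x i \<bullet> \<beta>2" if "i \<in> J2" for i using y[of i] that by (simp add: J2_def)
  qed
  then show ?thesis by (simp add: B_def p_def L_def)
qed

end

section \<open>The good event and the main result\<close>

lemma coordinate_measurable_vimage_algebra:
  assumes "i \<in> I"
  shows "(\<lambda>\<omega>. F i \<omega>) \<in> borel_measurable
    (vimage_algebra S (\<lambda>\<omega>. \<lambda>i\<in>I. F i \<omega>) (Pi\<^sub>M I (\<lambda>_. borel)))"
proof -
  let ?L = "vimage_algebra S (\<lambda>\<omega>. \<lambda>i\<in>I. F i \<omega>) (Pi\<^sub>M I (\<lambda>_. borel))"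
  have "(\<lambda>\<omega>. \<lambda>i\<in>I. F i \<omega>) \<in> ?L \<rightarrow>\<^sub>M Pi\<^sub>M I (\<lambda>_. borel)"
    by (rule measurable_vimage_algebra1) (auto simp: space_PiM)
  moreover have "(\<lambda>f. f i) \<in> borel_measurable (Pi\<^sub>M I (\<lambda>_. borel))"
    using assms by (rule measurable_component_singleton)
  ultimately have "(\<lambda>\<omega>. (\<lambda>i\<in>I. F i \<omega>) i) \<in> borel_measurable ?L" by (rule measurable_compose)
  then show ?thesis using assms by simp
qed

lemma exp_minus_le:
  assumes "1 \<le> (k :: nat)"
  shows "exp (- real k) \<le> 2 / (real k)\<^sup>2"
proof -
  have "(real k)\<^sup>2 / 2 \<le> exp (real k)" using exp_lower_Taylor_quadratic[of "real k"] by simp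
  then show ?thesis using assms by (simp add: exp_minus field_simps)
qed

context noiseless_mlr
begin

text \<open>The bounds hold for each fixed labelling; since the labels are independent of the covariates,
  the good events may be glued over the finitely many labellings.\<close>

lemma good_event:
  assumes N: "sphere_net k N" and D: "1 \<le> D" "real (card N) \<le> D ^ k"
    and cov: "2500 * (ln D + 1) * real k \<le> p1 * real (card Splus)"
      "2500 * (ln D + 1) * real k \<le> p2 * real (card Splus)"
    and \<eta>: "0 < \<eta>" "\<eta> \<le> 1"
    and mom: "24000000 * (ln D + 1) * real k \<le> real (card Sstar) * \<eta>\<^sup>2"
      "24000000 * (ln D + 1) * real k * ln (real (card Sstar)) \<le> real (card Sstar) * \<eta>"
      "real k \<le> real (card Sstar)"
  shows "\<exists>E\<in>events. 1 - 14 / (real k)\<^sup>2 \<le> prob E \<and> (\<forall>\<omega>\<in>E. \<omega> \<in> space M \<and>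
    moment_good N Sstar (\<lambda>i. if Z i \<omega> = 1 then \<beta>1 else \<beta>2) \<eta> (\<lambda>i. X i \<omega>) \<and>
    covariance_good N {i \<in> Splus. Z i \<omega> = 1} (\<lambda>i. X i \<omega>) \<and>
    covariance_good N {i \<in> Splus. Z i \<omega> = 0} (\<lambda>i. X i \<omega>))"
proof -
  let ?I = "Sstar \<union> Splus"
  define LZ where "LZ = vimage_algebra (space M) (\<lambda>\<omega>. \<lambda>i\<in>?I. Z i \<omega>) (Pi\<^sub>M ?I (\<lambda>_. borel))"
  define LX where "LX = vimage_algebra (space M) (\<lambda>\<omega>. \<lambda>(i, j)\<in>?I \<times> {..<k}. X i \<omega> $ j)
    (Pi\<^sub>M (?I \<times> {..<k}) (\<lambda>_. borel))"
  have sp: "space LZ = space M" "space LX = space M" by (auto simp: LZ_def LX_def)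
  have ind: "indep_set (sets LZ) (sets LX)" using Z_indep by (simp only: LZ_def LX_def)
  have ev: "sets LZ \<subseteq> events" "sets LX \<subseteq> events"
    using indep_setD_ev1[OF ind] indep_setD_ev2[OF ind] by auto
  have Zm: "(\<lambda>\<omega>. Z i \<omega>) \<in> borel_measurable LZ" if "i \<in> ?I" for i
    unfolding LZ_def using that by (rule coordinate_measurable_vimage_algebra)
  have Xm: "(\<lambda>\<omega>. X i \<omega> $ j) \<in> borel_measurable LX" if "i \<in> ?I" "j < k" for i j
    unfolding LX_def
    using coordinate_measurable_vimage_algebra[of "(i, j)" "?I \<times> {..<k}" "\<lambda>(i, j) \<omega>. X i \<omega> $ j" "space M"] that
    by (simp add: case_prod_beta')
  define b where "b z i = (if z i = 1 then \<beta>1 else \<beta>2)" for z :: "nat \<Rightarrow> real" and i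
  define J where "J c z = {i \<in> Splus. z i = c}" for c :: real and z :: "nat \<Rightarrow> real"
  define Az where "Az z = {\<omega> \<in> space M. \<forall>i\<in>?I. Z i \<omega> = z i}" for z
  define Gm where "Gm z = {\<omega> \<in> space M. moment_good N Sstar (b z) \<eta> (\<lambda>i. X i \<omega>)}" for z
  define Gc where "Gc c z = {\<omega> \<in> space M. covariance_good N (J c z) (\<lambda>i. X i \<omega>)}" for c z
  define Gz where "Gz z = Gm z \<inter> (Gc 1 z \<inter> Gc 0 z)" for z
  \<comment> \<open>Only labellings that occur at some outcome are kept: for these the exact
    fractions hold, and with them the lower bounds on the sizes of the label classes.\<close>
  define ZZ where "ZZ = {z \<in> ?I \<rightarrow>\<^sub>E {0, 1}. Az z \<noteq> {}}"
  have finI: "finite ?I" using samples by simp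
  have finZZ: "finite ZZ" unfolding ZZ_def by (intro finite_Collect_conjI disjI1) (auto intro!: finite_PiE finI simp: samples)
  have Az: "Az z \<in> sets LZ" for z
  proof -
    have "{\<omega> \<in> space LZ. \<forall>i\<in>?I. Z i \<omega> = z i} \<in> sets LZ"
    proof (rule sets.sets_Collect_finite_All[OF _ finI])
      fix i assume "i \<in> ?I"
      from Zm[OF this] show "{\<omega> \<in> space LZ. Z i \<omega> = z i} \<in> sets LZ" by measurable
    qed
    then show ?thesis by (simp add: Az_def sp)
  qed
  have Nc: "finite N" "N \<subseteq> carrier_vec k" using N by (auto simp: sphere_net_def)
  have bc: "b z i \<in> carrier_vec k" "b z i \<bullet> b z i = 1" for z i
    using beta_dim beta_unit by (auto simp: b_def)
  have Gm: "Gm z \<in> sets LX" for z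
    using good_measurable(2)[of Sstar k X LX N "b z" \<eta>] Xm samples Nc bc by (simp add: Gm_def sp)
  have Gc: "Gc c z \<in> sets LX" for c z
    using good_measurable(1)[of "J c z" k X LX N "b z"] Xm samples Nc bc by (simp add: Gc_def sp J_def)
  have Gz: "Gz z \<in> sets LX" for z unfolding Gz_def using Gm Gc by blast
  have frac: "real (card (J 1 z)) = p1 * real (card Splus)" "real (card (J 0 z)) = p2 * real (card Splus)"
    if z: "z \<in> ZZ" for z
  proof -
    obtain \<omega> where "\<omega> \<in> Az z" using z by (auto simp: ZZ_def)
    then have \<omega>: "\<omega> \<in> space M" "Z i \<omega> = z i" if "i \<in> ?I" for i using that by (auto simp: Az_def)
    then have "J c z = {i \<in> Splus. Z i \<omega> = c}" for c by (auto simp: J_def)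
    then show "real (card (J 1 z)) = p1 * real (card Splus)" "real (card (J 0 z)) = p2 * real (card Splus)"
      using Z_fraction[of Splus \<omega>] \<open>\<omega> \<in> Az z\<close> by (auto simp: Az_def)
  qed
  have J_sub: "J c z \<subseteq> ?I" for c z by (auto simp: J_def)
  have prob_Gz: "1 - 14 / (real k)\<^sup>2 \<le> prob (Gz z)" if z: "z \<in> ZZ" for z
  proof -
    have neg: "prob {\<omega> \<in> space M. \<not> P \<omega>} = 1 - prob {\<omega> \<in> space M. P \<omega>}"
      if "{\<omega> \<in> space M. P \<omega>} \<in> events" for P
      using prob_neg[OF that] .
    have e: "Gm z \<in> events" "Gc c z \<in> events" for c using Gm Gc ev by auto
    have "prob {\<omega> \<in> space M. \<not> moment_good N Sstar (b z) \<eta> (\<lambda>i. X i \<omega>)}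
        \<le> 2 * exp (- real k) + 2 / real k ^ 3"
      by (rule prob_moment_bad[OF N D _ _ _ dim_ge_2 \<eta> mom]) (use bc in auto)
    then have 1: "1 - prob (Gm z) \<le> 2 * exp (- real k) + 2 / real k ^ 3"
      using neg[OF e(1)[unfolded Gm_def]] by (simp add: Gm_def)
    have 2: "1 - prob (Gc c z) \<le> 2 * exp (- real k)" if "c \<in> {0, 1}" for c
    proof -
      have "2500 * (ln D + 1) * real k \<le> real (card (J c z))" using cov frac[OF z] that by auto
      from prob_covariance_bad[OF N D J_sub this] show ?thesis
        using neg[OF e(2)[of c, unfolded Gc_def]] by (simp add: Gc_def)
    qed
    have compl: "space M - Gz z = (space M - Gm z) \<union> ((space M - Gc 1 z) \<union> (space M - Gc 0 z))"
      by (auto simp: Gz_def)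
    have "prob (space M - Gz z) \<le> prob (space M - Gm z) + prob ((space M - Gc 1 z) \<union> (space M - Gc 0 z))"
      unfolding compl using e by (intro measure_Un_le) auto
    moreover have "prob ((space M - Gc 1 z) \<union> (space M - Gc 0 z))
        \<le> prob (space M - Gc 1 z) + prob (space M - Gc 0 z)"
      using e by (intro measure_Un_le) auto
    moreover have "Gz z \<in> events" using Gz ev by auto
    ultimately have "1 - prob (Gz z) \<le> (1 - prob (Gm z)) + ((1 - prob (Gc 1 z)) + (1 - prob (Gc 0 z)))"
      using prob_compl[of "Gz z"] prob_compl[OF e(1)] prob_compl[OF e(2)[of 1]] prob_compl[OF e(2)[of 0]]
      by linarith
    also have "\<dots> \<le> (2 * exp (- real k) + 2 / real k ^ 3) + (2 * exp (- real k) + 2 * exp (- real k))"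
      by (intro add_mono 1 2) auto
    \<comment> \<open>Six exponentials at most \<open>2 / (real k)\<^sup>2\<close> each, and one
      truncation term at most \<open>2 / (real k)\<^sup>2\<close>.\<close>
    also have "\<dots> \<le> 14 / (real k)\<^sup>2"
    proof -
      have "exp (- real k) \<le> 2 / (real k)\<^sup>2" using dim_ge_2 by (intro exp_minus_le) simp
      moreover have "2 / real k ^ 3 \<le> 2 / (real k)\<^sup>2"
        using dim_ge_2 by (intro divide_left_mono power_increasing mult_pos_pos) auto
      ultimately show ?thesis by linarith
    qed
    finally show ?thesis by linarith
  qed
  define E where "E = (\<Union>z\<in>ZZ. Az z \<inter> Gz z)"
  have disj: "disjoint_family_on Az ZZ"
    unfolding disjoint_family_on_def
  proof (intro ballI impI)
    fix z w assume zw: "z \<in> ZZ" "w \<in> ZZ" "z \<noteq> w"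
    then obtain i where "i \<in> ?I" "z i \<noteq> w i"
      unfolding ZZ_def by (metis (no_types, lifting) PiE_ext mem_Collect_eq)
    then show "Az z \<inter> Az w = {}" by (auto simp: Az_def)
  qed
  then have disj': "disjoint_family_on (\<lambda>z. Az z \<inter> Gz z) ZZ"
    by (auto simp: disjoint_family_on_def)
  have Aev: "Az z \<in> events" and AGev: "Az z \<inter> Gz z \<in> events" for z
    using Az[of z] Gz[of z] ev by auto
  have "(\<Union>z\<in>ZZ. Az z) = space M"
  proof
    show "(\<Union>z\<in>ZZ. Az z) \<subseteq> space M" by (auto simp: Az_def)
    show "space M \<subseteq> (\<Union>z\<in>ZZ. Az z)"
    proof
      fix \<omega> assume \<omega>: "\<omega> \<in> space M"
      define z where "z = (\<lambda>i\<in>?I. Z i \<omega>)"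
      have "\<omega> \<in> Az z" using \<omega> by (auto simp: Az_def z_def)
      moreover have "z \<in> ?I \<rightarrow>\<^sub>E {0, 1}" using Z_label \<omega> unfolding z_def by (intro restrict_PiE_iff[THEN iffD2]) blast
      ultimately show "\<omega> \<in> (\<Union>z\<in>ZZ. Az z)" by (auto simp: ZZ_def)
    qed
  qed
  then have total: "(\<Sum>z\<in>ZZ. prob (Az z)) = 1"
    using finite_measure_finite_Union[OF finZZ _ disj] Aev prob_space by auto
  \<comment> \<open>The labelling events partition the space, so their probabilities are averaging
    weights; independence factorises each intersection, and no conditional probability is
    formed.\<close>
  have "1 - 14 / (real k)\<^sup>2 = (\<Sum>z\<in>ZZ. prob (Az z) * (1 - 14 / (real k)\<^sup>2))"
    unfolding sum_distrib_right[symmetric] total by simp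
  also have "\<dots> \<le> (\<Sum>z\<in>ZZ. prob (Az z) * prob (Gz z))"
    by (intro sum_mono mult_left_mono prob_Gz) auto
  also have "\<dots> = (\<Sum>z\<in>ZZ. prob (Az z \<inter> Gz z))"
    by (intro sum.cong refl) (simp add: indep_setD[OF ind Az Gz])
  also have "\<dots> = prob E"
    unfolding E_def by (rule finite_measure_finite_Union[OF finZZ _ disj', symmetric]) (use AGev in blast)
  finally have "1 - 14 / (real k)\<^sup>2 \<le> prob E" .
  moreover have "E \<in> events" unfolding E_def using finZZ AGev by (intro sets.finite_UN) auto
  moreover have "\<omega> \<in> space M \<and>
    moment_good N Sstar (\<lambda>i. if Z i \<omega> = 1 then \<beta>1 else \<beta>2) \<eta> (\<lambda>i. X i \<omega>) \<and>
    covariance_good N {i \<in> Splus. Z i \<omega> = 1} (\<lambda>i. X i \<omega>) \<and>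
    covariance_good N {i \<in> Splus. Z i \<omega> = 0} (\<lambda>i. X i \<omega>)" if \<omega>: "\<omega> \<in> E" for \<omega>
  proof -
    obtain z where z: "\<omega> \<in> Az z" "\<omega> \<in> Gz z" using \<omega> by (auto simp: E_def)
    have Zz: "Z i \<omega> = z i" if "i \<in> ?I" for i using z(1) that by (simp add: Az_def)
    have "J c z = {i \<in> Splus. Z i \<omega> = c}" for c using Zz by (auto simp: J_def)
    moreover have "moment_good N Sstar (b z) \<eta> (\<lambda>i. X i \<omega>)
        = moment_good N Sstar (\<lambda>i. if Z i \<omega> = 1 then \<beta>1 else \<beta>2) \<eta> (\<lambda>i. X i \<omega>)"
      using Zz by (intro moment_good_cong) (simp add: b_def)
    ultimately show ?thesis using z(2) by (simp add: Gz_def Gm_def Gc_def)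
  qed
  ultimately show ?thesis by blast
qed

end

text \<open>Swapping the arguments leaves the loss unchanged, so the data determine the pair only up
  to order. The conclusion therefore asserts a correctly ordered output, and accuracy up to order
  for every output, whatever the choice of eigenvectors and minimisers.\<close>

theorem proposition2:
  fixes chat pmin :: real
  assumes "0 < chat" and "chat < 1 / 2"
  shows "\<exists>c1 > 0. \<exists>c2 > 0. \<exists>c3 > 0.
    \<forall>(M :: 'a measure) k \<beta>1 \<beta>2 p1 p2 Sstar Splus X Z \<delta>.
      noiseless_mlr M k \<beta>1 \<beta>2 p1 p2 Sstar Splus X Z \<longrightarrow>
      min p1 p2 = pmin \<longrightarrow>
      0 < \<delta> \<longrightarrow>
      \<delta> \<le> 2 / 11 * chat * l2_norm (\<beta>1 - \<beta>2) * sqrt (min p1 p2) ^ 3 \<longrightarrow>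
      real (card Sstar) \<ge>
        c1 * (1 / delta_tilde \<delta> \<beta>1 \<beta>2 p1 p2)\<^sup>2 * real k * (ln (real k))\<^sup>2 \<longrightarrow>
      real (card Splus) \<ge> (c2 / min p1 p2) * real k \<longrightarrow>
      (\<exists>E \<in> sets M. measure M E \<ge> 1 - c3 / (real k)\<^sup>2 \<and>
        (\<forall>\<omega>\<in>E.
          let x = (\<lambda>i. X i \<omega>);
              y = (\<lambda>i. response \<beta>1 \<beta>2 (Z i \<omega>) (x i));
              out = init_output k \<delta> Sstar Splus y x;
              bound = chat * min p1 p2 * l2_norm (\<beta>1 - \<beta>2)
          in (\<exists>u \<in> out. err \<beta>1 \<beta>2 u \<le> bound) \<and>
             (\<forall>(u1, u2) \<in> out.
                err \<beta>1 \<beta>2 (u1, u2) \<le> bound \<or> err \<beta>1 \<beta>2 (u2, u1) \<le> bound)))"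
proof -
  obtain D :: real where D: "1 \<le> D" and net: "\<And>k. 0 < k \<Longrightarrow> \<exists>N. sphere_net k N \<and> real (card N) \<le> D ^ k"
    using sphere_net_exists by blast
  define R where "R = 24000000 * (ln D + 1)"
  have lnD: "0 \<le> ln D" using D by simp
  have R: "1 \<le> R" using lnD by (simp add: R_def)
  define C where "C = 3 + 5 * R + 21 * R\<^sup>2"
  have C: "0 < C" using R by (simp add: C_def add_pos_nonneg)
  \<comment> \<open>The constant is chosen before \<open>pmin > 0\<close> is known; the default at 0
    keeps it positive. The factor 3 comes from \<open>3 * pmin / \<eta>\<close>, which is 300 /
    \<delta>^2 and hence at most 384 / \<delta>^2.\<close>
  define c1 where "c1 = C * (1 / (3 * (if pmin = 0 then 1 else pmin)))\<^sup>2"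
  define c2 where "c2 = 2500 * (ln D + 1)"
  have c1: "0 < c1" using C by (simp add: c1_def)
  have c2: "0 < c2" using lnD by (simp add: c2_def)
  show ?thesis
  proof (rule exI[of _ c1], intro conjI c1, rule exI[of _ c2], intro conjI c2,
      rule exI[of _ 14], intro conjI allI impI)
    fix M :: "'a measure" and k \<beta>1 \<beta>2 p1 p2 Sstar Splus X Z \<delta>
    assume mlr: "noiseless_mlr M k \<beta>1 \<beta>2 p1 p2 Sstar Splus X Z"
      and pmin: "min p1 p2 = pmin" and \<delta>: "0 < \<delta>"
      and \<delta>_le: "\<delta> \<le> 2 / 11 * chat * l2_norm (\<beta>1 - \<beta>2) * sqrt (min p1 p2) ^ 3"
      and Sstar: "c1 * (1 / delta_tilde \<delta> \<beta>1 \<beta>2 p1 p2)\<^sup>2 * real k * (ln (real k))\<^sup>2 \<le> real (card Sstar)"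
      and Splus: "c2 / min p1 p2 * real k \<le> real (card Splus)"
    interpret noiseless_mlr M k \<beta>1 \<beta>2 p1 p2 Sstar Splus X Z by (rule mlr)
    have p: "0 < pmin" "pmin \<le> p1" "pmin \<le> p2" "pmin \<le> 1" using fractions pmin by (auto simp: min_def split: if_splits)
    obtain N where N: "sphere_net k N" "real (card N) \<le> D ^ k" using net[of k] dim_ge_2 by auto
    define \<eta> where "\<eta> = pmin * \<delta>\<^sup>2 / 100"
    note dt = delta_tilde_bounds[OF beta_inner fractions \<delta>]
    have \<delta>1: "\<delta> \<le> 1" by (rule grid_resolution_bounds(3)[OF assms \<delta> \<delta>_le])
    have \<eta>: "0 < \<eta>" "\<eta> \<le> 1"
    proof -
      show "0 < \<eta>" using p \<delta> by (simp add: \<eta>_def)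
      have "\<delta>\<^sup>2 \<le> 1" using \<delta> \<delta>1 by (simp add: power_le_one)
      then have "pmin * \<delta>\<^sup>2 \<le> 1 * 1" using p by (intro mult_mono) auto
      then show "\<eta> \<le> 1" by (simp add: \<eta>_def)
    qed
    have n: "C * real k * (ln (real k))\<^sup>2 / \<eta>\<^sup>2 \<le> real (card Sstar)"
    proof -
      have "384 / \<delta>\<^sup>2 \<le> 1 / delta_tilde \<delta> \<beta>1 \<beta>2 p1 p2"
        using dt \<delta> by (simp add: field_simps)
      moreover have "3 * pmin / \<eta> \<le> 384 / \<delta>\<^sup>2" using p \<delta> by (simp add: \<eta>_def field_simps)
      ultimately have "(3 * pmin / \<eta>)\<^sup>2 \<le> (1 / delta_tilde \<delta> \<beta>1 \<beta>2 p1 p2)\<^sup>2"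
        using p \<eta> by (intro power_mono) auto
      then have "c1 * (3 * pmin / \<eta>)\<^sup>2 * real k * (ln (real k))\<^sup>2
          \<le> c1 * (1 / delta_tilde \<delta> \<beta>1 \<beta>2 p1 p2)\<^sup>2 * real k * (ln (real k))\<^sup>2"
        using c1 by (intro mult_right_mono mult_left_mono) auto
      moreover have "c1 * (3 * pmin / \<eta>)\<^sup>2 = C / \<eta>\<^sup>2"
        using p by (simp add: c1_def power_divide power_mult_distrib)
      ultimately show ?thesis using Sstar by simp
    qed
    note rates = sample_size_rates[OF R _ \<eta> n[unfolded C_def]]
    have k2: "2 \<le> real k" using dim_ge_2 by simp
    have Sp: "c2 * real k \<le> pmin * real (card Splus)"
      using Splus p(1) by (simp add: pmin pos_divide_le_eq mult.commute)
    have cov: "c2 * real k \<le> p1 * real (card Splus)" "c2 * real k \<le> p2 * real (card Splus)"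
      using Sp mult_right_mono[OF p(2), of "real (card Splus)"] mult_right_mono[OF p(3), of "real (card Splus)"]
      by linarith+
    obtain E where E: "E \<in> events" "1 - 14 / (real k)\<^sup>2 \<le> prob E"
      "\<And>\<omega>. \<omega> \<in> E \<Longrightarrow> \<omega> \<in> space M \<and>
        moment_good N Sstar (\<lambda>i. if Z i \<omega> = 1 then \<beta>1 else \<beta>2) \<eta> (\<lambda>i. X i \<omega>) \<and>
        covariance_good N {i \<in> Splus. Z i \<omega> = 1} (\<lambda>i. X i \<omega>) \<and>
        covariance_good N {i \<in> Splus. Z i \<omega> = 0} (\<lambda>i. X i \<omega>)"
      using good_event[OF N(1) D N(2) cov[unfolded c2_def] \<eta> rates[OF k2, unfolded R_def]] by blast
    have nonempty: "Sstar \<noteq> {}" "Splus \<noteq> {}"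
    proof -
      show "Sstar \<noteq> {}" using rates(3)[OF k2] k2 by auto
      have "0 < c2 * real k" using c2 k2 by simp
      then show "Splus \<noteq> {}" using Sp by auto
    qed
    have acc: "err \<beta>1 \<beta>2 (u1, u2) \<le> chat * min p1 p2 * l2_norm (\<beta>1 - \<beta>2) \<or>
        err \<beta>1 \<beta>2 (u2, u1) \<le> chat * min p1 p2 * l2_norm (\<beta>1 - \<beta>2)"
      if "\<omega> \<in> E" "(u1, u2) \<in> init_output k \<delta> Sstar Splus (\<lambda>i. response \<beta>1 \<beta>2 (Z i \<omega>) (X i \<omega>)) (\<lambda>i. X i \<omega>)"
      for \<omega> u1 u2
      using init_output_accurate[OF _ assms \<delta> \<delta>_le N(1) nonempty _ _ _ that(2)] E(3)[OF that(1)]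
      by (simp add: \<eta>_def pmin)
    show "\<exists>E\<in>sets M. 1 - 14 / (real k)\<^sup>2 \<le> measure M E \<and>
        (\<forall>\<omega>\<in>E.
          let x = (\<lambda>i. X i \<omega>);
              y = (\<lambda>i. response \<beta>1 \<beta>2 (Z i \<omega>) (x i));
              out = init_output k \<delta> Sstar Splus y x;
              bound = chat * min p1 p2 * l2_norm (\<beta>1 - \<beta>2)
          in (\<exists>u \<in> out. err \<beta>1 \<beta>2 u \<le> bound) \<and>
             (\<forall>(u1, u2) \<in> out.
                err \<beta>1 \<beta>2 (u1, u2) \<le> bound \<or> err \<beta>1 \<beta>2 (u2, u1) \<le> bound))"
    proof (intro bexI[of _ E] conjI E(1,2) ballI)
      fix \<omega> assume \<omega>: "\<omega> \<in> E"
      let ?out = "init_output k \<delta> Sstar Splus (\<lambda>i. response \<beta>1 \<beta>2 (Z i \<omega>) (X i \<omega>)) (\<lambda>i. X i \<omega>)"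
      obtain u1 u2 where u: "(u1, u2) \<in> ?out" using init_output_nonempty[OF dim_ge_2] by (metis ex_in_conv surj_pair)
      have "\<exists>u\<in>?out. err \<beta>1 \<beta>2 u \<le> chat * min p1 p2 * l2_norm (\<beta>1 - \<beta>2)"
        using acc[OF \<omega> u] u init_output_swap[OF u] by blast
      moreover have "\<forall>(u1, u2)\<in>?out. err \<beta>1 \<beta>2 (u1, u2) \<le> chat * min p1 p2 * l2_norm (\<beta>1 - \<beta>2) \<or>
          err \<beta>1 \<beta>2 (u2, u1) \<le> chat * min p1 p2 * l2_norm (\<beta>1 - \<beta>2)"
        using acc[OF \<omega>] by blast
      ultimately show "let x = (\<lambda>i. X i \<omega>);
              y = (\<lambda>i. response \<beta>1 \<beta>2 (Z i \<omega>) (x i));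
              out = init_output k \<delta> Sstar Splus y x;
              bound = chat * min p1 p2 * l2_norm (\<beta>1 - \<beta>2)
          in (\<exists>u \<in> out. err \<beta>1 \<beta>2 u \<le> bound) \<and>
             (\<forall>(u1, u2) \<in> out.
                err \<beta>1 \<beta>2 (u1, u2) \<le> bound \<or> err \<beta>1 \<beta>2 (u2, u1) \<le> bound)"
        unfolding Let_def by blast
    qed
  qed simp
qed

end
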